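(* Let $0\to I\to A\xrightarrow{\eta}B\to0$ be an extension of $C^*$-algebras with Busby invariant $\tau\colon B\to Q(I)=M(I)/I$. Then: (a) $\operatorname{tsr}(A)\le\max(\operatorname{tsr}(B),\operatorname{tsr}(M(I)))$. (b) If both $B$ and $M(I)$ have real rank zero, then $A$ has real rank zero. (c) If both $B$ and $M(I)$ are extremally rich, then the following are equivalent: (i) $\tau$ is extreme-point-preserving; (ii) $\eta(\mathcal E(A))=\mathcal E(B)$; (iii) $A$ is extremally rich.
   Context: $M(I)$ is the multiplier algebra of $I$ and $Q(I)=M(I)/I$ its corona algebra. The Busby invariant $\tau$ is the $*$-homomorphism induced on $B\cong A/I$ by the natural map $A\to M(I)$ (an element of $A$ acts on the ideal $I$ by multiplication). $\widetilde B$ denotes the unitization of $B$ ($\widetilde B=B$ if $B$ is unital). For unital $B$: $\operatorname{tsr}(B)$ is the smallest $d\ge1$ (or $\infty$) such that the tuples $(x_1,\dots,x_d)$ with $\sum x_k^*x_k$ invertible are dense in $B^d$; $B$ has real rank zero if the invertible self-adjoint elements are dense in $B_{\mathrm{sa}}$. For non-unital $B$ these are defined via $\widetilde B$. For unital $B$, $\mathcal E(B)$ is the set of extreme points of the closed unit ball and $B_q^{-1}=B^{-1}\mathcal E(B)B^{-1}$, with $B^{-1}$ the invertible elements. $B$ is extremally rich if $B_q^{-1}$ is dense in $B$; a non-unital $B$ is extremally rich if $\widetilde B$ is. A unital $*$-homomorphism $\varphi\colon B\to D$ is extreme-point-preserving if $\varphi(\mathcal E(B))\subset\mathcal E(D)$.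 Convention: if $A$ is unital, then $B$, $\eta$ and $\tau$ are unital and (c)(i), (c)(ii) are read literally. If $A$ is non-unital, then in (c)(i), (c)(ii) one replaces $A$, $B$ by the algebras $A^+$, $B^+$ obtained by adjoining a new unit (to $B$ even if $B$ is already unital), $\eta$ by its unital extension $A^+\to B^+$, and $\tau$ by its unital extension $B^+\to Q(I)$. *)

theory Defs
  imports "HOL-Analysis.Analysis" "HOL-Library.Extended_Nat"
begin

section \<open>C*-algebras\<close>

class complex_normed_star_algebra = real_normed_algebra +
  fixes scaleC :: "complex \<Rightarrow> 'a \<Rightarrow> 'a" (infixr \<open>*\<^sub>C\<close> 75)
    and adj :: "'a \<Rightarrow> 'a"
  assumes scaleC_add_right: "c *\<^sub>C (x + y) = c *\<^sub>C x + c *\<^sub>C y"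
    and scaleC_add_left: "(c + d) *\<^sub>C x = c *\<^sub>C x + d *\<^sub>C x"
    and scaleC_scaleC: "c *\<^sub>C d *\<^sub>C x = (c * d) *\<^sub>C x"
    and scaleC_of_real: "complex_of_real r *\<^sub>C x = r *\<^sub>R x"
    and mult_scaleC_left: "(c *\<^sub>C x) * y = c *\<^sub>C (x * y)"
    and mult_scaleC_right: "x * (c *\<^sub>C y) = c *\<^sub>C (x * y)"
    and norm_scaleC: "norm (c *\<^sub>C x) = cmod c * norm x"
    and adj_adj: "adj (adj x) = x"
    and adj_add: "adj (x + y) = adj x + adj y"
    and adj_mult: "adj (x * y) = adj y * adj x"
    and adj_scaleC: "adj (c *\<^sub>C x) = cnj c *\<^sub>C adj x"

lemma scaleC_one [simp]: "1 *\<^sub>C x = x"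
  using scaleC_of_real[of 1 x] by simp

lemma scaleC_zero_left [simp]: "0 *\<^sub>C x = 0"
  using scaleC_of_real[of 0 x] by simp

lemma scaleC_zero_right [simp]: "c *\<^sub>C 0 = 0"
  using scaleC_add_right[of c 0 0] by simp

lemma adj_zero [simp]: "adj 0 = 0"
  using adj_add[of 0 0] by simp

lemma adj_minus: "adj (- x) = - adj x"
  using adj_add[of x "- x"] by (metis add.right_inverse adj_zero minus_unique)

lemma adj_diff: "adj (x - y) = adj x - adj y"
  using adj_add[of x "- y"] by (simp add: adj_minus)

lemma scaleC_minus_right: "c *\<^sub>C (- x) = - (c *\<^sub>C x)"
  using scaleC_add_right[of c x "- x"] by (metis add.right_inverse scaleC_zero_right minus_unique)

lemma scaleC_diff_right: "c *\<^sub>C (x - y) = c *\<^sub>C x - c *\<^sub>C y"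
  using scaleC_add_right[of c x "- y"] by (simp add: scaleC_minus_right)

lemma scaleC_minus_left: "(- c) *\<^sub>C x = - (c *\<^sub>C x)"
  using scaleC_add_left[of c "- c" x] by (metis add.right_inverse scaleC_zero_left minus_unique)

lemma scaleC_diff_left: "(c - d) *\<^sub>C x = c *\<^sub>C x - d *\<^sub>C x"
  using scaleC_add_left[of c "- d" x] by (simp add: scaleC_minus_left)

lemma adj_scaleR: "adj (r *\<^sub>R x) = r *\<^sub>R adj x"
  using adj_scaleC[of "complex_of_real r" x] by (simp add: scaleC_of_real)

lemma scaleR_scaleC_commute: "r *\<^sub>R (c *\<^sub>C x) = c *\<^sub>C (r *\<^sub>R x)"
  by (simp add: scaleC_of_real[symmetric] scaleC_scaleC mult.commute)

class cstar_algebra = complex_normed_star_algebra + banach +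
  assumes cstar_identity: "norm (adj x * x) = (norm x)\<^sup>2"

lemma norm_adj [simp]: "norm (adj x) = norm x" for x :: "'a::cstar_algebra"
proof -
  have *: "norm y \<le> norm (adj y)" for y :: 'a
  proof (cases "norm y = 0")
    case False
    have "norm y * norm y \<le> norm (adj y) * norm y"
      using cstar_identity[of y] norm_mult_ineq[of "adj y" y] by (simp add: power2_eq_square)
    then show ?thesis using False by simp
  qed simp
  show ?thesis using *[of x] *[of "adj x"] by (simp add: adj_adj)
qed

lemma mult_left_faithful: "(\<And>b. a * b = 0) \<Longrightarrow> a = 0" for a :: "'a::cstar_algebra"
  using cstar_identity[of "adj a"] by (simp add: adj_adj)

lemma mult_right_faithful: "(\<And>b. b * a = 0) \<Longrightarrow> a = 0" for a :: "'a::cstar_algebra"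
  using cstar_identity[of "a"] by simp

lemma norm_self_adj: "norm (x * adj x) = (norm x)\<^sup>2" for x :: "'a::cstar_algebra"
  using cstar_identity[of "adj x"] by (simp add: adj_adj)

definition star_hom ::
  "('a::complex_normed_star_algebra \<Rightarrow> 'b::complex_normed_star_algebra) \<Rightarrow> bool" where
  "star_hom f \<longleftrightarrow>
     (\<forall>x y. f (x + y) = f x + f y) \<and> (\<forall>c x. f (c *\<^sub>C x) = c *\<^sub>C f x) \<and>
     (\<forall>x y. f (x * y) = f x * f y) \<and> (\<forall>x. f (adj x) = adj (f x))"

section \<open>Units, invertibles and extreme points\<close>

text \<open>Having a unit is a property of the algebra, not part of the type class; the zero algebra
  counts as unital.  On a non-unital algebra \<open>cunit\<close> is unspecified, so the notions
  below that mention it are only meant for unital algebras.\<close>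

definition is_unit_element :: "'a::complex_normed_star_algebra \<Rightarrow> bool" where
  "is_unit_element e \<longleftrightarrow> (\<forall>x. e * x = x \<and> x * e = x)"

definition unital :: "'a::complex_normed_star_algebra itself \<Rightarrow> bool" where
  "unital _ \<longleftrightarrow> (\<exists>e::'a. is_unit_element e)"

definition cunit :: "'a::complex_normed_star_algebra" where
  "cunit = (THE e. is_unit_element e)"

lemma cunit_eqI: "is_unit_element e \<Longrightarrow> cunit = e"
  unfolding cunit_def by (rule the_equality) (auto simp: is_unit_element_def, metis)

definition invertibles :: "'a::complex_normed_star_algebra set" where
  "invertibles = {x. \<exists>y. x * y = cunit \<and> y * x = cunit}"

definition unit_ball_extremes :: "'a::complex_normed_star_algebra set" where
  "unit_ball_extremes = {x. x extreme_point_of cball 0 1}"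

definition quasi_invertibles :: "'a::complex_normed_star_algebra set" where
  "quasi_invertibles =
     {x * v * y | x v y. x \<in> invertibles \<and> v \<in> unit_ball_extremes \<and> y \<in> invertibles}"

definition extreme_point_preserving ::
  "('a::complex_normed_star_algebra \<Rightarrow> 'b::complex_normed_star_algebra) \<Rightarrow> bool" where
  "extreme_point_preserving f \<longleftrightarrow> f ` unit_ball_extremes \<subseteq> unit_ball_extremes"

section \<open>Adjoining a new unit\<close>

datatype 'a unitization = Unitize (alg_part: 'a) (scal_part: complex)

lemma bounded_linear_unitization_action:
  "bounded_linear (\<lambda>b::'a::complex_normed_star_algebra. a * b + c *\<^sub>C b)"
proof (rule bounded_linear_intro)
  fix b :: 'a
  show "norm (a * b + c *\<^sub>C b) \<le> norm b * (norm a + cmod c)"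
    using norm_triangle_ineq[of "a * b" "c *\<^sub>C b"] norm_mult_ineq[of a b]
    by (simp add: norm_scaleC algebra_simps)
qed (simp_all add: algebra_simps scaleC_add_right scaleR_scaleC_commute)

text \<open>The C*-norm of \<open>A\<^sup>+\<close>.  If \<open>A\<close> is not unital, then
  \<open>A\<^sup>+\<close> acts faithfully on \<open>A\<close> and the operator norm dominates
  \<open>\<bar>c\<bar>\<close>; if \<open>A\<close> is unital, then
  \<open>A\<^sup>+\<close> is the direct sum of \<open>A\<close> and the complex numbers via
  \<open>(a, c) \<mapsto> (a + c 1, c)\<close>.  The formula with the maximum covers both cases.\<close>

instantiation unitization :: (cstar_algebra) complex_normed_star_algebra
begin

definition zero_unitization :: "'a unitization" where
  "zero_unitization = Unitize 0 0"
definition plus_unitization :: "'a unitization \<Rightarrow> 'a unitization \<Rightarrow> 'a unitization" where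
  "plus_unitization x y = Unitize (alg_part x + alg_part y) (scal_part x + scal_part y)"
definition minus_unitization :: "'a unitization \<Rightarrow> 'a unitization \<Rightarrow> 'a unitization" where
  "minus_unitization x y = Unitize (alg_part x - alg_part y) (scal_part x - scal_part y)"
definition uminus_unitization :: "'a unitization \<Rightarrow> 'a unitization" where
  "uminus_unitization x = Unitize (- alg_part x) (- scal_part x)"
definition scaleR_unitization :: "real \<Rightarrow> 'a unitization \<Rightarrow> 'a unitization" where
  "scaleR_unitization r x = Unitize (r *\<^sub>R alg_part x) (r *\<^sub>R scal_part x)"
definition scaleC_unitization :: "complex \<Rightarrow> 'a unitization \<Rightarrow> 'a unitization" where
  "scaleC_unitization c x = Unitize (c *\<^sub>C alg_part x) (c * scal_part x)"
definition times_unitization :: "'a unitization \<Rightarrow> 'a unitization \<Rightarrow> 'a unitization" where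
  "times_unitization x y =
     Unitize (alg_part x * alg_part y + scal_part y *\<^sub>C alg_part x + scal_part x *\<^sub>C alg_part y)
       (scal_part x * scal_part y)"
definition adj_unitization :: "'a unitization \<Rightarrow> 'a unitization" where
  "adj_unitization x = Unitize (adj (alg_part x)) (cnj (scal_part x))"
definition norm_unitization :: "'a unitization \<Rightarrow> real" where
  "norm_unitization x =
     max (onorm (\<lambda>b. alg_part x * b + scal_part x *\<^sub>C b)) (cmod (scal_part x))"
definition dist_unitization :: "'a unitization \<Rightarrow> 'a unitization \<Rightarrow> real" where
  "dist_unitization x y = norm (x - y)"
definition sgn_unitization :: "'a unitization \<Rightarrow> 'a unitization" where
  "sgn_unitization x = scaleR (inverse (norm x)) x"
definition uniformity_unitization :: "('a unitization \<times> 'a unitization) filter" where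
  "uniformity_unitization = (INF e\<in>{0<..}. principal {(x, y). dist x y < e})"
definition open_unitization :: "'a unitization set \<Rightarrow> bool" where
  "open_unitization U \<longleftrightarrow> (\<forall>x\<in>U. eventually (\<lambda>(x', y). x' = x \<longrightarrow> y \<in> U) uniformity)"

lemmas unitization_defs = zero_unitization_def plus_unitization_def minus_unitization_def
  uminus_unitization_def scaleR_unitization_def scaleC_unitization_def times_unitization_def
  adj_unitization_def

definition unitization_action :: "'a unitization \<Rightarrow> 'a \<Rightarrow> 'a" where
  "unitization_action x b = alg_part x * b + scal_part x *\<^sub>C b"

lemma norm_unitization_eq: "norm x = max (onorm (unitization_action x)) (cmod (scal_part x))"
  for x :: "'a unitization"
  by (simp add: norm_unitization_def unitization_action_def[abs_def])

lemma blin_action: "bounded_linear (unitization_action x)"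
  unfolding unitization_action_def[abs_def] by (rule bounded_linear_unitization_action)

lemma action_times: "unitization_action (x * y) b = unitization_action x (unitization_action y b)"
  by (simp add: unitization_action_def unitization_defs algebra_simps scaleC_add_right
      mult_scaleC_left mult_scaleC_right scaleC_scaleC)

lemma action_add: "unitization_action (x + y) b = unitization_action x b + unitization_action y b"
  by (simp add: unitization_action_def unitization_defs algebra_simps scaleC_add_left)

lemma action_adj: "adj c * unitization_action x b = adj (unitization_action (adj x) c) * b"
  by (simp add: unitization_action_def unitization_defs algebra_simps adj_add adj_mult adj_adj
      adj_scaleC mult_scaleC_left mult_scaleC_right)

lemma norm_action_le: "norm (unitization_action x b) \<le> norm x * norm b"
proof -
  have "norm (unitization_action x b) \<le> onorm (unitization_action x) * norm b"
    by (rule onorm[OF blin_action])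
  also have "\<dots> \<le> norm x * norm b" by (intro mult_right_mono) (auto simp: norm_unitization_eq)
  finally show ?thesis .
qed

lemma norm_scal_le: "cmod (scal_part x) \<le> norm x" for x :: "'a unitization"
  by (simp add: norm_unitization_eq)

lemma norm_unitization_le:
  assumes "\<And>b. norm (unitization_action x b) \<le> K * norm b" "cmod (scal_part x) \<le> K"
  shows "norm x \<le> K"
  unfolding norm_unitization_eq using assms order_trans[OF norm_ge_zero assms(2)]
  by (auto intro!: onorm_bound)

lemma norm_alg_part_le: "norm (alg_part x) \<le> norm x + cmod (scal_part x)" for x :: "'a unitization"
proof (cases "alg_part x = 0")
  case False
  define a c where "a = alg_part x" "c = scal_part x"
  have "norm a * norm a = norm (a * adj a)" by (simp add: norm_self_adj power2_eq_square)
  also have "a * adj a = unitization_action x (adj a) - c *\<^sub>C adj a"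
    by (simp add: a_c_def unitization_action_def)
  also have "norm \<dots> \<le> norm (unitization_action x (adj a)) + norm (c *\<^sub>C adj a)"
    by (rule norm_triangle_ineq4)
  also have "\<dots> \<le> (norm x + cmod c) * norm a"
    using norm_action_le[of x "adj a"] by (simp add: norm_scaleC algebra_simps)
  finally show ?thesis using False by (simp add: a_c_def)
next
  case True
  then show ?thesis
    using norm_scal_le[of x] by (metis add_nonneg_nonneg norm_ge_zero norm_zero order_trans)
qed

lemma norm_unitization_le_sum: "norm x \<le> norm (alg_part x) + cmod (scal_part x)"
  for x :: "'a unitization"
proof (rule norm_unitization_le)
  fix b
  show "norm (unitization_action x b) \<le> (norm (alg_part x) + cmod (scal_part x)) * norm b"
    unfolding unitization_action_def
    using norm_triangle_ineq[of "alg_part x * b" "scal_part x *\<^sub>C b"] norm_mult_ineq[of "alg_part x" b]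
    by (simp add: norm_scaleC algebra_simps)
qed simp

instance
proof
  fix x y z :: "'a unitization" and r s :: real and c d :: complex
  show "x + y + z = x + (y + z)" "x + y = y + x" "0 + x = x" "- x + x = 0" "x - y = x + - y"
    by (simp_all add: unitization_defs unitization.expand)
  show "r *\<^sub>R (x + y) = r *\<^sub>R x + r *\<^sub>R y" "(r + s) *\<^sub>R x = r *\<^sub>R x + s *\<^sub>R x"
    "r *\<^sub>R s *\<^sub>R x = (r * s) *\<^sub>R x" "1 *\<^sub>R x = x"
    by (simp_all add: unitization_defs unitization.expand algebra_simps)
  show "x * y * z = x * (y * z)" "(x + y) * z = x * z + y * z" "x * (y + z) = x * y + x * z"
    "r *\<^sub>R x * y = r *\<^sub>R (x * y)" "x * r *\<^sub>R y = r *\<^sub>R (x * y)"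
    by (simp_all add: unitization_defs unitization.expand algebra_simps scaleC_add_right
        scaleC_add_left mult_scaleC_left mult_scaleC_right scaleC_scaleC scaleC_of_real[symmetric]
        scaleR_conv_of_real)
  show "c *\<^sub>C (x + y) = c *\<^sub>C x + c *\<^sub>C y" "(c + d) *\<^sub>C x = c *\<^sub>C x + d *\<^sub>C x"
    "c *\<^sub>C d *\<^sub>C x = (c * d) *\<^sub>C x" "complex_of_real r *\<^sub>C x = r *\<^sub>R x"
    "(c *\<^sub>C x) * y = c *\<^sub>C (x * y)" "x * (c *\<^sub>C y) = c *\<^sub>C (x * y)"
    "adj (adj x) = x" "adj (x + y) = adj x + adj y" "adj (x * y) = adj y * adj x"
    "adj (c *\<^sub>C x) = cnj c *\<^sub>C adj x"
    by (simp_all add: unitization_defs unitization.expand algebra_simps scaleC_add_right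
        scaleC_add_left mult_scaleC_left mult_scaleC_right scaleC_scaleC scaleC_of_real
        scaleR_conv_of_real adj_add adj_mult adj_scaleC adj_adj)
  show "dist x y = norm (x - y)" by (rule dist_unitization_def)
  show "sgn x = inverse (norm x) *\<^sub>R x" by (rule sgn_unitization_def)
  show "uniformity = (INF e\<in>{0<..}. principal {(x::'a unitization, y). dist x y < e})"
    by (rule uniformity_unitization_def)
  show "open U \<longleftrightarrow> (\<forall>x\<in>U. eventually (\<lambda>(x', y). x' = x \<longrightarrow> y \<in> U) uniformity)"
    for U :: "'a unitization set"
    by (rule open_unitization_def)
  show "norm x = 0 \<longleftrightarrow> x = 0"
  proof
    assume n: "norm x = 0"
    then have "scal_part x = 0" using norm_scal_le[of x] by simp
    moreover from this have "alg_part x = 0" using norm_alg_part_le[of x] n by simp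
    ultimately show "x = 0" by (simp add: zero_unitization_def unitization.expand)
  next
    assume "x = 0"
    then have "norm x \<le> 0"
      by (intro norm_unitization_le) (simp_all add: zero_unitization_def unitization_action_def)
    moreover have "0 \<le> norm x" using norm_scal_le[of x] by (rule order_trans[OF norm_ge_zero])
    ultimately show "norm x = 0" by simp
  qed
  show "norm (x + y) \<le> norm x + norm y"
  proof (rule norm_unitization_le)
    fix b
    show "norm (unitization_action (x + y) b) \<le> (norm x + norm y) * norm b"
      unfolding action_add
      using norm_triangle_ineq[of "unitization_action x b" "unitization_action y b"]
        norm_action_le[of x b] norm_action_le[of y b] by (simp add: algebra_simps)
    show "cmod (scal_part (x + y)) \<le> norm x + norm y"
      using norm_triangle_ineq[of "scal_part x" "scal_part y"] norm_scal_le[of x] norm_scal_le[of y]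
      by (simp add: unitization_defs)
  qed
  show nC: "norm (c *\<^sub>C x) = cmod c * norm x" for c and x :: "'a unitization"
  proof -
    have le: "norm (c *\<^sub>C x) \<le> cmod c * norm x" for c and x :: "'a unitization"
    proof (rule norm_unitization_le)
      fix b
      have "unitization_action (c *\<^sub>C x) b = c *\<^sub>C unitization_action x b"
        by (simp add: unitization_defs unitization_action_def scaleC_add_right scaleC_scaleC
            mult_scaleC_left)
      then show "norm (unitization_action (c *\<^sub>C x) b) \<le> cmod c * norm x * norm b"
        using norm_action_le[of x b] by (simp add: norm_scaleC mult.assoc mult_left_mono)
      show "cmod (scal_part (c *\<^sub>C x)) \<le> cmod c * norm x"
        using norm_scal_le[of x] by (simp add: unitization_defs norm_mult mult_left_mono)
    qed
    show ?thesis
    proof (cases "c = 0")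
      case True
      have "0 \<le> norm (c *\<^sub>C x)"
        using norm_scal_le[of "c *\<^sub>C x"] by (rule order_trans[OF norm_ge_zero])
      then show ?thesis using le[of c x] True by simp
    next
      case False
      have "norm x = norm (inverse c *\<^sub>C c *\<^sub>C x)"
        using False
        by (simp add: scaleC_unitization_def scaleC_scaleC mult.assoc[symmetric])
      also have "\<dots> \<le> cmod (inverse c) * norm (c *\<^sub>C x)" by (rule le)
      finally have "norm x \<le> inverse (cmod c) * norm (c *\<^sub>C x)" by (simp only: norm_inverse)
      then have "cmod c * norm x \<le> norm (c *\<^sub>C x)" using False by (simp add: field_simps)
      then show ?thesis using le[of c x] by simp
    qed
  qed
  show "norm (r *\<^sub>R x) = \<bar>r\<bar> * norm x"
  proof -
    have "r *\<^sub>R x = complex_of_real r *\<^sub>C x"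
      by (simp add: unitization_defs scaleC_of_real scaleR_conv_of_real)
    then show ?thesis using nC[of "complex_of_real r" x] by simp
  qed
  show "norm (x * y) \<le> norm x * norm y"
  proof (rule norm_unitization_le)
    fix b
    have nn: "0 \<le> norm x" using norm_scal_le[of x] by (rule order_trans[OF norm_ge_zero])
    show "norm (unitization_action (x * y) b) \<le> norm x * norm y * norm b"
      unfolding action_times
      using order_trans[OF norm_action_le mult_left_mono[OF norm_action_le[of y b] nn]]
      by (simp add: mult.assoc)
    show "cmod (scal_part (x * y)) \<le> norm x * norm y"
      using norm_scal_le[of x] norm_scal_le[of y] nn
      by (simp add: unitization_defs norm_mult mult_mono)
  qed
qed

end

instance unitization :: (cstar_algebra) cstar_algebra
proof
  show "norm (adj x * x) = (norm x)\<^sup>2" for x :: "'a unitization"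
  proof -
    have lower: "(norm x)\<^sup>2 \<le> norm (adj x * x)" for x :: "'a unitization"
    proof -
      have "norm x \<le> sqrt (norm (adj x * x))"
      proof (rule norm_unitization_le)
        fix b
        have "(norm (unitization_action x b))\<^sup>2
            = norm (adj (unitization_action x b) * unitization_action x b)"
          by (simp add: cstar_identity)
        also have "adj (unitization_action x b) * unitization_action x b
            = adj (unitization_action (adj x) (unitization_action x b)) * b"
          by (rule action_adj)
        also have "\<dots> = adj (unitization_action (adj x * x) b) * b" by (simp add: action_times)
        also have "norm \<dots> \<le> norm (adj x * x) * norm b * norm b"
          using order_trans[OF norm_mult_ineq mult_right_mono[OF _ norm_ge_zero]]
            norm_action_le[of "adj x * x" b] by (metis norm_adj)
        finally have "(norm (unitization_action x b))\<^sup>2 \<le> (sqrt (norm (adj x * x)) * norm b)\<^sup>2"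
          by (simp add: power_mult_distrib power2_eq_square[of "norm b"] mult.assoc)
        then show "norm (unitization_action x b) \<le> sqrt (norm (adj x * x)) * norm b"
          by (rule power2_le_imp_le) simp
        have "(cmod (scal_part x))\<^sup>2 \<le> norm (adj x * x)"
          using norm_scal_le[of "adj x * x"]
          by (simp add: unitization_defs norm_mult power2_eq_square)
        then show "cmod (scal_part x) \<le> sqrt (norm (adj x * x))" by (rule real_le_rsqrt)
      qed
      then have "(norm x)\<^sup>2 \<le> (sqrt (norm (adj x * x)))\<^sup>2" by (rule power_mono) simp
      then show ?thesis by simp
    qed
    have adj_le: "norm x \<le> norm (adj x)" for x :: "'a unitization"
    proof (cases "norm x = 0")
      case False
      have "norm x * norm x \<le> norm (adj x) * norm x"
        using lower[of x] norm_mult_ineq[of "adj x" x] by (simp add: power2_eq_square)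
      then show ?thesis using False by simp
    qed simp
    have "norm (adj x) = norm x" using adj_le[of x] adj_le[of "adj x"] by (simp add: adj_adj)
    then show ?thesis using lower[of x] norm_mult_ineq[of "adj x" x] by (simp add: power2_eq_square)
  qed
  show "convergent X" if X: "Cauchy X" for X :: "nat \<Rightarrow> 'a unitization"
  proof -
    define a c where "a = (\<lambda>n. alg_part (X n))" "c = (\<lambda>n. scal_part (X n))"
    have C: "\<exists>M. \<forall>m\<ge>M. \<forall>n\<ge>M. norm (X m - X n) < e" if "0 < e" for e
      using that X unfolding Cauchy_def dist_norm by blast
    have cle: "norm (c m - c n) \<le> norm (X m - X n)" for m n
      using norm_scal_le[of "X m - X n"] by (simp add: a_c_def unitization_defs)
    have ale: "norm (a m - a n) \<le> 2 * norm (X m - X n)" for m n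
      using norm_alg_part_le[of "X m - X n"] norm_scal_le[of "X m - X n"]
      by (simp add: a_c_def unitization_defs)
    have "Cauchy c" unfolding Cauchy_def dist_norm using C cle by (meson le_less_trans)
    then obtain c0 where c0: "c \<longlonglongrightarrow> c0" using Cauchy_convergent convergent_def by blast
    have "Cauchy a" unfolding Cauchy_def dist_norm
    proof (intro allI impI)
      fix e :: real assume "0 < e"
      then obtain M where "\<forall>m\<ge>M. \<forall>n\<ge>M. norm (X m - X n) < e / 2" using C[of "e / 2"] by auto
      then have "norm (a m - a n) < e" if "m \<ge> M" "n \<ge> M" for m n
        using ale[of m n] that by fastforce
      then show "\<exists>M. \<forall>m\<ge>M. \<forall>n\<ge>M. norm (a m - a n) < e" by blast
    qed
    then obtain a0 where a0: "a \<longlonglongrightarrow> a0" using Cauchy_convergent convergent_def by blast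
    have z: "(\<lambda>n. norm (a n - a0) + norm (c n - c0)) \<longlonglongrightarrow> 0"
      using tendsto_add[OF tendsto_norm_zero[OF LIM_zero[OF a0]]
          tendsto_norm_zero[OF LIM_zero[OF c0]]] by simp
    have b: "dist (X n) (Unitize a0 c0) \<le> norm (a n - a0) + norm (c n - c0)" for n
      using norm_unitization_le_sum[of "X n - Unitize a0 c0"]
      by (simp add: dist_norm a_c_def unitization_defs)
    have "\<exists>N. \<forall>n\<ge>N. dist (X n) (Unitize a0 c0) < e" if "0 < e" for e
      using order_tendstoD(2)[OF z that] b unfolding eventually_sequentially
      by (meson le_less_trans)
    then have "X \<longlonglongrightarrow> Unitize a0 c0"
      unfolding tendsto_iff eventually_sequentially by blast
    then show ?thesis unfolding convergent_def by blast
  qed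
qed

lemma is_unit_element_unitization: "is_unit_element (Unitize (0::'a::cstar_algebra) 1)"
  by (simp add: is_unit_element_def unitization_defs unitization.expand)

definition unitization_map ::
  "('a::cstar_algebra \<Rightarrow> 'b::cstar_algebra) \<Rightarrow> 'a unitization \<Rightarrow> 'b unitization" where
  "unitization_map f x = Unitize (f (alg_part x)) (scal_part x)"

definition unital_extension ::
  "('a::cstar_algebra \<Rightarrow> 'd::complex_normed_star_algebra) \<Rightarrow> 'a unitization \<Rightarrow> 'd" where
  "unital_extension f x = f (alg_part x) + scal_part x *\<^sub>C cunit"


section \<open>Stable rank, real rank zero, extremal richness\<close>

text \<open>Each notion is defined for unital algebras first (suffix \<open>_unital\<close>), and for
  a non-unital algebra by passing to its unitization.\<close>

definition tsr_unital :: "'a::complex_normed_star_algebra itself \<Rightarrow> enat" where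
  "tsr_unital _ = Inf {enat d | d. 1 \<le> d \<and>
     (\<forall>(y :: nat \<Rightarrow> 'a) e. 0 < e \<longrightarrow>
        (\<exists>x. (\<forall>k<d. norm (x k - y k) < e) \<and> (\<Sum>k<d. adj (x k) * x k) \<in> invertibles))}"

definition tsr :: "'a::cstar_algebra itself \<Rightarrow> enat" where
  "tsr _ = (if unital TYPE('a) then tsr_unital TYPE('a) else tsr_unital TYPE('a unitization))"

definition real_rank_zero_unital :: "'a::complex_normed_star_algebra itself \<Rightarrow> bool" where
  "real_rank_zero_unital _ \<longleftrightarrow>
     {x::'a. adj x = x} \<subseteq> closure {x. adj x = x \<and> x \<in> invertibles}"

definition real_rank_zero :: "'a::cstar_algebra itself \<Rightarrow> bool" where
  "real_rank_zero _ \<longleftrightarrow>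
     (if unital TYPE('a) then real_rank_zero_unital TYPE('a)
      else real_rank_zero_unital TYPE('a unitization))"

definition extremally_rich_unital :: "'a::complex_normed_star_algebra itself \<Rightarrow> bool" where
  "extremally_rich_unital _ \<longleftrightarrow> closure (quasi_invertibles :: 'a set) = UNIV"

definition extremally_rich :: "'a::cstar_algebra itself \<Rightarrow> bool" where
  "extremally_rich _ \<longleftrightarrow>
     (if unital TYPE('a) then extremally_rich_unital TYPE('a)
      else extremally_rich_unital TYPE('a unitization))"

section \<open>The multiplier algebra\<close>

lift_definition scaleC_blinfun ::
  "complex \<Rightarrow> ('a::complex_normed_star_algebra \<Rightarrow>\<^sub>L 'a) \<Rightarrow> 'a \<Rightarrow>\<^sub>L 'a"
  is "\<lambda>c f x. c *\<^sub>C f x"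
proof -
  fix c and f :: "'a \<Rightarrow> 'a"
  assume "bounded_linear f"
  then interpret f: bounded_linear f .
  obtain K where K: "\<And>x. norm (f x) \<le> norm x * K" using f.bounded by blast
  show "bounded_linear (\<lambda>x. c *\<^sub>C f x)"
    using mult_left_mono[OF K norm_ge_zero[of c]]
    by (intro bounded_linear_intro[of _ "cmod c * K"])
      (simp_all add: f.add f.scaleR scaleC_add_right scaleR_scaleC_commute norm_scaleC
        mult.left_commute)
qed

lift_definition adj_blinfun :: "('a::cstar_algebra \<Rightarrow>\<^sub>L 'a) \<Rightarrow> 'a \<Rightarrow>\<^sub>L 'a"
  is "\<lambda>f x. adj (f (adj x))"
proof -
  fix f :: "'a \<Rightarrow> 'a"
  assume "bounded_linear f"
  then interpret f: bounded_linear f .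
  obtain K where K: "\<And>x. norm (f x) \<le> norm x * K" using f.bounded by blast
  show "bounded_linear (\<lambda>x. adj (f (adj x)))"
    using K[of "adj _"]
    by (intro bounded_linear_intro[of _ K]) (simp_all add: f.add f.scaleR adj_add adj_scaleR)
qed

text \<open>Double centralizers: pairs \<open>(L, R)\<close> of maps with \<open>a L(b) = R(a) b\<close>.
  This identity already makes \<open>L\<close> and \<open>R\<close> complex linear with
  \<open>L(a b) = L(a) b\<close> and \<open>R(a b) = a R(b)\<close>.\<close>

typedef (overloaded) ('i::cstar_algebra) multiplier =
  "{(L, R). \<forall>a b :: 'i. a * blinfun_apply (L :: 'i \<Rightarrow>\<^sub>L 'i) b = blinfun_apply R a * b}"
  by (rule exI[of _ 0]) (simp add: zero_prod_def)

setup_lifting type_definition_multiplier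
lifting_forget blinfun.lifting

lift_definition mult_L :: "'i::cstar_algebra multiplier \<Rightarrow> 'i \<Rightarrow>\<^sub>L 'i" is fst .
lift_definition mult_R :: "'i::cstar_algebra multiplier \<Rightarrow> 'i \<Rightarrow>\<^sub>L 'i" is snd .

lemma multiplier_centralizer: "a * mult_L m b = mult_R m a * b"
  by transfer auto

lemma mult_right_cancel: "(\<And>b. b * x = b * y) \<Longrightarrow> x = y" for x y :: "'a::cstar_algebra"
  using mult_right_faithful[of "x - y"] by (simp add: algebra_simps)

lemma mult_left_cancel: "(\<And>b. x * b = y * b) \<Longrightarrow> x = y" for x y :: "'a::cstar_algebra"
  using mult_left_faithful[of "x - y"] by (simp add: algebra_simps)

lemma mult_L_mult: "mult_L m (a * b) = mult_L m a * b"
  by (rule mult_right_cancel) (simp add: multiplier_centralizer mult.assoc[symmetric])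

lemma mult_R_mult: "mult_R m (a * b) = a * mult_R m b"
  by (rule mult_left_cancel) (simp add: multiplier_centralizer[symmetric] mult.assoc)

lemma mult_L_scaleC: "mult_L m (c *\<^sub>C a) = c *\<^sub>C mult_L m a"
  by (rule mult_right_cancel) (simp add: multiplier_centralizer mult_scaleC_right)

lemma mult_R_scaleC: "mult_R m (c *\<^sub>C a) = c *\<^sub>C mult_R m a"
  by (rule mult_left_cancel) (simp add: multiplier_centralizer[symmetric] mult_scaleC_left)

lemma multiplier_eqI: "mult_L m = mult_L n \<Longrightarrow> m = n"
proof -
  assume L: "mult_L m = mult_L n"
  have "mult_R m a = mult_R n a" for a
    by (rule mult_left_cancel) (simp add: multiplier_centralizer[symmetric] L)
  then have "mult_R m = mult_R n" by (rule blinfun_eqI)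
  with L show "m = n" by transfer (auto simp: prod_eq_iff)
qed

instantiation multiplier :: (cstar_algebra) complex_normed_star_algebra
begin

lift_definition zero_multiplier :: "'a multiplier" is "(0, 0)" by simp
lift_definition plus_multiplier :: "'a multiplier \<Rightarrow> 'a multiplier \<Rightarrow> 'a multiplier"
  is "\<lambda>(L, R) (L', R'). (L + L', R + R')"
  by (auto simp: blinfun.add_left algebra_simps)
lift_definition minus_multiplier :: "'a multiplier \<Rightarrow> 'a multiplier \<Rightarrow> 'a multiplier"
  is "\<lambda>(L, R) (L', R'). (L - L', R - R')"
  by (auto simp: blinfun.diff_left algebra_simps)
lift_definition uminus_multiplier :: "'a multiplier \<Rightarrow> 'a multiplier"
  is "\<lambda>(L, R). (- L, - R)"
  by (auto simp: blinfun.minus_left)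
lift_definition scaleR_multiplier :: "real \<Rightarrow> 'a multiplier \<Rightarrow> 'a multiplier"
  is "\<lambda>r (L, R). (r *\<^sub>R L, r *\<^sub>R R)"
  by (auto simp: blinfun.scaleR_left)
lift_definition scaleC_multiplier :: "complex \<Rightarrow> 'a multiplier \<Rightarrow> 'a multiplier"
  is "\<lambda>c (L, R). (scaleC_blinfun c L, scaleC_blinfun c R)"
  by (auto simp: scaleC_blinfun.rep_eq mult_scaleC_left mult_scaleC_right)
lift_definition times_multiplier :: "'a multiplier \<Rightarrow> 'a multiplier \<Rightarrow> 'a multiplier"
  is "\<lambda>(L, R) (L', R'). (L o\<^sub>L L', R' o\<^sub>L R)"
  by auto
lift_definition adj_multiplier :: "'a multiplier \<Rightarrow> 'a multiplier"
  is "\<lambda>(L, R). (adj_blinfun R, adj_blinfun L)"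
  by (auto simp: adj_blinfun.rep_eq) (metis adj_adj adj_mult)

definition norm_multiplier :: "'a multiplier \<Rightarrow> real" where
  "norm_multiplier m = norm (mult_L m)"
definition dist_multiplier :: "'a multiplier \<Rightarrow> 'a multiplier \<Rightarrow> real" where
  "dist_multiplier m n = norm (m - n)"
definition sgn_multiplier :: "'a multiplier \<Rightarrow> 'a multiplier" where
  "sgn_multiplier m = scaleR (inverse (norm m)) m"
definition uniformity_multiplier :: "('a multiplier \<times> 'a multiplier) filter" where
  "uniformity_multiplier = (INF e\<in>{0<..}. principal {(m, n). dist m n < e})"
definition open_multiplier :: "'a multiplier set \<Rightarrow> bool" where
  "open_multiplier U \<longleftrightarrow> (\<forall>m\<in>U. eventually (\<lambda>(m', n). m' = m \<longrightarrow> n \<in> U) uniformity)"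

lemma mult_L_simps:
  "mult_L 0 = 0" "mult_L (m + n) = mult_L m + mult_L n" "mult_L (m - n) = mult_L m - mult_L n"
  "mult_L (- m) = - mult_L m" "mult_L (r *\<^sub>R m) = r *\<^sub>R mult_L m"
  "mult_L (c *\<^sub>C m) = scaleC_blinfun c (mult_L m)" "mult_L (m * n) = mult_L m o\<^sub>L mult_L n"
  "mult_L (adj m) = adj_blinfun (mult_R m)"
  by (transfer; auto)+

lemma mult_R_simps:
  "mult_R 0 = 0" "mult_R (m + n) = mult_R m + mult_R n" "mult_R (m - n) = mult_R m - mult_R n"
  "mult_R (- m) = - mult_R m" "mult_R (r *\<^sub>R m) = r *\<^sub>R mult_R m"
  "mult_R (c *\<^sub>C m) = scaleC_blinfun c (mult_R m)" "mult_R (m * n) = mult_R n o\<^sub>L mult_R m"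
  "mult_R (adj m) = adj_blinfun (mult_L m)"
  by (transfer; auto)+

lemmas multiplier_apply = mult_L_simps mult_R_simps blinfun.add_left blinfun.diff_left
  blinfun.minus_left blinfun.scaleR_left scaleC_blinfun.rep_eq adj_blinfun.rep_eq

lemma multiplier_eqI': "(\<And>a. mult_L m a = mult_L n a) \<Longrightarrow> m = n" for m n :: "'a multiplier"
  by (intro multiplier_eqI blinfun_eqI)

lemma norm_scaleC_blinfun: "norm (scaleC_blinfun c f) = cmod c * norm f" for f :: "'a \<Rightarrow>\<^sub>L 'a"
proof -
  have le: "norm (scaleC_blinfun c f) \<le> cmod c * norm f" for c and f :: "'a \<Rightarrow>\<^sub>L 'a"
    by (rule norm_blinfun_bound)
      (simp_all add: scaleC_blinfun.rep_eq norm_scaleC mult.assoc mult_left_mono norm_blinfun)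
  show ?thesis
  proof (cases "c = 0")
    case True
    then show ?thesis using le[of c f] by simp
  next
    case False
    have "f = scaleC_blinfun (inverse c) (scaleC_blinfun c f)"
      using False by (intro blinfun_eqI) (simp add: scaleC_blinfun.rep_eq scaleC_scaleC)
    then have "norm f \<le> inverse (cmod c) * norm (scaleC_blinfun c f)"
      using le[of "inverse c" "scaleC_blinfun c f"] by (simp only: norm_inverse)
    then have "cmod c * norm f \<le> norm (scaleC_blinfun c f)" using False by (simp add: field_simps)
    then show ?thesis using le[of c f] by simp
  qed
qed

instance
proof
  fix x y z :: "'a multiplier" and r s :: real and c d :: complex
  show "x + y + z = x + (y + z)" "x + y = y + x" "0 + x = x" "- x + x = 0" "x - y = x + - y"
    "r *\<^sub>R (x + y) = r *\<^sub>R x + r *\<^sub>R y" "(r + s) *\<^sub>R x = r *\<^sub>R x + s *\<^sub>R x"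
    "r *\<^sub>R s *\<^sub>R x = (r * s) *\<^sub>R x" "1 *\<^sub>R x = x"
    "x * y * z = x * (y * z)" "(x + y) * z = x * z + y * z" "x * (y + z) = x * y + x * z"
    "r *\<^sub>R x * y = r *\<^sub>R (x * y)" "x * r *\<^sub>R y = r *\<^sub>R (x * y)"
    "c *\<^sub>C (x + y) = c *\<^sub>C x + c *\<^sub>C y" "(c + d) *\<^sub>C x = c *\<^sub>C x + d *\<^sub>C x"
    "c *\<^sub>C d *\<^sub>C x = (c * d) *\<^sub>C x" "complex_of_real r *\<^sub>C x = r *\<^sub>R x"
    "(c *\<^sub>C x) * y = c *\<^sub>C (x * y)" "x * (c *\<^sub>C y) = c *\<^sub>C (x * y)"
    "adj (adj x) = x" "adj (x + y) = adj x + adj y" "adj (x * y) = adj y * adj x"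
    "adj (c *\<^sub>C x) = cnj c *\<^sub>C adj x"
    by (intro multiplier_eqI';
        simp add: multiplier_apply algebra_simps blinfun.bilinear_simps scaleC_add_right
          scaleC_add_left scaleC_scaleC scaleC_of_real mult_L_scaleC adj_add adj_scaleC adj_adj)+
  show "dist x y = norm (x - y)" by (rule dist_multiplier_def)
  show "sgn x = inverse (norm x) *\<^sub>R x" by (rule sgn_multiplier_def)
  show "uniformity = (INF e\<in>{0<..}. principal {(x::'a multiplier, y). dist x y < e})"
    by (rule uniformity_multiplier_def)
  show "open U \<longleftrightarrow> (\<forall>x\<in>U. eventually (\<lambda>(x', y). x' = x \<longrightarrow> y \<in> U) uniformity)"
    for U :: "'a multiplier set"
    by (rule open_multiplier_def)
  show "norm x = 0 \<longleftrightarrow> x = 0"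
    by (auto simp: norm_multiplier_def mult_L_simps intro: multiplier_eqI)
  show "norm (x + y) \<le> norm x + norm y"
    by (simp add: norm_multiplier_def mult_L_simps norm_triangle_ineq)
  show "norm (r *\<^sub>R x) = \<bar>r\<bar> * norm x" by (simp add: norm_multiplier_def mult_L_simps)
  show "norm (x * y) \<le> norm x * norm y"
    by (simp add: norm_multiplier_def mult_L_simps norm_blinfun_compose)
  show "norm (c *\<^sub>C x) = cmod c * norm x"
    by (simp add: norm_multiplier_def mult_L_simps norm_scaleC_blinfun)
qed

end

lemma norm_mult_R: "norm (mult_R m) = norm m"
proof (rule antisym)
  have "norm (mult_R m a) \<le> norm m * norm a" for a
  proof (cases "mult_R m a = 0")
    case False
    let ?b = "mult_R m a"
    have "norm ?b * norm ?b = norm (?b * adj ?b)" by (simp add: norm_self_adj power2_eq_square)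
    also have "\<dots> = norm (a * mult_L m (adj ?b))" by (simp add: multiplier_centralizer)
    also have "\<dots> \<le> norm a * (norm (mult_L m) * norm (adj ?b))"
      by (intro order_trans[OF norm_mult_ineq] mult_left_mono norm_blinfun norm_ge_zero)
    finally have "norm ?b * norm ?b \<le> norm a * (norm m * norm ?b)"
      by (simp only: norm_adj norm_multiplier_def)
    then have "norm ?b * norm ?b \<le> norm m * norm a * norm ?b" by (simp only: ac_simps)
    then show ?thesis using False by simp
  qed simp
  then show "norm (mult_R m) \<le> norm m" by (intro norm_blinfun_bound) auto
  have "norm (mult_L m a) \<le> norm (mult_R m) * norm a" for a
  proof (cases "mult_L m a = 0")
    case False
    let ?b = "mult_L m a"
    have "norm ?b * norm ?b = norm (adj ?b * ?b)" by (simp add: cstar_identity power2_eq_square)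
    also have "\<dots> = norm (mult_R m (adj ?b) * a)" by (simp add: multiplier_centralizer)
    also have "\<dots> \<le> norm (mult_R m) * norm (adj ?b) * norm a"
      by (intro order_trans[OF norm_mult_ineq] mult_right_mono norm_blinfun norm_ge_zero)
    finally have "norm ?b * norm ?b \<le> norm (mult_R m) * norm ?b * norm a"
      by (simp only: norm_adj)
    then have "norm ?b * norm ?b \<le> norm (mult_R m) * norm a * norm ?b" by (simp only: ac_simps)
    then show ?thesis using False by simp
  qed simp
  then show "norm m \<le> norm (mult_R m)"
    unfolding norm_multiplier_def by (intro norm_blinfun_bound) auto
qed

instance multiplier :: (cstar_algebra) cstar_algebra
proof
  fix m :: "'a multiplier"
  have lower: "(norm m)\<^sup>2 \<le> norm (adj m * m)" for m :: "'a multiplier"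
  proof -
    have "norm (mult_L m a) \<le> sqrt (norm (adj m * m)) * norm a" for a
    proof (rule power2_le_imp_le)
      have "(norm (mult_L m a))\<^sup>2 = norm (adj (mult_L m a) * mult_L m a)"
        by (simp add: cstar_identity)
      also have "\<dots> = norm (adj a * mult_L (adj m * m) a)"
        by (simp add: multiplier_centralizer multiplier_apply adj_mult[symmetric] adj_adj)
      also have "\<dots> \<le> norm (adj a) * (norm (mult_L (adj m * m)) * norm a)"
        by (intro order_trans[OF norm_mult_ineq] mult_left_mono norm_blinfun norm_ge_zero)
      also have "\<dots> = norm (adj m * m) * (norm a)\<^sup>2"
        by (simp add: norm_multiplier_def power2_eq_square)
      finally show "(norm (mult_L m a))\<^sup>2 \<le> (sqrt (norm (adj m * m)) * norm a)\<^sup>2"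
        by (simp add: power_mult_distrib)
    qed simp
    then have "norm m \<le> sqrt (norm (adj m * m))"
      unfolding norm_multiplier_def by (intro norm_blinfun_bound) auto
    then have "(norm m)\<^sup>2 \<le> (sqrt (norm (adj m * m)))\<^sup>2" by (rule power_mono) simp
    then show ?thesis by simp
  qed
  have adj_le: "norm m \<le> norm (adj m)" for m :: "'a multiplier"
  proof (cases "norm m = 0")
    case False
    have "norm m * norm m \<le> norm (adj m) * norm m"
      using lower[of m] norm_mult_ineq[of "adj m" m] by (simp add: power2_eq_square)
    then show ?thesis using False by simp
  qed simp
  have "norm (adj m) = norm m" using adj_le[of m] adj_le[of "adj m"] by (simp add: adj_adj)
  then show "norm (adj m * m) = (norm m)\<^sup>2"
    using lower[of m] norm_mult_ineq[of "adj m" m] by (simp add: power2_eq_square)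
next
  fix X :: "nat \<Rightarrow> 'a multiplier"
  assume X: "Cauchy X"
  have "Cauchy (\<lambda>n. mult_L (X n))"
    using X by (simp add: Cauchy_def dist_norm norm_multiplier_def mult_L_simps)
  then obtain L where L: "(\<lambda>n. mult_L (X n)) \<longlonglongrightarrow> L"
    using Cauchy_convergent convergent_def by blast
  have "Cauchy (\<lambda>n. mult_R (X n))"
    using X unfolding Cauchy_def dist_norm by (simp add: mult_R_simps[symmetric] norm_mult_R)
  then obtain R where R: "(\<lambda>n. mult_R (X n)) \<longlonglongrightarrow> R"
    using Cauchy_convergent convergent_def by blast
  have LR: "a * L b = R a * b" for a b
  proof (rule LIMSEQ_unique)
    show "(\<lambda>n. a * mult_L (X n) b) \<longlonglongrightarrow> a * L b" by (intro tendsto_intros L)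
    show "(\<lambda>n. a * mult_L (X n) b) \<longlonglongrightarrow> R a * b"
      unfolding multiplier_centralizer by (intro tendsto_intros R)
  qed
  define m where "m = Abs_multiplier (L, R)"
  have m: "mult_L m = L" using LR by (simp add: m_def mult_L.rep_eq Abs_multiplier_inverse)
  have "X \<longlonglongrightarrow> m"
    using L unfolding tendsto_iff dist_norm by (simp add: norm_multiplier_def mult_L_simps m)
  then show "convergent X" unfolding convergent_def by blast
qed

lift_definition multiplier_of :: "'i::cstar_algebra \<Rightarrow> 'i multiplier"
  is "\<lambda>i. (blinfun_mult_right i, blinfun_mult_left i)"
  by (simp add: blinfun_mult_right.rep_eq blinfun_mult_left.rep_eq mult.assoc)

lemma mult_L_multiplier_of [simp]: "mult_L (multiplier_of i) a = i * a"
  by transfer (simp add: blinfun_mult_right.rep_eq)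

lemma mult_R_multiplier_of [simp]: "mult_R (multiplier_of i) a = a * i"
  by transfer (simp add: blinfun_mult_left.rep_eq)

lift_definition multiplier_id :: "'i::cstar_algebra multiplier"
  is "(id_blinfun, id_blinfun)" by simp

lemma is_unit_element_multiplier_id: "is_unit_element (multiplier_id :: 'i::cstar_algebra multiplier)"
proof -
  have "mult_L multiplier_id = (id_blinfun :: 'i \<Rightarrow>\<^sub>L 'i)" by transfer simp
  then have "mult_L multiplier_id a = a" for a :: 'i by (simp add: id_blinfun.rep_eq)
  then show ?thesis by (auto simp: is_unit_element_def mult_L_simps intro!: multiplier_eqI')
qed

lemma multiplier_of_algebra:
  "multiplier_of (i + j) = multiplier_of i + multiplier_of j"
  "multiplier_of (i - j) = multiplier_of i - multiplier_of j"
  "multiplier_of 0 = 0" "multiplier_of (- i) = - multiplier_of i"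
  "multiplier_of (c *\<^sub>C i) = c *\<^sub>C multiplier_of i"
  "multiplier_of (r *\<^sub>R i) = r *\<^sub>R multiplier_of i"
  "multiplier_of (adj i) = adj (multiplier_of i)"
  "multiplier_of (i * j) = multiplier_of i * multiplier_of j"
  "m * multiplier_of i = multiplier_of (mult_L m i)"
  "multiplier_of i * m = multiplier_of (mult_R m i)"
  by (rule multiplier_eqI';
      simp add: multiplier_apply algebra_simps mult_scaleC_left adj_mult adj_adj mult_L_mult
        multiplier_centralizer)+

lemma norm_multiplier_of [simp]: "norm (multiplier_of i) = norm i"
proof (rule antisym)
  show "norm (multiplier_of i) \<le> norm i"
    unfolding norm_multiplier_def by (rule norm_blinfun_bound) (simp_all add: norm_mult_ineq)
  show "norm i \<le> norm (multiplier_of i)"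
  proof (cases "i = 0")
    case False
    have "norm i * norm i = norm (mult_L (multiplier_of i) (adj i))"
      by (simp add: norm_self_adj power2_eq_square)
    also have "\<dots> \<le> norm (multiplier_of i) * norm i"
      unfolding norm_multiplier_def by (metis norm_adj norm_blinfun)
    finally show ?thesis using False by simp
  qed simp
qed

lemma closed_range_multiplier_of: "closed (range (multiplier_of :: 'i::cstar_algebra \<Rightarrow> _))"
proof -
  have "complete (range (multiplier_of :: 'i \<Rightarrow> _))"
  proof (rule completeI)
    fix X :: "nat \<Rightarrow> 'i multiplier"
    assume r: "\<forall>n. X n \<in> range multiplier_of" and X: "Cauchy X"
    from r obtain i where i: "X = (\<lambda>n. multiplier_of (i n))" by (auto simp: image_iff) metis
    have "Cauchy i"
      using X by (simp add: Cauchy_def dist_norm i multiplier_of_algebra(2)[symmetric])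
    then obtain j where "i \<longlonglongrightarrow> j" using Cauchy_convergent convergent_def by blast
    then have "X \<longlonglongrightarrow> multiplier_of j"
      by (simp add: tendsto_iff dist_norm i multiplier_of_algebra(2)[symmetric])
    then show "\<exists>l\<in>range multiplier_of. X \<longlonglongrightarrow> l" by blast
  qed
  then show ?thesis by (rule complete_imp_closed)
qed

section \<open>The corona algebra\<close>

lifting_forget multiplier.lifting

lemma multiplier_of_ideal:
  fixes x y m :: "'i::cstar_algebra multiplier"
  assumes "x \<in> range multiplier_of"
  shows "- x \<in> range multiplier_of" "c *\<^sub>C x \<in> range multiplier_of"
    "r *\<^sub>R x \<in> range multiplier_of" "adj x \<in> range multiplier_of"
    "m * x \<in> range multiplier_of" "x * m \<in> range multiplier_of"
    "y \<in> range multiplier_of \<Longrightarrow> x + y \<in> range multiplier_of"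
    "y \<in> range multiplier_of \<Longrightarrow> x - y \<in> range multiplier_of"
  using assms by (auto simp: multiplier_of_algebra(1-8)[symmetric] multiplier_of_algebra(9,10))

lemma zero_in_range_multiplier_of: "0 \<in> range multiplier_of"
  by (metis multiplier_of_algebra(3) rangeI)

quotient_type (overloaded) 'i corona =
  "'i::cstar_algebra multiplier" / "\<lambda>m n. m - n \<in> range multiplier_of"
proof (rule equivpI)
  show "reflp (\<lambda>m n. m - n \<in> range (multiplier_of :: 'i \<Rightarrow> _))"
    by (simp add: reflp_def zero_in_range_multiplier_of)
  show "symp (\<lambda>m n. m - n \<in> range (multiplier_of :: 'i \<Rightarrow> _))"
    by (rule sympI) (drule multiplier_of_ideal(1), simp)
  show "transp (\<lambda>m n. m - n \<in> range (multiplier_of :: 'i \<Rightarrow> _))"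
    by (rule transpI) (drule (1) multiplier_of_ideal(7), simp)
qed

text \<open>The quotient norm is the distance to the ideal.  The quotient is a C*-algebra, but only
  its structure as a normed *-algebra is needed to speak about extreme points of its unit ball.\<close>

instantiation corona :: (cstar_algebra) complex_normed_star_algebra
begin

lift_definition zero_corona :: "'a corona" is 0 .
lift_definition plus_corona :: "'a corona \<Rightarrow> 'a corona \<Rightarrow> 'a corona" is "(+)"
  by (drule (1) multiplier_of_ideal(7)) (simp add: algebra_simps)
lift_definition minus_corona :: "'a corona \<Rightarrow> 'a corona \<Rightarrow> 'a corona" is "(-)"
  by (drule (1) multiplier_of_ideal(8)) (simp add: algebra_simps)
lift_definition uminus_corona :: "'a corona \<Rightarrow> 'a corona" is uminus
  by (drule multiplier_of_ideal(1)) (simp add: algebra_simps)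
lift_definition scaleR_corona :: "real \<Rightarrow> 'a corona \<Rightarrow> 'a corona" is "(*\<^sub>R)"
  by (simp add: scaleR_diff_right[symmetric] multiplier_of_ideal)
lift_definition scaleC_corona :: "complex \<Rightarrow> 'a corona \<Rightarrow> 'a corona" is "(*\<^sub>C)"
  by (simp add: scaleC_diff_right[symmetric] multiplier_of_ideal)
lift_definition times_corona :: "'a corona \<Rightarrow> 'a corona \<Rightarrow> 'a corona" is "(*)"
proof -
  fix m m' n n' :: "'a multiplier"
  assume "m - m' \<in> range multiplier_of" "n - n' \<in> range multiplier_of"
  then have "(m - m') * n + m' * (n - n') \<in> range multiplier_of"
    by (intro multiplier_of_ideal(5-7))
  then show "m * n - m' * n' \<in> range multiplier_of" by (simp add: algebra_simps)
qed
lift_definition adj_corona :: "'a corona \<Rightarrow> 'a corona" is adj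
  by (simp add: adj_diff[symmetric] multiplier_of_ideal)

lift_definition norm_corona :: "'a corona \<Rightarrow> real" is "\<lambda>m. infdist m (range multiplier_of)"
proof -
  have le: "infdist m (range multiplier_of) \<le> infdist n (range multiplier_of)"
    if mn: "m - n \<in> range multiplier_of" for m n :: "'a multiplier"
  proof -
    from mn obtain i where i: "m - n = multiplier_of i" by blast
    have "infdist m (range multiplier_of) \<le> dist n (multiplier_of j)" for j
    proof -
      have "infdist m (range multiplier_of) \<le> dist m (multiplier_of (i + j))"
        by (rule infdist_le) simp
      also have "\<dots> = dist n (multiplier_of j)"
        by (simp add: dist_norm multiplier_of_algebra(1) i[symmetric])
      finally show ?thesis .
    qed
    then show ?thesis by (subst (2) infdist_notempty) (auto intro!: cINF_greatest)
  qed
  fix m n :: "'a multiplier"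
  assume mn: "m - n \<in> range multiplier_of"
  then have "n - m \<in> range multiplier_of" by (drule_tac multiplier_of_ideal(1)) simp
  with mn show "infdist m (range multiplier_of) = infdist n (range multiplier_of)"
    by (intro antisym le)
qed

definition dist_corona :: "'a corona \<Rightarrow> 'a corona \<Rightarrow> real" where
  "dist_corona x y = norm (x - y)"
definition sgn_corona :: "'a corona \<Rightarrow> 'a corona" where
  "sgn_corona x = scaleR (inverse (norm x)) x"
definition uniformity_corona :: "('a corona \<times> 'a corona) filter" where
  "uniformity_corona = (INF e\<in>{0<..}. principal {(x, y). dist x y < e})"
definition open_corona :: "'a corona set \<Rightarrow> bool" where
  "open_corona U \<longleftrightarrow> (\<forall>x\<in>U. eventually (\<lambda>(x', y). x' = x \<longrightarrow> y \<in> U) uniformity)"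

lemma norm_abs_corona_le: "norm (abs_corona m) \<le> norm m"
  using infdist_le[of "multiplier_of 0" "range multiplier_of" m]
  by (simp add: norm_corona.abs_eq multiplier_of_algebra zero_in_range_multiplier_of)

lemma norm_corona_less_rep:
  assumes "norm x < e"
  shows "\<exists>m. x = abs_corona m \<and> norm m < e"
proof -
  obtain m where m: "x = abs_corona m" by (metis Quotient_abs_rep Quotient_corona)
  have "(INF i. dist m (multiplier_of i)) < e"
    using assms by (simp add: m norm_corona.abs_eq infdist_notempty image_image)
  then obtain i where i: "dist m (multiplier_of i) < e"
    by (subst (asm) cINF_less_iff) (auto intro: bdd_belowI[of _ 0])
  have "x = abs_corona (m - multiplier_of i)" by (simp add: m corona.abs_eq_iff)
  with i show ?thesis by (auto simp: dist_norm)
qed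

lemma norm_corona_leI:
  fixes f :: "real \<Rightarrow> real"
  assumes "isCont f 0" "\<And>e. 0 < e \<Longrightarrow> K \<le> f e"
  shows "K \<le> f 0"
proof (rule tendsto_lowerbound)
  show "(f \<longlongrightarrow> f 0) (at_right 0)"
    using assms(1) by (simp add: continuous_within filterlim_at_split)
  show "\<forall>\<^sub>F e in at_right 0. K \<le> f e"
    using assms(2) by (auto simp: eventually_at_filter)
qed simp

instance
proof
  fix x y z :: "'a corona" and r s :: real and c d :: complex
  have R: "m - n \<in> range multiplier_of" if "m = n" for m n :: "'a multiplier"
    using that by (simp add: zero_in_range_multiplier_of)
  show "x + y + z = x + (y + z)" "x + y = y + x" "0 + x = x" "- x + x = 0" "x - y = x + - y"
    "r *\<^sub>R (x + y) = r *\<^sub>R x + r *\<^sub>R y" "(r + s) *\<^sub>R x = r *\<^sub>R x + s *\<^sub>R x"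
    "r *\<^sub>R s *\<^sub>R x = (r * s) *\<^sub>R x" "1 *\<^sub>R x = x"
    "x * y * z = x * (y * z)" "(x + y) * z = x * z + y * z" "x * (y + z) = x * y + x * z"
    "r *\<^sub>R x * y = r *\<^sub>R (x * y)" "x * r *\<^sub>R y = r *\<^sub>R (x * y)"
    "c *\<^sub>C (x + y) = c *\<^sub>C x + c *\<^sub>C y" "(c + d) *\<^sub>C x = c *\<^sub>C x + d *\<^sub>C x"
    "c *\<^sub>C d *\<^sub>C x = (c * d) *\<^sub>C x" "complex_of_real r *\<^sub>C x = r *\<^sub>R x"
    "(c *\<^sub>C x) * y = c *\<^sub>C (x * y)" "x * (c *\<^sub>C y) = c *\<^sub>C (x * y)"
    "adj (adj x) = x" "adj (x + y) = adj x + adj y" "adj (x * y) = adj y * adj x"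
    "adj (c *\<^sub>C x) = cnj c *\<^sub>C adj x"
    by (transfer, rule R, simp add: algebra_simps scaleC_add_right scaleC_add_left scaleC_scaleC
        scaleC_of_real mult_scaleC_left mult_scaleC_right adj_add adj_scaleC adj_adj adj_mult)+
  show "dist x y = norm (x - y)" by (rule dist_corona_def)
  show "sgn x = inverse (norm x) *\<^sub>R x" by (rule sgn_corona_def)
  show "uniformity = (INF e\<in>{0<..}. principal {(x::'a corona, y). dist x y < e})"
    by (rule uniformity_corona_def)
  show "open U \<longleftrightarrow> (\<forall>x\<in>U. eventually (\<lambda>(x', y). x' = x \<longrightarrow> y \<in> U) uniformity)"
    for U :: "'a corona set"
    by (rule open_corona_def)
  show "norm x = 0 \<longleftrightarrow> x = 0"
    by transfer (simp add: in_closed_iff_infdist_zero[OF closed_range_multiplier_of, symmetric])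
  have rep: "\<exists>m. x = abs_corona m \<and> norm m < norm x + e" if "0 < e"
    for x :: "'a corona" and e
    using that by (intro norm_corona_less_rep) simp
  have "norm (x + y) \<le> (norm x + 0) + (norm y + 0)"
  proof (rule norm_corona_leI[where f = "\<lambda>e. (norm x + e) + (norm y + e)"])
    fix e :: real assume "0 < e"
    then obtain m n where mn: "x = abs_corona m" "norm m < norm x + e"
      "y = abs_corona n" "norm n < norm y + e" using rep by meson
    have "norm (x + y) \<le> norm (m + n)"
      unfolding mn plus_corona.abs_eq by (rule norm_abs_corona_le)
    then show "norm (x + y) \<le> (norm x + e) + (norm y + e)"
      using norm_triangle_ineq[of m n] mn(2,4) by linarith
  qed simp
  then show "norm (x + y) \<le> norm x + norm y" by simp
  have "norm (x * y) \<le> (norm x + 0) * (norm y + 0)"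
  proof (rule norm_corona_leI[where f = "\<lambda>e. (norm x + e) * (norm y + e)"])
    fix e :: real assume "0 < e"
    then obtain m n where mn: "x = abs_corona m" "norm m < norm x + e"
      "y = abs_corona n" "norm n < norm y + e" using rep by meson
    have "norm (x * y) \<le> norm (m * n)"
      unfolding mn times_corona.abs_eq by (rule norm_abs_corona_le)
    also have "\<dots> \<le> norm m * norm n" by (rule norm_mult_ineq)
    also have "\<dots> \<le> (norm x + e) * (norm y + e)"
      using mn(2,4) norm_ge_zero[of m] norm_ge_zero[of n] by (intro mult_mono) linarith+
    finally show "norm (x * y) \<le> (norm x + e) * (norm y + e)" .
  qed simp
  then show "norm (x * y) \<le> norm x * norm y" by simp
  show nC: "norm (c *\<^sub>C x) = cmod c * norm x" for c and x :: "'a corona"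
  proof -
    have le: "norm (c *\<^sub>C x) \<le> cmod c * norm x" for c and x :: "'a corona"
    proof -
      have "norm (c *\<^sub>C x) \<le> cmod c * (norm x + 0)"
      proof (rule norm_corona_leI[where f = "\<lambda>e. cmod c * (norm x + e)"])
        fix e :: real assume "0 < e"
        then obtain m where m: "x = abs_corona m" "norm m < norm x + e" using rep by meson
        have "norm (c *\<^sub>C x) \<le> norm (c *\<^sub>C m)"
          unfolding m scaleC_corona.abs_eq by (rule norm_abs_corona_le)
        also have "\<dots> \<le> cmod c * (norm x + e)"
          using m(2) by (simp add: norm_scaleC mult_left_mono)
        finally show "norm (c *\<^sub>C x) \<le> cmod c * (norm x + e)" .
      qed simp
      then show ?thesis by simp
    qed
    show ?thesis
    proof (cases "c = 0")
      case True
      have "0 \<le> norm (c *\<^sub>C x)" by transfer (rule infdist_nonneg)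
      then show ?thesis using le[of c x] True by simp
    next
      case False
      have "x = inverse c *\<^sub>C c *\<^sub>C x"
        using False by transfer (rule R, simp add: scaleC_scaleC)
      then have "norm x \<le> inverse (cmod c) * norm (c *\<^sub>C x)"
        using le[of "inverse c" "c *\<^sub>C x"] by (simp only: norm_inverse)
      then have "cmod c * norm x \<le> norm (c *\<^sub>C x)" using False by (simp add: field_simps)
      then show ?thesis using le[of c x] by simp
    qed
  qed
  have "r *\<^sub>R x = complex_of_real r *\<^sub>C x"
    by transfer (rule R, simp add: scaleC_of_real)
  then show "norm (r *\<^sub>R x) = \<bar>r\<bar> * norm x" using nC[of "complex_of_real r" x] by simp
qed

end

lemma is_unit_element_corona: "is_unit_element (abs_corona multiplier_id)"
proof -
  have "m * multiplier_id = m" "multiplier_id * m = m" for m :: "'a multiplier"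
    using is_unit_element_multiplier_id unfolding is_unit_element_def by auto
  then show ?thesis
    unfolding is_unit_element_def by (metis Quotient_abs_rep Quotient_corona times_corona.abs_eq)
qed

section \<open>Extensions and the Busby invariant\<close>

text \<open>A short exact sequence \<open>0 \<rightarrow> I \<rightarrow> A \<rightarrow> B \<rightarrow> 0\<close>
  with inclusion \<open>\<iota>\<close> and quotient map \<open>\<eta>\<close>.\<close>

definition cstar_extension ::
  "('i::cstar_algebra \<Rightarrow> 'a::cstar_algebra) \<Rightarrow> ('a \<Rightarrow> 'b::cstar_algebra) \<Rightarrow> bool" where
  "cstar_extension \<iota> \<eta> \<longleftrightarrow> star_hom \<iota> \<and> star_hom \<eta> \<and>
     inj \<iota> \<and> surj \<eta> \<and> range \<iota> = {a. \<eta> a = 0}"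

text \<open>The natural map \<open>A \<rightarrow> M(I)\<close> sends \<open>a\<close> to the multiplier whose
  components, seen inside \<open>A\<close>, are left and right multiplication by \<open>a\<close>.
  The lemmas below assume \<open>\<iota>\<close> isometric; every injective *-homomorphism of
  C*-algebras is.\<close>

definition ideal_action ::
  "('i::cstar_algebra \<Rightarrow> 'a::cstar_algebra) \<Rightarrow> 'a \<Rightarrow> 'i multiplier" where
  "ideal_action \<iota> a =
     (THE m. \<forall>i. \<iota> (mult_L m i) = a * \<iota> i \<and> \<iota> (mult_R m i) = \<iota> i * a)"

lemma ideal_action:
  assumes ext: "cstar_extension \<iota> \<eta>" and isom: "\<And>i. norm (\<iota> i) = norm i"
  shows "\<iota> (mult_L (ideal_action \<iota> a) i) = a * \<iota> i"
    and "\<iota> (mult_R (ideal_action \<iota> a) i) = \<iota> i * a"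
proof -
  have hom: "\<iota> (x + y) = \<iota> x + \<iota> y" "\<iota> (c *\<^sub>C x) = c *\<^sub>C \<iota> x" "\<iota> (x * y) = \<iota> x * \<iota> y"
    for x y c using ext by (auto simp: cstar_extension_def star_hom_def)
  have homR: "\<iota> (r *\<^sub>R x) = r *\<^sub>R \<iota> x" for r x
    using hom(2)[of "complex_of_real r" x] by (simp add: scaleC_of_real)
  have inj: "\<iota> x = \<iota> y \<Longrightarrow> x = y" for x y
    using ext by (auto simp: cstar_extension_def dest: injD)
  have ker: "range \<iota> = {a. \<eta> a = 0}" and \<eta>: "\<eta> (x * y) = \<eta> x * \<eta> y" for x y
    using ext by (auto simp: cstar_extension_def star_hom_def)
  have "\<eta> (\<iota> i) = 0" for i using ker by blast
  then have "a * \<iota> i \<in> range \<iota>" "\<iota> i * a \<in> range \<iota>" for i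
    unfolding ker by (simp_all add: \<eta>)
  then have "\<exists>j. \<iota> j = a * \<iota> i" "\<exists>j. \<iota> j = \<iota> i * a" for i
    by (metis imageE)+
  then obtain l r where l: "\<And>i. \<iota> (l i) = a * \<iota> i" and r: "\<And>i. \<iota> (r i) = \<iota> i * a"
    using choice[of "\<lambda>i j. \<iota> j = a * \<iota> i"] choice[of "\<lambda>i j. \<iota> j = \<iota> i * a"] by blast
  have "bounded_linear l"
  proof (rule bounded_linear_intro[of _ "norm a"])
    show "l (x + y) = l x + l y" "l (c *\<^sub>R x) = c *\<^sub>R l x" for x y c
      by (rule inj, simp add: l hom homR algebra_simps)+
    show "norm (l x) \<le> norm x * norm a" for x
      using norm_mult_ineq[of a "\<iota> x"] isom[of "l x"] isom[of x] by (simp add: l mult.commute)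
  qed
  moreover have "bounded_linear r"
  proof (rule bounded_linear_intro[of _ "norm a"])
    show "r (x + y) = r x + r y" "r (c *\<^sub>R x) = c *\<^sub>R r x" for x y c
      by (rule inj, simp add: r hom homR algebra_simps)+
    show "norm (r x) \<le> norm x * norm a" for x
      using norm_mult_ineq[of "\<iota> x" a] isom[of "r x"] isom[of x] by (simp add: r mult.commute)
  qed
  moreover have "i * l j = r i * j" for i j
    by (rule inj) (simp add: l r hom mult.assoc)
  ultimately have "mult_L (Abs_multiplier (Blinfun l, Blinfun r)) i = l i"
    "mult_R (Abs_multiplier (Blinfun l, Blinfun r)) i = r i" for i
    by (simp_all add: mult_L.rep_eq mult_R.rep_eq Abs_multiplier_inverse bounded_linear_Blinfun_apply)
  then obtain m where m: "\<And>i. mult_L m i = l i" "\<And>i. mult_R m i = r i" by blast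
  have "\<exists>!m. \<forall>i. \<iota> (mult_L m i) = a * \<iota> i \<and> \<iota> (mult_R m i) = \<iota> i * a"
  proof (rule ex1I)
    show "\<forall>i. \<iota> (mult_L m i) = a * \<iota> i \<and> \<iota> (mult_R m i) = \<iota> i * a" by (simp add: m l r)
    fix n assume "\<forall>i. \<iota> (mult_L n i) = a * \<iota> i \<and> \<iota> (mult_R n i) = \<iota> i * a"
    then show "n = m" by (intro multiplier_eqI') (auto intro!: inj simp: m l)
  qed
  from theI'[OF this] show "\<iota> (mult_L (ideal_action \<iota> a) i) = a * \<iota> i"
    and "\<iota> (mult_R (ideal_action \<iota> a) i) = \<iota> i * a"
    unfolding ideal_action_def by auto
qed

definition busby ::
  "('i::cstar_algebra \<Rightarrow> 'a::cstar_algebra) \<Rightarrow> ('a \<Rightarrow> 'b::cstar_algebra) \<Rightarrow> 'b \<Rightarrow> 'i corona"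
  where
  "busby \<iota> \<eta> b = abs_corona (ideal_action \<iota> (SOME a. \<eta> a = b))"


lemma busby_eta:
  assumes ext: "cstar_extension \<iota> \<eta>" and isom: "\<And>i. norm (\<iota> i) = norm i"
  shows "busby \<iota> \<eta> (\<eta> a) = abs_corona (ideal_action \<iota> a)"
proof -
  define a' where "a' = (SOME x. \<eta> x = \<eta> a)"
  have "\<eta> a' = \<eta> a" unfolding a'_def by (rule someI) (rule refl)
  moreover have "\<eta> a' = \<eta> (a' - a) + \<eta> a"
    using ext unfolding cstar_extension_def star_hom_def by (metis diff_add_cancel)
  ultimately have "a' - a \<in> range \<iota>" using ext by (auto simp: cstar_extension_def)
  then obtain j where j: "a' - a = \<iota> j" by blast
  have hom: "\<iota> (x + y) = \<iota> x + \<iota> y" "\<iota> (x * y) = \<iota> x * \<iota> y" and inj: "inj \<iota>" for x y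
    using ext by (auto simp: cstar_extension_def star_hom_def)
  have "ideal_action \<iota> a' = ideal_action \<iota> a + multiplier_of j"
  proof (rule multiplier_eqI', rule injD[OF inj])
    fix i
    have "a' = a + \<iota> j" using j by (simp add: algebra_simps)
    then show "\<iota> (mult_L (ideal_action \<iota> a') i) = \<iota> (mult_L (ideal_action \<iota> a + multiplier_of j) i)"
      by (simp add: ideal_action[OF ext isom] mult_L_simps blinfun.add_left hom distrib_right)
  qed
  then show ?thesis by (simp add: busby_def a'_def[symmetric] corona.abs_eq_iff)
qed

end

theory Submission
  imports Defs
begin

text \<open>The algebra \<open>A\<close> is the pullback of \<open>\<tau> : B \<rightarrow> Q(I)\<close> and
  \<open>\<pi> : M(I) \<rightarrow> Q(I)\<close>.  Given \<open>a\<close> in \<open>A\<close>, approximate its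
  image in \<open>B\<close> by a good element \<open>b\<close> and then its image in \<open>M(I)\<close>
  by a good element \<open>m\<close>.  Now \<open>\<pi>(m)\<close> and \<open>\<tau>(b)\<close>
  need not agree, but they are close, and \<open>\<tau>(b)\<close> is itself good: a left invertible tuple,
  an invertible self-adjoint element, or a quasi-invertible element.  In each case good elements that are
  close enough differ by the action of invertible elements near \<open>1\<close>; these lift
  from \<open>Q(I)\<close> to invertible elements of \<open>M(I)\<close> near \<open>1\<close>, which move
  \<open>m\<close> to a good element lying over \<open>\<tau>(b)\<close>.  For quasi-invertible elements,
  uniqueness of the Moore-Penrose inverse makes the two components fit together, and
  \<open>\<tau>(b)\<close> is good exactly because \<open>\<tau>\<close> preserves extreme points.  Extreme
  points of \<open>B\<close> are lifted along \<open>\<eta>\<close> by the same orbit argument followed by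
  polar decomposition.  Conversely, lifted extreme points act on \<open>I\<close> as extreme points of
  \<open>M(I)\<close>, because \<open>I\<close> is essential there.\<close>

section \<open>Unital C*-algebras\<close>

text \<open>The argument runs on \<open>A\<^sup>+\<close> and \<open>B\<^sup>+\<close>: stable rank,
  real rank zero and extremal richness do not change when a unit is adjoined to an algebra that
  already has one, so all combinations of unital and non-unital \<open>A\<close>, \<open>B\<close>
  are treated alike. \<open>M(I)\<close> and \<open>Q(I)\<close> keep their own units.
  \<open>Q(I)\<close> has to be a genuine C*-algebra, because square roots, Moore-Penrose inverses
  and Kadison's description of extreme points are used there too. The order theory rests on the norm
  and on one iteration for square roots; uniqueness of positive roots does the work of functional
  calculus under homomorphisms. The obstacle in (c) is that a factorization \<open>x * v * y\<close>
  of a quasi-invertible element is far from unique, so factorizations over \<open>B\<close> and over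
  \<open>M(I)\<close> cannot be matched over \<open>Q(I)\<close>. Moore-Penrose inverses are unique
  and survive every unital homomorphism. Only the orthogonality of the defect projections can be
  lost under a map that is not onto, and (c)(i) is what secures it for \<tau>.\<close>

class cstar_algebra_1 = cstar_algebra + monoid_mult

lemma is_unit_element_one: "is_unit_element (1::'a::cstar_algebra_1)"
  by (simp add: is_unit_element_def)

lemma cunit_one [simp]: "cunit = (1::'a::cstar_algebra_1)"
  by (rule cunit_eqI) (rule is_unit_element_one)

lemma unital_cstar_algebra_1: "unital TYPE('a::cstar_algebra_1)"
  unfolding unital_def using is_unit_element_one by blast

lemma invertibles_iff: "x \<in> invertibles \<longleftrightarrow> (\<exists>y. x * y = 1 \<and> y * x = 1)"
  for x :: "'a::cstar_algebra_1"
  by (simp add: invertibles_def)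

lemma adj_one [simp]: "adj 1 = (1::'a::cstar_algebra_1)"
  by (metis adj_adj adj_mult mult_1_right)

text \<open>Equality fails in the zero algebra, which must be allowed: if \<open>I\<close> is
  unital, its corona is zero.\<close>

lemma norm_one_le: "norm (1::'a::cstar_algebra_1) \<le> 1"
proof -
  have "norm (1::'a) * norm (1::'a) = norm (1::'a)"
    using cstar_identity[of "1::'a"] by (simp add: power2_eq_square)
  then show ?thesis by (cases "norm (1::'a) = 0") auto
qed

lemma norm_mult_le: "norm x \<le> a \<Longrightarrow> norm y \<le> b \<Longrightarrow> norm (x * y) \<le> a * b"
  for x y :: "'a::real_normed_algebra"
  by (meson mult_mono norm_ge_zero norm_mult_ineq order_trans)

lemma norm_scaleR_one_le: "0 \<le> t \<Longrightarrow> norm (t *\<^sub>R (1::'a::cstar_algebra_1)) \<le> t"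
  using norm_one_le[where 'a='a] by (simp add: mult_left_le)

lemma left_right_inverse_eq: "x * y = 1 \<Longrightarrow> z * x = 1 \<Longrightarrow> z = y" for x :: "'a::monoid_mult"
  by (metis mult.assoc mult_1_left mult_1_right)

lemma invertibles_mult:
  "x \<in> invertibles \<Longrightarrow> y \<in> invertibles \<Longrightarrow> x * y \<in> invertibles" for x :: "'a::cstar_algebra_1"
proof -
  assume "x \<in> invertibles" "y \<in> invertibles"
  then obtain x' y' where "x * x' = 1" "x' * x = 1" "y * y' = 1" "y' * y = 1"
    by (auto simp: invertibles_iff)
  then have "(x * y) * (y' * x') = 1" "(y' * x') * (x * y) = 1"
    by (metis mult.assoc mult_1_left)+
  then show ?thesis unfolding invertibles_iff by blast
qed

text \<open>A right and a left inverse arise as fixed points of the contractions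
  \<open>\<lambda>y. 1 - x * y\<close> and \<open>\<lambda>y. 1 - y * x\<close>, and associativity
  identifies them. The bounds are multiplied by \<open>1 - norm x\<close> to keep division
  out.\<close>

lemma neumann_inverse:
  fixes x :: "'a::cstar_algebra_1"
  assumes "norm x < 1"
  obtains y where "(1 + x) * y = 1" "y * (1 + x) = 1" "norm y * (1 - norm x) \<le> 1"
    "norm (y - 1) * (1 - norm x) \<le> norm x"
proof -
  have "dist (1 - x * y) (1 - x * z) \<le> norm x * dist y z" for y z
    using norm_mult_ineq[of x "z - y"] by (simp add: dist_norm right_diff_distrib norm_minus_commute)
  then have fix1: "\<exists>!y. 1 - x * y = y"
    by (intro banach_fix_type[of "norm x"]) (use assms in auto)
  have "dist (1 - y * x) (1 - z * x) \<le> norm x * dist y z" for y z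
    using norm_mult_ineq[of "z - y" x]
    by (simp add: dist_norm left_diff_distrib norm_minus_commute mult.commute)
  then have fix2: "\<exists>!y. 1 - y * x = y"
    by (intro banach_fix_type[of "norm x"]) (use assms in auto)
  obtain y z where y: "1 - x * y = y" and z: "1 - z * x = z"
    using fix1 fix2 by blast
  have 1: "(1 + x) * y = 1" "z * (1 + x) = 1"
    using y z by (simp_all add: algebra_simps)
  have zy: "z = y" by (rule left_right_inverse_eq[OF 1])
  have "norm y \<le> 1 + norm x * norm y"
    using norm_triangle_ineq4[of 1 "x * y"] norm_mult_ineq[of x y] norm_one_le[where 'a='a] y by simp
  then have 2: "norm y * (1 - norm x) \<le> 1" by (simp add: algebra_simps)
  have "y - 1 = - (x * y)" using y by (simp add: algebra_simps)
  then have "norm (y - 1) \<le> norm x * norm y" using norm_mult_ineq[of x y] by simp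
  then have "norm (y - 1) * (1 - norm x) \<le> norm x * (norm y * (1 - norm x))"
    using assms by (simp add: mult_right_mono mult.assoc[symmetric])
  also have "\<dots> \<le> norm x" using mult_left_mono[OF 2, of "norm x"] by simp
  finally show ?thesis using that 1 2 zy by blast
qed

lemma invertible_near_one:
  "norm x < 1 \<Longrightarrow> 1 + x \<in> invertibles" for x :: "'a::cstar_algebra_1"
  by (meson invertibles_iff neumann_inverse)

section \<open>Square roots\<close>

text \<open>A limit \<open>y\<close> satisfies \<open>y = (1/2) *\<^sub>R (x + y * y)\<close>, that
  is, \<open>(1 - y) * (1 - y) = 1 - x\<close> once there is a unit. The iterates are polynomials in
  \<open>x\<close> with nonnegative coefficients, so the real sequence at \<open>1\<close> majorizes
  all of them; the type class is wide enough to contain the reals.\<close>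

primrec sqrt_iter :: "'a::real_normed_algebra \<Rightarrow> nat \<Rightarrow> 'a" where
  "sqrt_iter x 0 = 0"
| "sqrt_iter x (Suc n) = (1/2) *\<^sub>R (x + sqrt_iter x n * sqrt_iter x n)"

text \<open>Two parameters serve two purposes: \<open>x' = x\<close> lets the limit commute with
  whatever commutes with \<open>x\<close>, and \<open>x' = adj x\<close> gives the relation
  \<open>z * s = adj s * z\<close>, on which the congruences for real rank zero depend.\<close>

lemma sqrt_iter_intertwine: "z * x = x' * z \<Longrightarrow> z * sqrt_iter x n = sqrt_iter x' n * z"
proof (induction n)
  case (Suc n)
  then have "z * (sqrt_iter x n * sqrt_iter x n) = (sqrt_iter x' n * sqrt_iter x' n) * z"
    by (metis mult.assoc)
  then show ?case using Suc by (simp add: algebra_simps)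
qed simp

lemma sqrt_iter_commute: "sqrt_iter x m * sqrt_iter x n = sqrt_iter x n * sqrt_iter x m"
  by (intro sqrt_iter_intertwine sqrt_iter_intertwine[symmetric]) simp

lemma adj_sqrt_iter: "adj (sqrt_iter x n) = sqrt_iter (adj x) n" for x :: "'a::cstar_algebra"
  by (induction n) (auto simp: adj_scaleR adj_add adj_mult)

lemma sqrt_iter_one_bounds: "0 \<le> sqrt_iter (1::real) n" "sqrt_iter (1::real) n \<le> 1"
proof (induction n)
  case (Suc n)
  { case 1 show ?case using Suc by simp }
  { case 2
    have "sqrt_iter (1::real) n * sqrt_iter 1 n \<le> 1 * 1"
      using Suc by (intro mult_mono) auto
    then show ?case by simp }
qed simp_all

lemma sqrt_iter_one_step: "sqrt_iter (1::real) n \<le> sqrt_iter 1 (Suc n)"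
  using zero_le_power2[of "1 - sqrt_iter (1::real) n"]
  by (simp add: power2_eq_square algebra_simps)

lemma norm_sqrt_iter_le:
  assumes "norm x \<le> 1"
  shows "norm (sqrt_iter x n) \<le> norm x"
proof (induction n)
  case (Suc n)
  then have "norm (sqrt_iter x n * sqrt_iter x n) \<le> norm x * 1"
    using assms by (intro norm_mult_le) auto
  then show ?case
    using norm_triangle_ineq[of x "sqrt_iter x n * sqrt_iter x n"] by simp
qed simp

lemma norm_sqrt_iter_le_one:
  assumes "norm x \<le> 1"
  shows "norm (sqrt_iter x n) \<le> sqrt_iter 1 n"
proof (induction n)
  case (Suc n)
  then have "norm (sqrt_iter x n * sqrt_iter x n) \<le> sqrt_iter 1 n * sqrt_iter 1 n"
    by (intro norm_mult_le) auto
  then show ?case using norm_triangle_ineq[of x "sqrt_iter x n * sqrt_iter x n"] assms by simp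
qed simp

text \<open>Consecutive iterates commute, so the difference of their squares factors as
  \<open>(a + b) * (a - b)\<close> and the bound by the real sequence propagates. This reaches
  \<open>norm x = 1\<close>, where no geometric majorant exists.\<close>

lemma norm_sqrt_iter_step:
  assumes "norm x \<le> 1"
  shows "norm (sqrt_iter x (Suc n) - sqrt_iter x n) \<le> sqrt_iter 1 (Suc n) - sqrt_iter 1 n"
proof (induction n)
  case 0
  then show ?case using assms by simp
next
  case (Suc n)
  define a b where "a = sqrt_iter x (Suc n)" "b = sqrt_iter x n"
  define s t :: real where "s = sqrt_iter 1 (Suc n)" "t = sqrt_iter 1 n"
  have ab: "a * b = b * a" unfolding a_b_def by (rule sqrt_iter_commute)
  have "sqrt_iter x (Suc (Suc n)) - a = (1/2) *\<^sub>R (x + a * a) - (1/2) *\<^sub>R (x + b * b)"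
    by (simp add: a_b_def)
  also have "\<dots> = (1/2) *\<^sub>R ((a + b) * (a - b))"
    using ab by (simp add: algebra_simps)
  finally have "norm (sqrt_iter x (Suc (Suc n)) - a) = (1/2) * norm ((a + b) * (a - b))" by simp
  also have "\<dots> \<le> (1/2) * ((s + t) * (s - t))"
    using norm_sqrt_iter_le_one[OF assms, of n] norm_sqrt_iter_le_one[OF assms, of "Suc n"] Suc
    by (intro mult_left_mono norm_mult_le order_trans[OF norm_triangle_ineq] add_mono)
      (auto simp: a_b_def s_t_def)
  also have "\<dots> = (1/2) * (1 + s * s) - (1/2) * (1 + t * t)" by (simp add: algebra_simps)
  also have "\<dots> = sqrt_iter 1 (Suc (Suc n)) - s" by (simp add: s_t_def)
  finally show ?case by (simp only: a_b_def s_t_def)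
qed

lemma norm_sqrt_iter_diff:
  assumes "norm x \<le> 1" "n \<le> m"
  shows "norm (sqrt_iter x m - sqrt_iter x n) \<le> sqrt_iter 1 m - sqrt_iter 1 n"
  using assms(2)
proof (induction m rule: dec_induct)
  case (step m)
  then show ?case
    using norm_sqrt_iter_step[OF assms(1), of m]
      norm_triangle_ineq[of "sqrt_iter x (Suc m) - sqrt_iter x m" "sqrt_iter x m - sqrt_iter x n"]
    by simp
qed simp

lemma Cauchy_sqrt_iter:
  fixes x :: "'a::real_normed_algebra"
  assumes "norm x \<le> 1"
  shows "Cauchy (sqrt_iter x)"
proof -
  have "incseq (sqrt_iter (1::real))" by (intro incseq_SucI sqrt_iter_one_step)
  then have "convergent (sqrt_iter (1::real))"
    using sqrt_iter_one_bounds by (intro Bseq_monoseq_convergent Bseq_eq_bounded)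
      (auto simp: monoseq_iff Bseq_def intro!: exI[of _ 1])
  then have C: "Cauchy (sqrt_iter (1::real))" by (rule convergent_Cauchy)
  show ?thesis unfolding Cauchy_altdef2
  proof (intro allI impI)
    fix e :: real assume "0 < e"
    with C obtain N where N: "\<forall>n\<ge>N. dist (sqrt_iter (1::real) n) (sqrt_iter 1 N) < e"
      unfolding Cauchy_altdef2 by blast
    have "dist (sqrt_iter x n) (sqrt_iter x N) < e" if "N \<le> n" for n
      using norm_sqrt_iter_diff[OF assms that] N[rule_format, OF that] unfolding dist_norm by simp
    then show "\<exists>N. \<forall>n\<ge>N. dist (sqrt_iter x n) (sqrt_iter x N) < e" by blast
  qed
qed

text \<open>The boundary case \<open>norm x = 1\<close> matters: it yields roots of positive
  elements that are not invertible. With \<open>z = 1\<close> the last clause makes \<open>s\<close>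
  self-adjoint whenever \<open>x\<close> is.\<close>

lemma ex_sqrt_one_minus:
  fixes x :: "'a::cstar_algebra_1"
  assumes "norm x \<le> 1"
  obtains s where "s * s = 1 - x" "norm (s - 1) \<le> norm x"
    "\<And>z. z * x = x * z \<Longrightarrow> z * s = s * z" "\<And>z. z * x = adj x * z \<Longrightarrow> z * s = adj s * z"
proof -
  obtain y where y: "sqrt_iter x \<longlonglongrightarrow> y"
    using Cauchy_sqrt_iter[OF assms] Cauchy_convergent convergent_def by blast
  then have "(\<lambda>n. sqrt_iter x (Suc n)) \<longlonglongrightarrow> y" by (rule LIMSEQ_Suc)
  moreover have "(\<lambda>n. sqrt_iter x (Suc n)) \<longlonglongrightarrow> (1/2) *\<^sub>R (x + y * y)"
    unfolding sqrt_iter.simps by (intro tendsto_intros y)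
  ultimately have eq: "y = (1/2) *\<^sub>R (x + y * y)" by (rule LIMSEQ_unique)
  have "2 *\<^sub>R y = 2 *\<^sub>R ((1/2) *\<^sub>R (x + y * y))" by (rule arg_cong[OF eq])
  then have "y + y = x + y * y" by (simp add: scaleR_2)
  then have 1: "(1 - y) * (1 - y) = 1 - x" by (simp add: algebra_simps)
  have adjl: "(\<lambda>n. adj (sqrt_iter x n)) \<longlonglongrightarrow> adj y"
    using y unfolding tendsto_iff dist_norm adj_diff[symmetric] by simp
  have 2: "z * (1 - y) = (1 - y) * z" if "z * x = x * z" for z
  proof -
    have "(\<lambda>n. z * sqrt_iter x n) \<longlonglongrightarrow> z * y" "(\<lambda>n. sqrt_iter x n * z) \<longlonglongrightarrow> y * z"
      by (intro tendsto_intros y)+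
    then have "z * y = y * z"
      using LIMSEQ_unique sqrt_iter_intertwine[OF that] by auto
    then show ?thesis by (simp add: algebra_simps)
  qed
  have 3: "z * (1 - y) = adj (1 - y) * z" if "z * x = adj x * z" for z
  proof -
    have "(\<lambda>n. z * sqrt_iter x n) \<longlonglongrightarrow> z * y" "(\<lambda>n. adj (sqrt_iter x n) * z) \<longlonglongrightarrow> adj y * z"
      by (intro tendsto_intros y adjl)+
    then have "z * y = adj y * z"
      using LIMSEQ_unique sqrt_iter_intertwine[OF that] by (auto simp: adj_sqrt_iter)
    then show ?thesis by (simp add: algebra_simps adj_diff)
  qed
  have "norm y \<le> norm x"
    by (rule tendsto_le[OF _ tendsto_const tendsto_norm[OF y]])
      (auto simp: norm_sqrt_iter_le[OF assms])
  then have "norm ((1 - y) - 1) \<le> norm x" by simp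
  with 1 2 3 show ?thesis using that by blast
qed

section \<open>Positive elements\<close>

text \<open>Defined through the norm, which makes closure under addition immediate.\<close>

definition positive :: "'a::cstar_algebra_1 \<Rightarrow> bool" where
  "positive h \<longleftrightarrow> adj h = h \<and> (\<exists>t. norm (t *\<^sub>R 1 - h) \<le> t)"

lemma positive_adj: "positive h \<Longrightarrow> adj h = h"
  by (simp add: positive_def)

lemma norm_shift_mono:
  fixes h :: "'a::cstar_algebra_1"
  assumes "norm (t *\<^sub>R 1 - h) \<le> t" "t \<le> s"
  shows "norm (s *\<^sub>R 1 - h) \<le> s"
proof -
  have "s *\<^sub>R 1 - h = (s - t) *\<^sub>R 1 + (t *\<^sub>R 1 - h)" by (simp add: algebra_simps)
  then have "norm (s *\<^sub>R 1 - h) \<le> norm ((s - t) *\<^sub>R (1::'a)) + norm (t *\<^sub>R 1 - h)"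
    by (metis norm_triangle_ineq)
  then show ?thesis using norm_scaleR_one_le[of "s - t", where 'a='a] assms by linarith
qed

text \<open>For suitable \<open>t\<close> the element \<open>x = 1 - (1/t) *\<^sub>R h\<close> is a
  contraction, and \<open>sqrt t\<close> times the root of \<open>1 - x\<close> is a root of
  \<open>h\<close>. The root of \<open>1 - x\<close> lies within distance 1 of \<open>1\<close>, so
  after scaling it is positive with bound \<open>sqrt t\<close>.\<close>

lemma positive_sqrt:
  assumes "positive h"
  obtains k where "adj k = k" "h = k * k" "positive k" "\<And>z. z * h = h * z \<Longrightarrow> z * k = k * z"
proof -
  obtain t0 where t0: "norm (t0 *\<^sub>R 1 - h) \<le> t0" using assms positive_def by blast
  define t where "t = max t0 1"
  have t: "0 < t" "norm (t *\<^sub>R 1 - h) \<le> t"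
    using norm_shift_mono[OF t0] by (auto simp: t_def)
  define x where "x = 1 - (1/t) *\<^sub>R h"
  have "x = (1/t) *\<^sub>R (t *\<^sub>R 1 - h)" using t by (simp add: x_def algebra_simps)
  then have "norm x = (1/t) * norm (t *\<^sub>R 1 - h)" using t by simp
  also have "\<dots> \<le> (1/t) * t" using t by (intro mult_left_mono) auto
  finally have "norm x \<le> 1" using t by simp
  then obtain s where s: "s * s = 1 - x" "norm (s - 1) \<le> norm x" "\<And>z. z * x = x * z \<Longrightarrow> z * s = s * z"
    "\<And>z. z * x = adj x * z \<Longrightarrow> z * s = adj s * z" by (rule ex_sqrt_one_minus) blast
  have "adj x = x" using positive_adj[OF assms] by (simp add: x_def adj_diff adj_scaleR)
  then have "adj s = s" using s(4)[of 1] by simp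
  have "norm (sqrt t *\<^sub>R (1 - s)) \<le> sqrt t * 1"
    using s(2) \<open>norm x \<le> 1\<close> t by (simp add: norm_minus_commute)
  show ?thesis
  proof
    show "positive (sqrt t *\<^sub>R s)"
      using \<open>norm (sqrt t *\<^sub>R (1 - s)) \<le> sqrt t * 1\<close> \<open>adj s = s\<close>
      unfolding positive_def by (auto simp: adj_scaleR scaleR_diff_right intro!: exI[of _ "sqrt t"])
    show "adj (sqrt t *\<^sub>R s) = sqrt t *\<^sub>R s" by (simp add: adj_scaleR \<open>adj s = s\<close>)
    show "h = (sqrt t *\<^sub>R s) * (sqrt t *\<^sub>R s)" using t by (simp add: s(1) x_def)
    fix z assume "z * h = h * z"
    then have "z * x = x * z" by (simp add: x_def algebra_simps)
    then show "z * (sqrt t *\<^sub>R s) = (sqrt t *\<^sub>R s) * z" by (simp add: s(3))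
  qed
qed

text \<open>Here \<open>k + i b\<close> is a unitary, so its real and imaginary parts are contractions.\<close>

lemma norm_le_of_sum_squares_one:
  fixes k b :: "'a::cstar_algebra_1"
  assumes "adj k = k" "adj b = b" "k * b = b * k" "k * k + b * b = 1"
  shows "norm b \<le> 1" "norm (k * k - b * b) \<le> 1"
proof -
  define u where "u = k + \<i> *\<^sub>C b"
  have au: "adj u = k - \<i> *\<^sub>C b"
    by (simp add: u_def adj_add adj_scaleC assms scaleC_minus_left)
  have "adj u * u = k * k + b * b"
    by (simp only: au) (simp add: u_def algebra_simps mult_scaleC_left mult_scaleC_right scaleC_scaleC
        scaleC_minus_left scaleC_diff_right scaleC_add_right assms(3))
  then have "(norm u)\<^sup>2 = norm (1::'a)" using cstar_identity[of u] assms(4) by simp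
  then have nu: "norm u \<le> 1" using norm_one_le[where 'a='a]
    by (metis norm_ge_zero power2_le_imp_le power_one zero_le_one)
  have "u - adj u = 2 *\<^sub>R (\<i> *\<^sub>C b)"
    by (simp only: au) (simp add: u_def scaleR_2)
  then have "2 * norm b = norm (u - adj u)" by (simp add: norm_scaleC)
  also have "\<dots> \<le> 2" using norm_triangle_ineq4[of u "adj u"] nu by simp
  finally show "norm b \<le> 1" by simp
  have "u * u + adj u * adj u = 2 *\<^sub>R (k * k - b * b)"
    by (simp only: au) (simp add: u_def algebra_simps mult_scaleC_left mult_scaleC_right scaleC_scaleC
        scaleC_minus_left scaleC_diff_right scaleC_add_right assms(3) scaleR_2)
  then have "2 * norm (k * k - b * b) = norm (u * u + adj u * adj u)" by simp
  also have "\<dots> \<le> norm (u * u) + norm (adj u * adj u)" by (rule norm_triangle_ineq)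
  also have "\<dots> \<le> 1 * 1 + 1 * 1" using nu by (intro add_mono norm_mult_le) auto
  finally show "norm (k * k - b * b) \<le> 1" by simp
qed

lemma norm_one_minus_square:
  fixes k :: "'a::cstar_algebra_1"
  assumes "adj k = k" "norm k \<le> 1"
  shows "norm (1 - k * k) \<le> 1"
proof -
  have "norm (k * k) \<le> 1 * 1" using assms by (intro norm_mult_le)
  then obtain b where b: "b * b = 1 - k * k" "\<And>z. z * (k * k) = (k * k) * z \<Longrightarrow> z * b = b * z"
    "\<And>z. z * (k * k) = adj (k * k) * z \<Longrightarrow> z * b = adj b * z"
    by (metis ex_sqrt_one_minus mult_1_left)
  have "adj b = b" using b(3)[of 1] assms by (simp add: adj_mult)
  moreover have "k * b = b * k" using b(2)[of k] by (simp add: mult.assoc)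
  ultimately have "norm b \<le> 1" using assms b(1) by (intro norm_le_of_sum_squares_one(1)[of k b]) auto
  then have "norm (b * b) \<le> 1 * 1" by (intro norm_mult_le)
  then show ?thesis using b(1) by simp
qed

lemma norm_shift_square:
  fixes k :: "'a::cstar_algebra_1"
  assumes "adj k = k" "norm (k * k) \<le> t"
  shows "norm (t *\<^sub>R 1 - k * k) \<le> t"
proof (cases "t = 0")
  case True
  then show ?thesis using assms by simp
next
  case False
  then have t: "0 < t" using assms(2) norm_ge_zero[of "k * k"] by linarith
  have "(norm k)\<^sup>2 \<le> t" using cstar_identity[of k] assms by simp
  then have "norm k \<le> sqrt t" by (rule real_le_rsqrt)
  then have "norm ((1 / sqrt t) *\<^sub>R k) \<le> 1" using t by simp
  then have "norm (1 - ((1 / sqrt t) *\<^sub>R k) * ((1 / sqrt t) *\<^sub>R k)) \<le> 1"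
    using assms by (intro norm_one_minus_square) (simp_all add: adj_scaleR)
  then have "t * norm (1 - (1 / t) *\<^sub>R (k * k)) \<le> t" using t by (simp add: mult_left_le)
  also have "t * norm (1 - (1 / t) *\<^sub>R (k * k)) = norm (t *\<^sub>R (1 - (1 / t) *\<^sub>R (k * k)))"
    using t by simp
  also have "t *\<^sub>R (1 - (1 / t) *\<^sub>R (k * k)) = t *\<^sub>R 1 - k * k" using t by (simp add: algebra_simps)
  finally show ?thesis .
qed

text \<open>Frees positivity from its existential: any bound on \<open>norm h\<close> can serve as
  \<open>t\<close>, so one \<open>t\<close> can be used along a bounded sequence.\<close>

lemma positive_norm_shift:
  assumes "positive h" "norm h \<le> t"
  shows "norm (t *\<^sub>R 1 - h) \<le> t"
  using assms norm_shift_square by (metis positive_sqrt)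

lemma positive_square: "adj k = k \<Longrightarrow> positive (k * k)" for k :: "'a::cstar_algebra_1"
  unfolding positive_def using norm_shift_square[of k] by (auto simp: adj_mult)

lemma positive_add:
  assumes "positive g" "positive h"
  shows "positive (g + h)"
proof -
  obtain s t where "norm (s *\<^sub>R 1 - g) \<le> s" "norm (t *\<^sub>R 1 - h) \<le> t"
    using assms positive_def by metis
  moreover have "(s + t) *\<^sub>R 1 - (g + h) = (s *\<^sub>R 1 - g) + (t *\<^sub>R 1 - h)"
    by (simp add: algebra_simps)
  ultimately have "norm ((s + t) *\<^sub>R 1 - (g + h)) \<le> s + t"
    by (metis norm_triangle_mono)
  then show ?thesis using assms unfolding positive_def by (metis adj_add)
qed

lemma positive_scaleR:
  assumes "positive h" "0 \<le> r"
  shows "positive (r *\<^sub>R h)"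
proof -
  obtain k where "adj k = k" "h = k * k" using assms(1) by (rule positive_sqrt)
  then show ?thesis
    using positive_square[of "sqrt r *\<^sub>R k"] assms(2) by (simp add: adj_scaleR)
qed

lemma positive_one [simp]: "positive 1"
  using positive_square[of 1] by simp

lemma positive_zero [simp]: "positive 0"
  using positive_square[of 0] by simp

lemma positive_scaleR_one: "0 \<le> r \<Longrightarrow> positive (r *\<^sub>R 1)"
  by (simp add: positive_scaleR)

lemma positive_mult:
  assumes "positive g" "positive h" "g * h = h * g"
  shows "positive (g * h)"
proof -
  obtain k where k: "adj k = k" "g = k * k" "\<And>z. z * g = g * z \<Longrightarrow> z * k = k * z"
    using assms(1) by (rule positive_sqrt) blast
  have kh: "k * h = h * k" using k(3)[of h] assms(3) by simp
  obtain l where l: "adj l = l" "h = l * l" "\<And>z. z * h = h * z \<Longrightarrow> z * l = l * z"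
    using assms(2) by (rule positive_sqrt) blast
  have kl: "k * l = l * k" using l(3) kh by blast
  then have "adj (k * l) = k * l" by (simp add: adj_mult k(1) l(1))
  then have "positive ((k * l) * (k * l))" by (rule positive_square)
  moreover have "(k * l) * (k * l) = k * (l * k) * l" by (simp only: mult.assoc)
  then have "(k * l) * (k * l) = g * h" unfolding kl[symmetric] k(2) l(2) by (simp only: mult.assoc)
  ultimately show ?thesis by simp
qed

lemma positive_LIMSEQ:
  assumes "\<And>n. positive (X n)" "X \<longlonglongrightarrow> h"
  shows "positive h"
proof -
  have "(\<lambda>n. adj (X n)) \<longlonglongrightarrow> adj h"
    using assms(2) unfolding tendsto_iff dist_norm adj_diff[symmetric] by simp
  moreover have "(\<lambda>n. adj (X n)) = X" using assms(1) positive_adj by blast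
  ultimately have adj: "adj h = h" using assms(2) LIMSEQ_unique by metis
  define t where "t = norm h + 1"
  have "\<forall>\<^sub>F n in sequentially. norm (X n) < t"
    using tendsto_norm[OF assms(2)] by (rule order_tendstoD) (simp add: t_def)
  then have "\<forall>\<^sub>F n in sequentially. norm (t *\<^sub>R 1 - X n) \<le> t"
    by eventually_elim (simp add: positive_norm_shift[OF assms(1)])
  moreover have "(\<lambda>n. norm (t *\<^sub>R 1 - X n)) \<longlonglongrightarrow> norm (t *\<^sub>R 1 - h)"
    by (intro tendsto_intros assms(2))
  ultimately have "norm (t *\<^sub>R 1 - h) \<le> t" by (intro tendsto_upperbound) auto
  with adj show ?thesis unfolding positive_def by blast
qed

lemma positive_of_add_scaleR:
  assumes "\<And>e. 0 < e \<Longrightarrow> positive (h + e *\<^sub>R 1)"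
  shows "positive h"
proof (rule positive_LIMSEQ)
  show "positive (h + (1 / real (Suc n)) *\<^sub>R 1)" for n by (rule assms) simp
  have "(\<lambda>n. h + (1 / real (Suc n)) *\<^sub>R 1) \<longlonglongrightarrow> h + 0 *\<^sub>R 1"
    unfolding inverse_eq_divide[symmetric] by (intro tendsto_intros LIMSEQ_inverse_real_of_nat)
  then show "(\<lambda>n. h + (1 / real (Suc n)) *\<^sub>R 1) \<longlonglongrightarrow> h" by simp
qed

lemma positive_one_minus: "adj x = x \<Longrightarrow> norm x \<le> t \<Longrightarrow> positive (t *\<^sub>R 1 - x)"
  unfolding positive_def by (auto intro!: exI[of _ t] simp: adj_diff adj_scaleR)

text \<open>For \<open>0 < s\<close> the roots \<open>k\<close> of \<open>s - h\<close> and
  \<open>l\<close> of \<open>s + h\<close>, scaled by \<open>1 / sqrt (2 * s)\<close>, have squares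
  with sum 1 and difference \<open>h / s\<close>, and the estimate for unitaries bounds the
  difference by 1. The final epsilon covers \<open>t = 0\<close>.\<close>

lemma norm_le_of_positive:
  fixes h :: "'a::cstar_algebra_1"
  assumes "positive (t *\<^sub>R 1 - h)" "positive (t *\<^sub>R 1 + h)" "0 \<le> t"
  shows "norm h \<le> t"
proof -
  have *: "norm h \<le> s" if pos: "positive (s *\<^sub>R 1 - h)" "positive (s *\<^sub>R 1 + h)" and "0 < s" for s
  proof -
    obtain k where k: "adj k = k" "s *\<^sub>R 1 - h = k * k"
      "\<And>z. z * (s *\<^sub>R 1 - h) = (s *\<^sub>R 1 - h) * z \<Longrightarrow> z * k = k * z"
      using positive_sqrt[OF pos(1)] by metis
    obtain l where l: "adj l = l" "s *\<^sub>R 1 + h = l * l"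
      "\<And>z. z * (s *\<^sub>R 1 + h) = (s *\<^sub>R 1 + h) * z \<Longrightarrow> z * l = l * z"
      using positive_sqrt[OF pos(2)] by metis
    have "h * k = k * h" by (rule k(3)) (simp add: algebra_simps)
    then have "k * l = l * k" by (intro l(3)) (simp add: algebra_simps)
    define c where "c = 1 / sqrt (2 * s)"
    have c2: "c * c = 1 / (2 * s)" using \<open>0 < s\<close> by (simp add: c_def)
    have "k * k + l * l = s *\<^sub>R 1 + s *\<^sub>R 1"
      unfolding k(2)[symmetric] l(2)[symmetric] by (simp add: algebra_simps)
    then have 2: "l * l + k * k = (2 * s) *\<^sub>R 1"
      by (simp add: scaleR_add_left[symmetric] add.commute)
    have "norm ((c *\<^sub>R l) * (c *\<^sub>R l) - (c *\<^sub>R k) * (c *\<^sub>R k)) \<le> 1"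
    proof (rule norm_le_of_sum_squares_one(2))
      show "(c *\<^sub>R l) * (c *\<^sub>R l) + (c *\<^sub>R k) * (c *\<^sub>R k) = 1"
        using \<open>0 < s\<close> by (simp add: c2 scaleR_add_right[symmetric] 2)
    qed (simp_all add: adj_scaleR k(1) l(1) \<open>k * l = l * k\<close>)
    also have "(c *\<^sub>R l) * (c *\<^sub>R l) - (c *\<^sub>R k) * (c *\<^sub>R k) = (1 / (2 * s)) *\<^sub>R (l * l - k * k)"
      by (simp add: c2 algebra_simps)
    also have "l * l - k * k = 2 *\<^sub>R h"
      unfolding k(2)[symmetric] l(2)[symmetric] by (simp add: scaleR_2 algebra_simps)
    finally show ?thesis using \<open>0 < s\<close> by simp
  qed
  show ?thesis
  proof (rule field_le_epsilon)
    fix e :: real assume "0 < e"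
    have "positive ((t *\<^sub>R 1 - h) + e *\<^sub>R 1)" "positive ((t *\<^sub>R 1 + h) + e *\<^sub>R 1)"
      using \<open>0 < e\<close> assms by (auto intro!: positive_add positive_scaleR_one)
    then show "norm h \<le> t + e" using assms \<open>0 < e\<close> by (intro *) (auto simp: algebra_simps)
  qed
qed

lemma positive_antisym: "positive h \<Longrightarrow> positive (- h) \<Longrightarrow> h = 0"
  using norm_le_of_positive[of 0 h] by simp

lemma positive_sum_zero: "positive g \<Longrightarrow> positive h \<Longrightarrow> g + h = 0 \<Longrightarrow> g = 0"
  by (metis add_eq_0_iff positive_antisym minus_minus)

lemma positive_inverse:
  assumes "positive h" "h * v = 1" "v * h = 1"
  shows "positive v" "\<And>z. z * h = h * z \<Longrightarrow> z * v = v * z"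
proof -
  show c: "z * v = v * z" if "z * h = h * z" for z
  proof -
    have "v * (z * h) * v = v * (h * z) * v" using that by simp
    then show ?thesis using assms by (simp add: mult.assoc) (simp add: mult.assoc[symmetric])
  qed
  have "adj v * h = 1" using assms positive_adj[OF assms(1)] by (metis adj_mult adj_one)
  then have v: "adj v = v" using assms(2) left_right_inverse_eq by blast
  obtain k where k: "adj k = k" "h = k * k" using assms(1) by (rule positive_sqrt)
  have kv: "k * v = v * k" by (rule c) (simp add: k mult.assoc)
  have "positive ((v * k) * (v * k))"
    by (rule positive_square) (simp add: adj_mult k(1) v kv)
  moreover have "(v * k) * (v * k) = v"
    using assms(3) unfolding k(2) by (metis kv mult.assoc mult_1_right)
  ultimately show "positive v" by simp
qed

lemma positive_invertible:
  assumes "positive h" "0 < e"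
  shows "h + e *\<^sub>R 1 \<in> invertibles"
proof -
  obtain t0 where t0: "norm (t0 *\<^sub>R 1 - h) \<le> t0" using assms(1) positive_def by blast
  define t where "t = max t0 0"
  have t: "norm (t *\<^sub>R 1 - h) \<le> t" "0 \<le> t" using norm_shift_mono[OF t0] by (auto simp: t_def)
  define x where "x = (1 / (t + e)) *\<^sub>R (h - t *\<^sub>R 1)"
  have "norm x = (1 / (t + e)) * norm (t *\<^sub>R 1 - h)"
    using t assms by (simp add: x_def norm_minus_commute)
  also have "\<dots> < 1" using t assms by (simp add: field_simps)
  finally have "1 + x \<in> invertibles" by (rule invertible_near_one)
  then obtain y where y: "(1 + x) * y = 1" "y * (1 + x) = 1" by (auto simp: invertibles_iff)
  have "(t + e) *\<^sub>R (1 + x) = (t + e) *\<^sub>R 1 + (h - t *\<^sub>R 1)"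
    using t assms by (simp add: x_def scaleR_add_right)
  then have "h + e *\<^sub>R 1 = (t + e) *\<^sub>R (1 + x)" by (simp add: algebra_simps)
  then have "(h + e *\<^sub>R 1) * ((1 / (t + e)) *\<^sub>R y) = 1" "((1 / (t + e)) *\<^sub>R y) * (h + e *\<^sub>R 1) = 1"
    using y t assms by simp_all
  then show ?thesis unfolding invertibles_iff by blast
qed

text \<open>Since \<open>r * r = h * h\<close>, formally \<open>r + h\<close> is
  \<open>(r + h) * (r + h)\<close> divided by \<open>2 * r\<close>. As \<open>r\<close> may fail to
  be invertible, \<open>s = r + e\<close> replaces it; then \<open>2 * s * (s + h)\<close> exceeds
  \<open>(s + h) * (s + h)\<close> by the positive element \<open>2 * e * r + e * e\<close>.\<close>

lemma positive_abs_add: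
  assumes "positive r" "adj h = h" "r * r = h * h" "r * h = h * r"
  shows "positive (r + h)"
proof (rule positive_of_add_scaleR)
  fix e :: real assume e: "0 < e"
  define s where "s = r + e *\<^sub>R 1"
  have s: "positive s" using assms e by (auto simp: s_def intro!: positive_add positive_scaleR_one)
  have "s \<in> invertibles" unfolding s_def by (rule positive_invertible[OF assms(1) e])
  then obtain v where v: "s * v = 1" "v * s = 1" by (auto simp: invertibles_iff)
  have sh: "s * h = h * s" using assms by (simp add: s_def algebra_simps)
  define p where "p = s * (s + h)"
  have "p + p = (s + h) * (s + h) + ((e *\<^sub>R r + e *\<^sub>R r) + (e * e) *\<^sub>R 1)"
    using assms by (simp add: p_def s_def algebra_simps)
  moreover have "positive ((s + h) * (s + h) + ((e *\<^sub>R r + e *\<^sub>R r) + (e * e) *\<^sub>R 1))"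
    using e assms positive_adj[OF s]
    by (intro positive_add positive_square positive_scaleR_one positive_scaleR) (auto simp: adj_add)
  ultimately have "positive ((1/2) *\<^sub>R (p + p))" by (simp add: positive_scaleR)
  then have p: "positive p" by (simp add: scaleR_2[symmetric])
  have "s * (s + h) = (s + h) * s" using sh by (simp add: distrib_left distrib_right)
  then have "p * s = s * p" unfolding p_def by (metis mult.assoc)
  then have "p * v = v * p" by (rule positive_inverse(2)[OF s v])
  then have "positive (v * p)"
    using p positive_inverse(1)[OF s v] by (intro positive_mult) auto
  moreover have "v * p = r + h + e *\<^sub>R 1"
    using v(2) by (simp add: p_def mult.assoc[symmetric]) (simp add: s_def algebra_simps)
  ultimately show "positive (r + h + e *\<^sub>R 1)" by simp
qed

text \<open>\<open>r\<close> is the absolute value of \<open>h\<close>; half of \<open>r + h\<close>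
  and half of \<open>r - h\<close> are the positive and negative parts of \<open>h\<close>.\<close>

lemma abs_decomposition:
  fixes h :: "'a::cstar_algebra_1"
  assumes "adj h = h"
  obtains r where "positive r" "r * r = h * h" "\<And>z. z * h = h * z \<Longrightarrow> z * r = r * z"
    "positive (r + h)" "positive (r - h)"
proof -
  obtain r where r: "adj r = r" "h * h = r * r" "positive r"
    "\<And>z. z * (h * h) = (h * h) * z \<Longrightarrow> z * r = r * z"
    using positive_square[OF assms] by (rule positive_sqrt) blast
  have c: "z * r = r * z" if "z * h = h * z" for z
    by (rule r(4)) (metis that mult.assoc)
  have "positive (r + h)"
    by (rule positive_abs_add) (use r(3) r(2)[symmetric] c[of h] assms in simp_all)
  moreover have "positive (r + - h)"
    by (rule positive_abs_add) (use r(3) r(2)[symmetric] c[of h] assms in \<open>simp_all add: adj_minus\<close>)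
  ultimately show ?thesis using that[OF r(3) r(2)[symmetric] c] by simp
qed

section \<open>Positivity of \<open>adj x * x\<close>\<close>

lemma selfadj_square_zero: "adj c = c \<Longrightarrow> c * c = 0 \<Longrightarrow> c = 0" for c :: "'a::cstar_algebra"
  using cstar_identity[of c] by simp

lemma adj_mult_self_zero: "adj c * c = 0 \<Longrightarrow> c = 0" for c :: "'a::cstar_algebra"
  using cstar_identity[of c] by simp

text \<open>The C*-identity, iterated. Exact geometric growth along powers of two stands in for the
  spectral radius.\<close>

lemma norm_power_selfadj:
  fixes w :: "'a::cstar_algebra_1"
  assumes "adj w = w"
  shows "norm (w ^ (2 ^ k)) = norm w ^ (2 ^ k)"
proof (induction k)
  case (Suc k)
  have "adj (w ^ n) = w ^ n" for n
    by (induction n) (simp_all add: adj_mult assms power_commutes)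
  then have "norm (w ^ (2 ^ k) * w ^ (2 ^ k)) = (norm (w ^ (2 ^ k)))\<^sup>2"
    using cstar_identity[of "w ^ (2 ^ k)"] by simp
  then show ?case by (simp add: Suc power_add[symmetric] mult_2 power2_eq_square)
qed simp

text \<open>The spectra of \<open>y\<^sup>* y\<close> and \<open>y y\<^sup>*\<close> agree up to zero;
  here a growth estimate for the powers of \<open>1 + y y\<^sup>*\<close>
  takes the place of this fact.\<close>

lemma norm_one_add_swap:
  fixes y :: "'a::cstar_algebra_1"
  assumes "norm (1 + adj y * y) \<le> 1"
  shows "norm (1 + y * adj y) \<le> 1"
proof (rule ccontr)
  define w where "w = 1 + y * adj y"
  define v where "v = 1 + adj y * y"
  define c where "c = (norm y)\<^sup>2"
  assume "\<not> norm (1 + y * adj y) \<le> 1"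
  then have w1: "1 < norm w" by (simp add: w_def)
  have vn: "norm (v ^ n) \<le> 1" for n
  proof (induction n)
    case 0
    then show ?case by (simp add: norm_one_le)
  next
    case (Suc n)
    then show ?case
      using norm_mult_le[OF assms[folded v_def] Suc] by simp
  qed
  have wy: "w ^ n * y = y * v ^ n" for n
  proof (induction n)
    case (Suc n)
    have "w ^ Suc n * y = w * (y * v ^ n)" by (simp add: mult.assoc Suc)
    also have "\<dots> = (w * y) * v ^ n" by (simp add: mult.assoc)
    also have "w * y = y * v" by (simp add: w_def v_def algebra_simps)
    finally show ?case by (simp add: mult.assoc)
  qed simp
  \<comment> \<open>Relation \<open>wy\<close> moves the power from \<open>w\<close> to the
    contraction \<open>v\<close>, so each step adds at most \<open>norm y\<close> squared. This
    linear growth contradicts the geometric growth along exponents \<open>2 ^ k\<close> if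
    \<open>norm w > 1\<close>.\<close>
  have wn: "norm (w ^ n) \<le> 1 + real n * c" for n
  proof (induction n)
    case 0
    then show ?case by (simp add: norm_one_le)
  next
    case (Suc n)
    have "w ^ Suc n = w ^ n * w" by (rule power_Suc2)
    also have "\<dots> = w ^ n + (w ^ n * y) * adj y" by (simp add: w_def algebra_simps)
    also have "\<dots> = w ^ n + (y * v ^ n) * adj y" by (simp only: wy)
    finally have "norm (w ^ Suc n) \<le> norm (w ^ n) + norm ((y * v ^ n) * adj y)"
      by (metis norm_triangle_ineq)
    also have "norm ((y * v ^ n) * adj y) \<le> (norm y * 1) * norm y"
      by (intro norm_mult_le vn) auto
    finally show ?case using Suc by (simp add: c_def power2_eq_square algebra_simps)
  qed
  have "adj w = w" by (simp add: w_def adj_add adj_mult adj_adj)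
  define q where "q = inverse (norm w)"
  have q: "0 < q" "q < 1" using w1 by (auto simp: q_def inverse_less_1_iff)
  have "(\<lambda>n. q ^ n + c * (real n * q ^ n)) \<longlonglongrightarrow> 0 + c * 0"
    using q by (intro tendsto_intros LIMSEQ_realpow_zero powser_times_n_limit_0) auto
  then have "\<forall>\<^sub>F n in sequentially. q ^ n + c * (real n * q ^ n) < 1"
    by (rule order_tendstoD(2)) simp
  then obtain N where N: "\<And>n. N \<le> n \<Longrightarrow> q ^ n + c * (real n * q ^ n) < 1"
    by (auto simp: eventually_sequentially)
  define n :: nat where "n = 2 ^ N"
  have "norm w ^ n \<le> 1 + real n * c"
    using wn[of n] norm_power_selfadj[OF \<open>adj w = w\<close>, of N] by (simp add: n_def)
  then have "norm w ^ n * q ^ n \<le> (1 + real n * c) * q ^ n" using q by (intro mult_right_mono) auto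
  moreover have "norm w ^ n * q ^ n = 1"
    using w1 unfolding q_def power_mult_distrib[symmetric] by (subst right_inverse) auto
  ultimately have "1 \<le> q ^ n + c * (real n * q ^ n)" by (simp add: algebra_simps)
  moreover have "N \<le> n" by (simp add: n_def)
  ultimately show False using N by fastforce
qed

text \<open>Once \<open>y\<close> is scaled to a contraction, negativity of \<open>adj y * y\<close>
  amounts to \<open>norm (1 + adj y * y) \<le> 1\<close>, the form in which the factors can be
  exchanged.\<close>

lemma negative_adj_mult_swap:
  fixes y :: "'a::cstar_algebra_1"
  assumes "positive (- (adj y * y))"
  shows "positive (- (y * adj y))"
proof -
  define r where "r = 1 / (norm y + 1)"
  have r: "0 < r" by (simp add: r_def add_nonneg_pos)
  define z where "z = r *\<^sub>R y"
  have z: "adj z * z = (r * r) *\<^sub>R (adj y * y)" "z * adj z = (r * r) *\<^sub>R (y * adj y)"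
    by (simp_all add: z_def adj_scaleR)
  have "norm z \<le> 1" using r by (simp add: z_def) (simp add: r_def add_nonneg_pos)
  then have "norm (- (adj z * z)) \<le> 1" by (simp add: cstar_identity power_le_one)
  moreover have "positive (- (adj z * z))"
    using positive_scaleR[OF assms, of "r * r"] by (simp add: z)
  ultimately have "norm (1 + adj z * z) \<le> 1" using positive_norm_shift[of "- (adj z * z)" 1] by simp
  then have "norm (1 + z * adj z) \<le> 1" by (rule norm_one_add_swap)
  then have "positive (- (z * adj z))" unfolding positive_def
    by (auto simp: adj_minus adj_mult adj_adj intro!: exI[of _ 1])
  then have "positive ((1 / (r * r)) *\<^sub>R - (z * adj z))" by (rule positive_scaleR) (use r in simp)
  then show ?thesis using r by (simp add: z)
qed

text \<open>The sum \<open>adj y * y + y * adj y\<close> is half the sum of the squares of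
  \<open>y + adj y\<close> and \<open>\<i> *\<^sub>C (y - adj y)\<close>, hence positive. Here both
  of its summands are negative, so both vanish.\<close>

lemma negative_adj_mult_zero:
  fixes y :: "'a::cstar_algebra_1"
  assumes "positive (- (adj y * y))"
  shows "y = 0"
proof -
  define a b where "a = y + adj y" "b = \<i> *\<^sub>C (y - adj y)"
  have "positive (a * a + b * b)"
    by (intro positive_add positive_square)
      (simp_all add: a_b_def adj_add adj_adj adj_scaleC adj_diff scaleC_minus_left
        scaleC_diff_right add.commute)
  moreover have "a * a + b * b = 2 *\<^sub>R (adj y * y + y * adj y)"
    by (simp add: a_b_def algebra_simps scaleC_diff_right mult_scaleC_left mult_scaleC_right
        scaleC_scaleC scaleC_minus_left scaleR_2)
  ultimately have "positive ((1/2) *\<^sub>R (2 *\<^sub>R (adj y * y + y * adj y)))"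
    by (simp only: positive_scaleR)
  then have 1: "positive (adj y * y + y * adj y)" by simp
  have "positive (- (adj y * y) + - (y * adj y))"
    using positive_add[OF assms negative_adj_mult_swap[OF assms]] .
  then have "positive (- (adj y * y + y * adj y))" by simp
  then have "adj y * y + y * adj y = 0" using 1 positive_antisym by blast
  moreover have "- (adj y * y) + - (y * adj y) = - (adj y * y + y * adj y)" by simp
  ultimately have "- (adj y * y) + - (y * adj y) = 0" by simp
  then have "- (adj y * y) = 0"
    using positive_sum_zero[OF assms negative_adj_mult_swap[OF assms]] by blast
  then show ?thesis by - (rule adj_mult_self_zero, simp)
qed

text \<open>With \<open>h = adj x * x\<close>, the element \<open>c = r - h\<close> is twice the
  negative part of \<open>h\<close>, and \<open>adj (x * c) * (x * c)\<close> is minus half of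
  \<open>c * c * c\<close>. Being negative, it vanishes; hence \<open>x * c = 0\<close> and then
  \<open>c = 0\<close>.\<close>

lemma positive_adj_mult: "positive (adj x * x)" for x :: "'a::cstar_algebra_1"
proof -
  define h where "h = adj x * x"
  have h: "adj h = h" by (simp add: h_def adj_mult adj_adj)
  obtain r where r: "positive r" "r * r = h * h" "\<And>z. z * h = h * z \<Longrightarrow> z * r = r * z"
    "positive (r - h)" using abs_decomposition[OF h] by metis
  have rh: "h * r = r * h" using r(3) by simp
  define c where "c = r - h"
  have ca: "adj c = c" using positive_adj[OF r(4)] by (simp add: c_def)
  have "c * c = - (h * c) - (h * c)" by (simp add: c_def algebra_simps r(2) rh)
  then have "c * c = 2 *\<^sub>R - (h * c)" by (simp only: scaleR_2) simp
  then have "(1/2) *\<^sub>R (c * c) = - (h * c)" by simp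
  moreover have "adj (x * c) * (x * c) = c * (h * c)" by (simp add: adj_mult ca h_def mult.assoc)
  ultimately have "- (adj (x * c) * (x * c)) = (1/2) *\<^sub>R (c * (c * c))"
    by (metis mult_minus_right mult_scaleR_right)
  moreover have "positive ((1/2) *\<^sub>R (c * (c * c)))"
    using r(4) by (intro positive_scaleR positive_mult positive_square ca)
      (simp_all add: c_def[symmetric] mult.assoc)
  ultimately have "x * c = 0" by - (rule negative_adj_mult_zero, simp)
  then have "h * c = 0" by (simp add: h_def mult.assoc)
  then have "c * c = 0" using \<open>c * c = - (h * c) - (h * c)\<close> by simp
  then have "c = 0" using ca selfadj_square_zero by blast
  then show ?thesis using r(1) by (simp add: c_def h_def)
qed

lemma positive_conj:
  assumes "positive h"
  shows "positive (adj x * h * x)"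
proof -
  obtain k where k: "adj k = k" "h = k * k" using assms by (rule positive_sqrt)
  have "adj (k * x) * (k * x) = adj x * h * x" by (simp add: adj_mult k mult.assoc)
  then show ?thesis using positive_adj_mult[of "k * x"] by simp
qed

text \<open>The bridge between norm and order. Homomorphisms preserve the right-hand side, which is
  how their contractivity is obtained.\<close>

lemma norm_le_iff_positive:
  fixes x :: "'a::cstar_algebra_1"
  assumes "0 \<le> t"
  shows "norm x \<le> t \<longleftrightarrow> positive ((t * t) *\<^sub>R 1 - adj x * x)"
proof
  assume "norm x \<le> t"
  then have "norm (adj x * x) \<le> t * t"
    using assms by (simp add: cstar_identity power2_eq_square mult_mono)
  then show "positive ((t * t) *\<^sub>R 1 - adj x * x)"
    by (intro positive_one_minus) (simp_all add: adj_mult adj_adj)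
next
  assume "positive ((t * t) *\<^sub>R 1 - adj x * x)"
  moreover have "positive ((t * t) *\<^sub>R 1 + adj x * x)"
    using assms by (intro positive_add positive_adj_mult positive_scaleR_one) simp
  ultimately have "norm (adj x * x) \<le> t * t" using assms by (intro norm_le_of_positive) auto
  then have "(norm x)\<^sup>2 \<le> t\<^sup>2" by (simp add: cstar_identity power2_eq_square)
  then show "norm x \<le> t" using assms by (rule power2_le_imp_le)
qed

lemma norm_le_one_iff_positive: "norm x \<le> 1 \<longleftrightarrow> positive (1 - adj x * x)"
  for x :: "'a::cstar_algebra_1"
  using norm_le_iff_positive[of 1 x] by simp

lemma invertible_of_positive_diff:
  assumes "positive (h - e *\<^sub>R 1)" "0 < e"
  shows "h \<in> invertibles"
  using positive_invertible[OF assms] by simp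

text \<open>With \<open>c = a - b\<close>, the positive elements \<open>c * a * c\<close> and
  \<open>c * b * c\<close> add up to 0, so both vanish and \<open>c * c * c = 0\<close>. This
  identifies images of roots under homomorphisms.\<close>

lemma positive_sqrt_unique:
  fixes a b :: "'a::cstar_algebra_1"
  assumes "positive a" "positive b" "a * a = b * b" "a * b = b * a"
  shows "a = b"
proof -
  define c where "c = a - b"
  have c: "adj c = c" using positive_adj[OF assms(1)] positive_adj[OF assms(2)] by (simp add: c_def adj_diff)
  have "c * (a + b) = 0" using assms by (simp add: c_def algebra_simps)
  then have "(c * a + c * b) * c = 0" by (simp add: distrib_left)
  then have z: "c * a * c + c * b * c = 0" by (simp only: distrib_right)
  have p: "positive (c * a * c)" "positive (c * b * c)"
    using positive_conj[OF assms(1), of c] positive_conj[OF assms(2), of c] by (simp_all add: c)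
  have "c * a * c = 0" by (rule positive_sum_zero[OF p z])
  moreover from this have "c * b * c = 0" using z by simp
  ultimately have "c * (a - b) * c = 0" by (simp add: left_diff_distrib right_diff_distrib)
  then have "c * c * c = 0" by (simp only: c_def)
  then have "(c * c) * (c * c) = 0" by (metis mult.assoc mult_zero_left)
  then have "c * c = 0" by - (rule selfadj_square_zero, simp_all add: adj_mult c)
  then have "c = 0" using c selfadj_square_zero by blast
  then show ?thesis by (simp add: c_def)
qed

section \<open>Left invertible tuples\<close>

lemma positive_sum: "(\<And>k. k \<in> S \<Longrightarrow> positive (g k)) \<Longrightarrow> positive (\<Sum>k\<in>S. g k)"
  by (induction S rule: infinite_finite_induct) (auto intro: positive_add)

text \<open>A Cauchy-Schwarz inequality with a crude constant. The induction step is the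
  parallelogram identity for \<open>z + b\<close> and \<open>z - b\<close>, with
  \<open>adj w * w\<close> as the square of \<open>w\<close>.\<close>

lemma sum_adj_mult_dominates:
  fixes x y :: "nat \<Rightarrow> 'a::cstar_algebra_1"
  defines "z \<equiv> \<lambda>d. \<Sum>k<d. y k * x k"
  shows "\<exists>c\<ge>0. positive (c *\<^sub>R (\<Sum>k<d. adj (x k) * x k) - adj (z d) * z d)"
proof (induction d)
  case 0
  then show ?case by (auto simp: z_def)
next
  case (Suc d)
  define s where "s = (\<Sum>k<d. adj (x k) * x k)"
  define b where "b = y d * x d"
  define n where "n = norm (y d)"
  from Suc obtain c where c: "0 \<le> c" "positive (c *\<^sub>R s - adj (z d) * z d)"
    by (auto simp: s_def)
  have "positive (adj (x d) * ((n * n) *\<^sub>R 1 - adj (y d) * y d) * x d)"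
    by (intro positive_conj, subst norm_le_iff_positive[symmetric]) (simp_all add: n_def)
  then have 1: "positive ((n * n) *\<^sub>R (adj (x d) * x d) - adj b * b)"
    by (simp add: b_def algebra_simps adj_mult)
  have s: "positive s" unfolding s_def by (intro positive_sum positive_adj_mult)
  \<comment> \<open>One scalar must multiply both the old sum and the new term, so
    \<open>2 * n * n\<close> copies of \<open>s\<close> and \<open>2 * c\<close> copies of the new
    term are added as surplus.\<close>
  define C where "C = 2 * (c + n * n)"
  have "positive (2 *\<^sub>R (c *\<^sub>R s - adj (z d) * z d)
      + 2 *\<^sub>R ((n * n) *\<^sub>R (adj (x d) * x d) - adj b * b)
      + adj (z d - b) * (z d - b) + (2 * n * n) *\<^sub>R s + (2 * c) *\<^sub>R (adj (x d) * x d))"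
    using c 1 s by (intro positive_add positive_scaleR positive_adj_mult) (auto simp: n_def)
  also have "(2 *\<^sub>R (c *\<^sub>R s - adj (z d) * z d)
      + 2 *\<^sub>R ((n * n) *\<^sub>R (adj (x d) * x d) - adj b * b)
      + adj (z d - b) * (z d - b) + (2 * n * n) *\<^sub>R s + (2 * c) *\<^sub>R (adj (x d) * x d))
     = C *\<^sub>R (s + adj (x d) * x d) - adj (z d + b) * (z d + b)"
    by (simp add: C_def algebra_simps adj_add adj_diff scaleR_2)
  also have "s + adj (x d) * x d = (\<Sum>k<Suc d. adj (x k) * x k)" by (simp add: s_def)
  also have "z d + b = z (Suc d)" by (simp add: z_def b_def)
  finally show ?case using c by (intro exI[of _ C]) (simp add: C_def n_def)
qed

text \<open>Any left inverse of the tuple bounds the sum of squares from below. The condition in the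
  stable rank thus becomes a linear equation, which can be transported and repaired.\<close>

lemma sum_adj_mult_invertible:
  fixes x y :: "nat \<Rightarrow> 'a::cstar_algebra_1"
  assumes "(\<Sum>k<d. y k * x k) = 1"
  shows "(\<Sum>k<d. adj (x k) * x k) \<in> invertibles"
proof -
  define s where "s = (\<Sum>k<d. adj (x k) * x k)"
  obtain c where c: "0 \<le> c" "positive (c *\<^sub>R s - 1)"
    using sum_adj_mult_dominates[where d=d and x=x and y=y] assms by (auto simp: s_def)
  have s: "positive s" unfolding s_def by (intro positive_sum positive_adj_mult)
  \<comment> \<open>Adding \<open>s\<close> and dividing by \<open>c + 1\<close> avoids dividing by
    \<open>c\<close>, which may be 0 in the zero algebra.\<close>
  have "positive ((1 / (c + 1)) *\<^sub>R ((c *\<^sub>R s - 1) + s))"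
    using c s by (intro positive_scaleR positive_add) auto
  also have "(c *\<^sub>R s - 1) + s = (c + 1) *\<^sub>R s - 1" by (simp add: algebra_simps)
  also have "(1 / (c + 1)) *\<^sub>R ((c + 1) *\<^sub>R s - 1) = s - (1 / (c + 1)) *\<^sub>R 1"
    using c by (simp add: scaleR_diff_right)
  finally show ?thesis
    unfolding s_def[symmetric] by (rule invertible_of_positive_diff) (use c in simp)
qed

section \<open>Unital *-homomorphisms\<close>

definition unital_hom :: "('a::cstar_algebra_1 \<Rightarrow> 'b::cstar_algebra_1) \<Rightarrow> bool" where
  "unital_hom f \<longleftrightarrow> star_hom f \<and> f 1 = 1"

lemma unital_homD:
  assumes "unital_hom f"
  shows "f (x + y) = f x + f y" "f (c *\<^sub>C x) = c *\<^sub>C f x" "f (x * y) = f x * f y"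
    "f (adj x) = adj (f x)" "f 1 = 1" "f 0 = 0" "f (- x) = - f x" "f (x - y) = f x - f y"
    "f (r *\<^sub>R x) = r *\<^sub>R f x"
proof -
  show add: "f (x + y) = f x + f y" "f (c *\<^sub>C x) = c *\<^sub>C f x" "f (x * y) = f x * f y"
    "f (adj x) = adj (f x)" "f 1 = 1" for x y c
    using assms by (auto simp: unital_hom_def star_hom_def)
  show zero: "f 0 = 0" using add(1)[of 0 0] by simp
  show minus: "f (- x) = - f x" for x using add(1)[of x "- x"] zero by (simp add: minus_unique)
  show "f (x - y) = f x - f y" using add(1)[of x "- y"] minus by simp
  show "f (r *\<^sub>R x) = r *\<^sub>R f x" using add(2)[of "complex_of_real r" x] by (simp add: scaleC_of_real)
qed

lemma unital_hom_sum: "unital_hom f \<Longrightarrow> f (\<Sum>k\<in>S. g k) = (\<Sum>k\<in>S. f (g k))"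
  by (induction S rule: infinite_finite_induct) (auto simp: unital_homD)

section \<open>Order, norm and lifting under unital homomorphisms\<close>

lemma unital_hom_positive:
  assumes f: "unital_hom f" and "positive h"
  shows "positive (f h)"
proof -
  obtain k where k: "adj k = k" "h = k * k" using assms(2) by (rule positive_sqrt)
  then have "adj (f k) = f k" using unital_homD(4)[OF f, of k] by simp
  then show ?thesis unfolding k(2) unital_homD(3)[OF f] by (rule positive_square)
qed

lemma unital_hom_invertible:
  assumes f: "unital_hom f" and "x \<in> invertibles"
  shows "f x \<in> invertibles"
proof -
  obtain y where "x * y = 1" "y * x = 1" using assms(2) by (auto simp: invertibles_iff)
  then have "f x * f y = 1" "f y * f x = 1" by (simp_all add: unital_homD(3,5)[OF f, symmetric])
  then show ?thesis unfolding invertibles_iff by blast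
qed

lemma unital_hom_norm_le:
  assumes f: "unital_hom f"
  shows "norm (f x) \<le> norm x"
proof -
  have "positive ((norm x * norm x) *\<^sub>R 1 - adj x * x)"
    by (subst norm_le_iff_positive[symmetric]) auto
  then have "positive ((norm x * norm x) *\<^sub>R 1 - adj (f x) * f x)"
    using unital_hom_positive[OF f] by (fastforce simp: unital_homD[OF f])
  then show ?thesis by (subst norm_le_iff_positive) auto
qed

text \<open>Both sides are positive roots of \<open>f h * f h\<close>. In effect \<open>f\<close>
  annihilates \<open>r + h\<close>, which is twice the positive part of \<open>h\<close>.\<close>

lemma unital_hom_abs:
  assumes f: "unital_hom f" and r: "positive r" "r * r = h * h" "r * h = h * r"
    and h: "positive (- f h)"
  shows "f r = - f h"
proof (rule positive_sqrt_unique)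
  show "positive (f r)" using f r(1) by (rule unital_hom_positive)
  show "f r * f r = - f h * - f h" using r(2) by (simp flip: unital_homD(3)[OF f])
  show "f r * - f h = - f h * f r" using r(3) by (simp flip: unital_homD(3)[OF f])
qed fact

text \<open>For \<open>s = norm (f x)\<close> the image of
  \<open>h = adj x * x - (s * s) *\<^sub>R 1\<close> is negative, so the positive part of
  \<open>h\<close> lies in the kernel and is 0; that is, \<open>adj x * x\<close> is at most
  \<open>s * s\<close>.\<close>

lemma unital_hom_isometric:
  assumes f: "unital_hom f" and inj: "\<And>x. f x = 0 \<Longrightarrow> x = 0"
  shows "norm (f x) = norm x"
proof (rule antisym[OF unital_hom_norm_le[OF f]])
  define s where "s = norm (f x)"
  define h where "h = adj x * x - (s * s) *\<^sub>R 1"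
  have "adj h = h" by (simp add: h_def adj_diff adj_mult adj_adj adj_scaleR)
  then obtain r where r: "positive r" "r * r = h * h" "\<And>z. z * h = h * z \<Longrightarrow> z * r = r * z"
    using abs_decomposition by metis
  have "- f h = (s * s) *\<^sub>R 1 - adj (f x) * f x" by (simp add: h_def unital_homD[OF f])
  then have "positive (- f h)" 
    using norm_le_iff_positive[of s "f x"] by (simp add: s_def)
  then have "f r = - f h" 
    using unital_hom_abs[OF f r(1,2)] r(3)[of h] by simp
  then have "f (r + h) = 0" by (simp add: unital_homD[OF f])
  then have "r + h = 0" by (rule inj)
  then have "- h = r" by (simp add: minus_unique add.commute)
  then have "positive ((s * s) *\<^sub>R 1 - adj x * x)" using r(1) by (simp add: h_def)
  then show "norm x \<le> norm (f x)" by (subst (asm) norm_le_iff_positive[symmetric]) (auto simp: s_def)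
qed

text \<open>Truncation: an arbitrary lift \<open>m\<close> is cut down to
  \<open>m (max (m\<^sup>* m) 1)\<^sup>-\<^sup>1\<^sup>/\<^sup>2\<close>.\<close>

lemma unital_hom_lift_le_one:
  assumes f: "unital_hom f" and m: "norm (f m) \<le> 1"
  obtains n where "f n = f m" "norm n \<le> 1"
proof -
  define h where "h = adj m * m - 1"
  have h: "adj h = h" by (simp add: h_def adj_diff adj_mult adj_adj)
  then obtain r where r: "positive r" "r * r = h * h" "\<And>z. z * h = h * z \<Longrightarrow> z * r = r * z"
    "positive (r + h)" "positive (r - h)"
    using abs_decomposition by metis
  have "- f h = 1 - adj (f m) * f m" by (simp add: h_def unital_homD[OF f])
  then have "positive (- f h)" using m norm_le_one_iff_positive by auto
  then have fr: "f r = - f h" 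
    using unital_hom_abs[OF f r(1,2)] r(3)[of h] by simp
  define g where "g = (1/2) *\<^sub>R (r + h)"
  have g: "positive g" using r(4) by (simp add: g_def positive_scaleR)
  \<comment> \<open>As \<open>g\<close> is the positive part of \<open>adj m * m - 1\<close>, this
    is the maximum of \<open>adj m * m\<close> and 1. It is sent to 1 because
    \<open>f g = 0\<close>.\<close>
  define p where "p = g + 1"
  have p: "positive p" using g by (simp add: p_def positive_add)
  have "p \<in> invertibles" using positive_invertible[OF g, of 1] by (simp add: p_def)
  then obtain v where v: "p * v = 1" "v * p = 1" by (auto simp: invertibles_iff)
  have pv: "positive v" by (rule positive_inverse(1)[OF p v])
  obtain k where k: "adj k = k" "v = k * k" "positive k" "\<And>z. z * v = v * z \<Longrightarrow> z * k = k * z"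
    using positive_sqrt[OF pv] by metis
  have fp: "f p = 1" by (simp add: p_def g_def unital_homD[OF f] fr)
  have "f k = 1"
  proof (rule positive_sqrt_unique)
    show "positive (f k)" using f k(3) by (rule unital_hom_positive)
    have "f p * f v = 1" using v(1) by (simp add: unital_homD(3,5)[OF f, symmetric])
    then have "f v = 1" by (simp add: fp)
    then show "f k * f k = 1 * 1" by (simp add: k(2) unital_homD(3)[OF f, symmetric])
  qed simp_all
  have pk: "p * k = k * p" by (rule k(4)) (simp add: v)
  have "k * p * k = p * k * k" by (simp add: pk)
  then have kpk: "k * (p * k) = 1" using v(1) by (simp add: k(2) mult.assoc)
  \<comment> \<open>The difference is the negative part of \<open>h\<close>, so \<open>p\<close>
    dominates \<open>adj m * m\<close>; conjugation by \<open>k\<close> turns this into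
    \<open>norm (m * k) \<le> 1\<close>.\<close>
  have "p - (1 + h) = (1/2) *\<^sub>R (r - h)"
  proof -
    have "h = (1/2) *\<^sub>R h + (1/2) *\<^sub>R h" by (simp flip: scaleR_add_left)
    then have "p - (1 + h) = (1/2) *\<^sub>R r + (1/2) *\<^sub>R h - ((1/2) *\<^sub>R h + (1/2) *\<^sub>R h)"
      by (simp add: p_def g_def scaleR_add_right)
    then show ?thesis by (simp add: scaleR_diff_right)
  qed
  then have "positive (p - (1 + h))" using r(5) by (simp add: positive_scaleR)
  then have "positive (k * (p - (1 + h)) * k)" using positive_conj[of _ k] k(1) by metis
  moreover have "k * (p - (1 + h)) * k = 1 - adj (m * k) * (m * k)"
    by (simp add: kpk h_def adj_mult k(1) mult.assoc left_diff_distrib right_diff_distrib)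
  ultimately have "norm (m * k) \<le> 1"
    unfolding norm_le_one_iff_positive by simp
  moreover have "f (m * k) = f m" by (simp add: unital_homD(3)[OF f] \<open>f k = 1\<close>)
  ultimately show ?thesis using that by blast
qed

text \<open>The quotient norm is attained, so a factor \<open>1 + g\<close> with
  \<open>norm g < 1\<close> lifts to a factor with the same bound, which is again
  invertible.\<close>

lemma unital_hom_lift:
  assumes f: "unital_hom f" and "surj f"
  obtains m where "f m = q" "norm m \<le> norm q"
proof (cases "q = 0")
  case True
  then show ?thesis using that[of 0] by (simp add: unital_homD[OF f])
next
  case False
  obtain m where m: "f m = (1 / norm q) *\<^sub>R q" using assms(2) by (metis surjD)
  have "norm (f m) \<le> 1" using False by (simp add: m)
  then obtain n where n: "f n = f m" "norm n \<le> 1" using unital_hom_lift_le_one[OF f] by metis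
  have "f (norm q *\<^sub>R n) = q" using False by (simp add: unital_homD[OF f] n m)
  moreover have "norm (norm q *\<^sub>R n) \<le> norm q" using n by (simp add: mult_left_le)
  ultimately show ?thesis using that by blast
qed

section \<open>Unitizations, multiplier algebras and coronas\<close>

instantiation unitization :: (cstar_algebra) cstar_algebra_1
begin

definition one_unitization :: "'a unitization" where "one_unitization = Unitize 0 1"

instance
  by standard (simp_all add: one_unitization_def unitization_defs unitization.expand)

end

instantiation multiplier :: (cstar_algebra) cstar_algebra_1
begin

definition one_multiplier :: "'a multiplier" where "one_multiplier = multiplier_id"

instance
  by standard (use is_unit_element_multiplier_id in
    \<open>auto simp: one_multiplier_def is_unit_element_def\<close>)

end

section \<open>The corona as a C*-algebra\<close>

text \<open>The element \<open>v = (1 + n j\<^sup>2)\<^sup>-\<^sup>1\<close>, for self-adjoint \<open>j\<close>, is \<open>1\<close>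
  modulo the ideal and makes \<open>j v\<close> small.\<close>

lemma norm_corona_square_le:
  fixes m :: "'i::cstar_algebra multiplier"
  assumes j: "j \<in> range multiplier_of"
  shows "(norm (abs_corona m))\<^sup>2 \<le> norm (adj m * m + j)"
proof (rule field_le_epsilon)
  fix t :: real assume t: "0 < t"
  define a where "a = adj m * m"
  have a: "adj a = a" by (simp add: a_def adj_mult adj_adj)
  \<comment> \<open>Since \<open>adj m * m\<close> is self-adjoint, passing to the self-adjoint part
    of \<open>j\<close> does not increase the norm of the sum.\<close>
  define l where "l = (1/2) *\<^sub>R (j + adj j)"
  have l: "adj l = l" by (simp add: l_def adj_scaleR adj_add adj_adj add.commute)
  have lI: "l \<in> range multiplier_of" unfolding l_def by (intro multiplier_of_ideal j)
  have "a = (1/2) *\<^sub>R (a + a)" by (simp add: scaleR_2[symmetric])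
  then have "a + l = (1/2) *\<^sub>R ((a + j) + adj (a + j))"
    by (metis (no_types, lifting) l_def a adj_add scaleR_add_right add.assoc add.left_commute)
  then have al: "norm (a + l) \<le> norm (a + j)"
    using norm_triangle_ineq[of "a + j" "adj (a + j)"] by simp
  \<comment> \<open>Chosen with \<open>4 * n * t * t = 1\<close>: the scalar function
    \<open>x / (1 + n * x)^2\<close> has maximum \<open>1 / (4 * n)\<close>, attained at
    \<open>x = 1 / n\<close>, and this is the bound \<open>t * t\<close> wanted for the square of
    \<open>l * v\<close>. Below, \<open>q\<close> completes the square.\<close>
  define n where "n = 1 / (4 * t * t)"
  have n: "0 < n" using t by (simp add: n_def)
  define w where "w = l * l"
  have w: "positive w" unfolding w_def by (rule positive_square[OF l])
  have nw: "positive (n *\<^sub>R w)" using w n by (simp add: positive_scaleR)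
  define p where "p = n *\<^sub>R w + 1"
  have p: "positive p" unfolding p_def by (intro positive_add nw) simp
  have "p \<in> invertibles" using positive_invertible[OF nw, of 1] by (simp add: p_def)
  then obtain v where v: "p * v = 1" "v * p = 1" by (auto simp: invertibles_iff)
  have pv: "positive v" by (rule positive_inverse(1)[OF p v])
  have va: "adj v = v" by (rule positive_adj[OF pv])
  have wv: "w * v = v * w" by (rule positive_inverse(2)[OF p v]) (simp add: p_def algebra_simps)
  have ov: "1 - v = n *\<^sub>R w * v" using v(1) by (simp add: p_def algebra_simps)
  have "positive (n *\<^sub>R w * v)" using nw pv wv by (intro positive_mult) auto
  then have "positive (1 - v)" by (simp only: ov)
  moreover have "positive (1 + v)" by (intro positive_add pv) simp
  ultimately have nv: "norm v \<le> 1" using norm_le_of_positive[of 1 v] by simp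
  define q where "q = t *\<^sub>R (1 - n *\<^sub>R w)"
  have "adj q = q" using positive_adj[OF w] by (simp add: q_def adj_scaleR adj_diff)
  then have "positive (adj v * (q * q) * v)" by (intro positive_conj positive_square)
  also have "q * q = (t * t) *\<^sub>R (p * p) - w"
  proof -
    have "4 *\<^sub>R (n *\<^sub>R w) = (n *\<^sub>R w + n *\<^sub>R w) + (n *\<^sub>R w + n *\<^sub>R w)"
      using scaleR_add_left[of 2 2 "n *\<^sub>R w"] by (simp only: scaleR_2) simp
    then have "p * p - (1 - n *\<^sub>R w) * (1 - n *\<^sub>R w) = 4 *\<^sub>R (n *\<^sub>R w)"
      by (simp add: p_def algebra_simps)
    then have "(t * t) *\<^sub>R (p * p - (1 - n *\<^sub>R w) * (1 - n *\<^sub>R w)) = w"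
      using t by (simp add: n_def)
    moreover have "q * q = (t * t) *\<^sub>R ((1 - n *\<^sub>R w) * (1 - n *\<^sub>R w))"
      by (simp only: q_def mult_scaleR_left mult_scaleR_right scaleR_scaleR)
    ultimately show ?thesis by (simp only: scaleR_diff_right) (simp add: algebra_simps)
  qed
  also have "adj v * ((t * t) *\<^sub>R (p * p) - w) * v = (t * t) *\<^sub>R ((v * p) * (p * v)) - adj (l * v) * (l * v)"
    by (simp add: algebra_simps va adj_mult l w_def)
  also have "(v * p) * (p * v) = 1" by (simp add: v)
  finally have lv: "norm (l * v) \<le> t" using norm_le_iff_positive[of t "l * v"] t by simp
  have "m - m * v = m * (n *\<^sub>R w * v)" by (simp only: ov[symmetric] right_diff_distrib mult_1_right)
  moreover have "m * (n *\<^sub>R w * v) \<in> range multiplier_of"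
    unfolding w_def by (intro multiplier_of_ideal lI)
  ultimately have "abs_corona m = abs_corona (m * v)" by (simp add: corona.abs_eq_iff)
  then have "(norm (abs_corona m))\<^sup>2 \<le> (norm (m * v))\<^sup>2"
    using norm_abs_corona_le[of "m * v"] by (simp add: power_mono)
  also have "(norm (m * v))\<^sup>2 = norm (v * (a + l) * v - v * (l * v))"
    by (simp add: cstar_identity[symmetric] adj_mult va a_def algebra_simps)
  also have "\<dots> \<le> norm (v * (a + l) * v) + norm (v * (l * v))" by (rule norm_triangle_ineq4)
  also have "\<dots> \<le> (1 * norm (a + l)) * 1 + 1 * t"
    using nv lv by (intro add_mono norm_mult_le) auto
  also have "\<dots> \<le> norm (a + j) + t" using al by simp
  finally show "(norm (abs_corona m))\<^sup>2 \<le> norm (adj m * m + j) + t" by (simp add: a_def)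
qed

text \<open>A subsequence has increments below \<open>(1/2) ^ n\<close>. These lift one by one to
  multipliers within the same bound, and the lifted series converges because \<open>M(I)\<close> is
  complete.\<close>

lemma Cauchy_corona_convergent:
  fixes X :: "nat \<Rightarrow> 'i::cstar_algebra corona"
  assumes X: "Cauchy X"
  shows "convergent X"
proof -
  have "\<exists>N. \<forall>k\<ge>N. \<forall>l\<ge>N. norm (X k - X l) < (1/2) ^ n" for n :: nat
    using X unfolding Cauchy_def dist_norm by (metis zero_less_divide_1_iff zero_less_numeral zero_less_power)
  then obtain N where N: "\<And>n k l. N n \<le> k \<Longrightarrow> N n \<le> l \<Longrightarrow> norm (X k - X l) < (1/2) ^ n"
    by metis
  define r where "r n = (\<Sum>i\<le>n. N i) + n" for n
  have rN: "N n \<le> r n" for n by (simp add: r_def atMost_Suc lessThan_Suc_atMost[symmetric])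
  have r: "strict_mono r" by (simp add: strict_mono_Suc_iff r_def)
  have "norm (X (r (Suc n)) - X (r n)) < (1/2) ^ n" for n
    using strict_mono_less_eq[OF r, of n "Suc n"] rN[of n] by (intro N) auto
  then have "\<exists>m. X (r (Suc n)) - X (r n) = abs_corona m \<and> norm m < (1/2) ^ n" for n
    by (rule norm_corona_less_rep)
  then obtain d where d: "\<And>n. X (r (Suc n)) - X (r n) = abs_corona (d n)"
    "\<And>n. norm (d n) < (1/2) ^ n" by metis
  obtain m0 where m0: "X (r 0) = abs_corona m0" by (metis Quotient_abs_rep Quotient_corona)
  have M: "X (r n) = abs_corona (m0 + (\<Sum>i<n. d i))" for n
  proof (induction n)
    case (Suc n)
    have "X (r (Suc n)) = X (r n) + abs_corona (d n)" using d(1)[of n] by (simp add: algebra_simps)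
    then show ?case by (simp add: Suc plus_corona.abs_eq add.assoc)
  qed (simp add: m0)
  have "summable d"
    by (rule summable_comparison_test[of _ "\<lambda>n. (1/2) ^ n"])
      (use d(2) less_imp_le in \<open>auto simp: summable_geometric\<close>)
  then have "(\<lambda>n. m0 + (\<Sum>i<n. d i)) \<longlonglongrightarrow> m0 + suminf d"
    by (intro tendsto_intros summable_LIMSEQ)
  then have z: "(\<lambda>n. norm ((m0 + (\<Sum>i<n. d i)) - (m0 + suminf d))) \<longlonglongrightarrow> 0"
    by (intro tendsto_norm_zero LIM_zero)
  have "(\<lambda>n. X (r n) - abs_corona (m0 + suminf d)) \<longlonglongrightarrow> 0"
  proof (rule Lim_null_comparison[OF _ z], intro always_eventually allI)
    show "norm (X (r n) - abs_corona (m0 + suminf d)) \<le> norm ((m0 + (\<Sum>i<n. d i)) - (m0 + suminf d))" for n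
      unfolding M minus_corona.abs_eq by (rule norm_abs_corona_le)
  qed
  then have "(X \<circ> r) \<longlonglongrightarrow> abs_corona (m0 + suminf d)" by (simp add: LIM_zero_iff o_def)
  then have "X \<longlonglongrightarrow> abs_corona (m0 + suminf d)" by (rule Cauchy_converges_subseq[OF X r])
  then show ?thesis by (rule convergentI)
qed

instance corona :: (cstar_algebra) cstar_algebra
proof
  have lower: "(norm x)\<^sup>2 \<le> norm (adj x * x)" for x :: "'a corona"
  proof (rule field_le_epsilon)
    fix e :: real assume e: "0 < e"
    obtain m where m: "x = abs_corona m" by (metis Quotient_abs_rep Quotient_corona)
    have "norm (adj x * x) < norm (adj x * x) + e" using e by simp
    then obtain n where n: "adj x * x = abs_corona n" "norm n < norm (adj x * x) + e"
      using norm_corona_less_rep by blast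
    then have "n - adj m * m \<in> range multiplier_of"
      by (simp add: m adj_corona.abs_eq times_corona.abs_eq flip: corona.abs_eq_iff)
    then have "(norm x)\<^sup>2 \<le> norm (adj m * m + (n - adj m * m))"
      unfolding m by (rule norm_corona_square_le)
    then show "(norm x)\<^sup>2 \<le> norm (adj x * x) + e" using n(2) by simp
  qed
  have adj_le: "norm x \<le> norm (adj x)" for x :: "'a corona"
  proof (cases "norm x = 0")
    case False
    have "norm x * norm x \<le> norm (adj x) * norm x"
      using lower[of x] norm_mult_ineq[of "adj x" x] by (simp add: power2_eq_square)
    then show ?thesis using False by simp
  qed simp
  show "norm (adj x * x) = (norm x)\<^sup>2" for x :: "'a corona"
  proof -
    have "norm (adj x) = norm x" using adj_le[of x] adj_le[of "adj x"] by (simp add: adj_adj)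
    then show ?thesis using lower[of x] norm_mult_ineq[of "adj x" x] by (simp add: power2_eq_square)
  qed
qed (rule Cauchy_corona_convergent)

instantiation corona :: (cstar_algebra) cstar_algebra_1
begin

definition one_corona :: "'a corona" where "one_corona = abs_corona 1"

instance
  by standard (use is_unit_element_corona in
    \<open>auto simp: one_corona_def one_multiplier_def is_unit_element_def\<close>)

end

lemma unital_hom_abs_corona: "unital_hom (abs_corona :: 'i::cstar_algebra multiplier \<Rightarrow> _)"
  by (simp add: unital_hom_def star_hom_def one_corona_def plus_corona.abs_eq
      scaleC_corona.abs_eq times_corona.abs_eq adj_corona.abs_eq)

lemma surj_abs_corona: "surj (abs_corona :: 'i::cstar_algebra multiplier \<Rightarrow> _)"
  by (metis Quotient_abs_rep Quotient_corona surjI)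

section \<open>Extreme points of the unit ball\<close>

lemma unit_ball_extremes_iff:
  "x \<in> unit_ball_extremes \<longleftrightarrow>
     norm x \<le> 1 \<and> (\<forall>b. norm (x + b) \<le> 1 \<longrightarrow> norm (x - b) \<le> 1 \<longrightarrow> b = 0)"
proof (intro iffI conjI allI impI)
  assume "x \<in> unit_ball_extremes"
  then have x: "norm x \<le> 1"
    "\<And>a b. norm a \<le> 1 \<Longrightarrow> norm b \<le> 1 \<Longrightarrow> x \<notin> open_segment a b"
    by (auto simp: unit_ball_extremes_def extreme_point_of_def)
  show "norm x \<le> 1" by (rule x)
  fix b assume b: "norm (x + b) \<le> 1" "norm (x - b) \<le> 1"
  show "b = 0"
  proof (rule ccontr)
    assume "b \<noteq> 0"
    have "x = (1 - 1/2) *\<^sub>R (x + b) + (1/2) *\<^sub>R (x - b)"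
      by (simp add: algebra_simps flip: scaleR_add_left)
    moreover have "x + b \<noteq> x - b"
    proof
      assume "x + b = x - b"
      then have "b + b = 0" by (simp add: eq_neg_iff_add_eq_0 flip: add_uminus_conv_diff)
      then show False using \<open>b \<noteq> 0\<close> by (simp add: scaleR_2[symmetric])
    qed
    ultimately have "x \<in> open_segment (x + b) (x - b)"
      unfolding in_segment by (intro conjI exI[of _ "1/2"]) auto
    then show False using x(2) b by blast
  qed
next
  assume x: "norm x \<le> 1 \<and> (\<forall>b. norm (x + b) \<le> 1 \<longrightarrow> norm (x - b) \<le> 1 \<longrightarrow> b = 0)"
  have "x \<notin> open_segment a b" if a: "norm a \<le> 1" "norm b \<le> 1" for a b
  proof
    assume "x \<in> open_segment a b"
    then obtain u where u: "a \<noteq> b" "0 < u" "u < 1" "x = (1 - u) *\<^sub>R a + u *\<^sub>R b"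
      by (auto simp: in_segment)
    define s where "s = min u (1 - u)"
    have conv: "norm ((1 - t) *\<^sub>R a + t *\<^sub>R b) \<le> 1" if t: "0 \<le> t" "t \<le> 1" for t
    proof -
      have "norm ((1 - t) *\<^sub>R a + t *\<^sub>R b) \<le> (1 - t) * norm a + t * norm b"
        using norm_triangle_ineq[of "(1 - t) *\<^sub>R a" "t *\<^sub>R b"] t by simp
      also have "\<dots> \<le> (1 - t) * 1 + t * 1" using a t by (intro add_mono mult_left_mono) auto
      finally show ?thesis by simp
    qed
    have "x + s *\<^sub>R (b - a) = (1 - (u + s)) *\<^sub>R a + (u + s) *\<^sub>R b"
      "x - s *\<^sub>R (b - a) = (1 - (u - s)) *\<^sub>R a + (u - s) *\<^sub>R b"
      by (simp_all add: u(4) algebra_simps)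
    then have "norm (x + s *\<^sub>R (b - a)) \<le> 1" "norm (x - s *\<^sub>R (b - a)) \<le> 1"
      using u by (auto intro!: conv simp: s_def)
    then have "s *\<^sub>R (b - a) = 0" using x by blast
    then show False using u by (auto simp: s_def min_def split: if_splits)
  qed
  with x show "x \<in> unit_ball_extremes"
    by (auto simp: unit_ball_extremes_def extreme_point_of_def)
qed

text \<open>Kadison's algebraic form of being an extreme point. That \<open>v\<close> is a partial
  isometry is contained in the case \<open>a = v\<close>.\<close>

definition extremal :: "'a::cstar_algebra_1 \<Rightarrow> bool" where
  "extremal v \<longleftrightarrow> (\<forall>a. (1 - v * adj v) * a * (1 - adj v * v) = 0)"

text \<open>With \<open>y = 1 - adj v * v\<close> one has
  \<open>(1 - v * adj v) * v = v * y\<close>, so the case \<open>a = v\<close> reads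
  \<open>v * y * y = 0\<close>, and this forces \<open>v * y = 0\<close>.\<close>

lemma extremal_partial_isometry:
  assumes "extremal v"
  shows "v * adj v * v = v"
proof -
  define y where "y = 1 - adj v * v"
  have y: "adj y = y" by (simp add: y_def adj_diff adj_mult adj_adj)
  have "v * y * y = (1 - v * adj v) * v * (1 - adj v * v)"
    by (simp add: y_def algebra_simps)
  then have "v * y * y = 0" using assms by (simp add: extremal_def)
  then have "adj v * (v * y * y) = 0" by simp
  moreover have "adj (v * y) * (v * y) = y * (adj v * (v * y))" by (simp add: adj_mult y mult.assoc)
  moreover have "y * (adj v * (v * y)) = adj v * (v * y * y)"
    by (simp add: y_def algebra_simps)
  ultimately have "v * y = 0" by (intro adj_mult_self_zero[of "v * y"]) simp
  then show ?thesis by (simp add: y_def algebra_simps)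
qed

text \<open>If \<open>v + b\<close> and \<open>v - b\<close> are contractions, adding the two
  inequalities bounds \<open>adj v * v + adj b * b\<close> by 1. Hence \<open>b\<close> vanishes on
  the initial space of \<open>v\<close>; by passing to adjoints, its range is orthogonal to that of
  \<open>v\<close>; the remaining corner is zero by extremality.\<close>

lemma extremal_imp_unit_ball_extreme:
  assumes "extremal v"
  shows "v \<in> unit_ball_extremes"
proof -
  define p q where "p = adj v * v" "q = v * adj v"
  have v: "v * adj v * v = v" by (rule extremal_partial_isometry[OF assms])
  then have av: "adj v * v * adj v = adj v" by (metis adj_adj adj_mult mult.assoc)
  have pq: "p * p = p" "q * q = q" "adj p = p" "adj q = q"
    using v av by (simp_all add: p_q_def mult.assoc adj_mult adj_adj)
  have "1 - adj v * v = adj (1 - p) * (1 - p)"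
    by (simp add: algebra_simps adj_diff pq) (simp add: p_q_def)
  then have "norm v \<le> 1" by (simp add: norm_le_one_iff_positive positive_adj_mult)
  moreover have "b = 0" if b: "norm (v + b) \<le> 1" "norm (v - b) \<le> 1" for b
  proof -
    have key: "c * (adj w * w) = 0"
      if w: "norm (w + c) \<le> 1" "norm (w - c) \<le> 1" and ww: "adj w * w * (adj w * w) = adj w * w"
      for w c :: 'a
    proof -
      define e where "e = adj w * w"
      have e: "adj e = e" "e * e = e" using ww by (simp_all add: e_def adj_mult adj_adj)
      have "positive ((1 - adj (w + c) * (w + c)) + (1 - adj (w - c) * (w - c)))"
        using w by (intro positive_add) (simp_all add: norm_le_one_iff_positive)
      also have "(1 - adj (w + c) * (w + c)) + (1 - adj (w - c) * (w - c))
          = 2 *\<^sub>R (1 - e - adj c * c)"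
        by (simp add: scaleR_2 e_def algebra_simps adj_add adj_diff)
      finally have "positive ((1/2) *\<^sub>R (2 *\<^sub>R (1 - e - adj c * c)))" by (simp only: positive_scaleR)
      then have "positive (adj e * (1 - e - adj c * c) * e)" by (intro positive_conj) simp
      also have "adj e * (1 - e - adj c * c) * e = - (adj (c * e) * (c * e))"
        by (simp add: algebra_simps adj_mult e)
      finally show ?thesis unfolding e_def[symmetric] by (rule negative_adj_mult_zero)
    qed
    have 1: "b * p = 0" unfolding p_q_def
      by (rule key[OF b]) (use pq in \<open>simp add: p_q_def\<close>)
    have "norm (adj v + adj b) \<le> 1" "norm (adj v - adj b) \<le> 1"
      using b by (simp_all flip: adj_add adj_diff)
    then have "adj b * (adj (adj v) * adj v) = 0"
      by (rule key) (use pq in \<open>simp add: p_q_def adj_adj\<close>)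
    then have "adj b * q = 0" by (simp add: p_q_def adj_adj)
    then have "adj (adj b * q) = 0" by simp
    then have 2: "q * b = 0" by (simp add: adj_mult adj_adj pq)
    have "(1 - q) * b * (1 - p) = 0" using assms by (simp add: extremal_def p_q_def)
    then show "b = 0" by (simp add: algebra_simps 1 2)
  qed
  ultimately show ?thesis unfolding unit_ball_extremes_iff by blast
qed

text \<open>The test directions are \<open>v * (1 + z)\<close> and \<open>v * (1 - z)\<close>.
  Taking \<open>z\<close> as half of \<open>1 - adj v * v\<close> cancels the first-order terms:
  \<open>(1 + z) * (1 - 2 * z) * (1 + z)\<close> is \<open>1 - 3 * z * z - 2 * z * z * z\<close>, so
  both stay in the ball and \<open>v * z = 0\<close>.\<close>

lemma unit_ball_extreme_imp_partial_isometry: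
  fixes v :: "'a::cstar_algebra_1"
  assumes "v \<in> unit_ball_extremes"
  shows "v * adj v * v = v"
proof -
  from assms have n: "norm v \<le> 1"
    and ext: "\<And>b. norm (v + b) \<le> 1 \<Longrightarrow> norm (v - b) \<le> 1 \<Longrightarrow> b = 0"
    by (auto simp: unit_ball_extremes_iff)
  define x y where "x = adj v * v" "y = 1 - adj v * v"
  have y: "positive y" using n by (simp add: x_y_def norm_le_one_iff_positive)
  have x: "positive x" by (simp add: x_y_def positive_adj_mult)
  have xy: "x = 1 - y" by (simp add: x_y_def)
  have ya: "adj y = y" by (rule positive_adj[OF y])
  define z where "z = (1/2) *\<^sub>R y"
  have zz: "y = z + z" by (simp add: z_def flip: scaleR_add_left)
  have z: "positive z" using y by (simp add: z_def positive_scaleR)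
  have za: "adj z = z" by (rule positive_adj[OF z])
  have "positive (z * z + (z * z + z * z) + (z * z * z + z * z * z))"
    using z by (intro positive_add positive_mult) (auto simp: mult.assoc)
  also have "z * z + (z * z + z * z) + (z * z * z + z * z * z) = 1 - adj (v + v * z) * (v + v * z)"
  proof -
    have "adj (v + v * z) * (v + v * z) = (1 + z) * x * (1 + z)"
      by (simp add: x_y_def(1) adj_add adj_mult za algebra_simps)
    then show ?thesis by (simp add: xy zz algebra_simps)
  qed
  finally have 1: "norm (v + v * z) \<le> 1" by (simp only: norm_le_one_iff_positive)
  have "positive (1 + (1 - z))"
  proof -
    have "1 + (1 - z) = x + 1 + z" by (simp add: xy zz)
    then show ?thesis using x z by (simp add: positive_add)
  qed
  moreover have "positive (1 - (1 - z))" using z by simp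
  ultimately have "norm (1 - z) \<le> 1" using norm_le_of_positive[of 1 "1 - z"] by simp
  then have "norm (v * (1 - z)) \<le> 1 * 1" using n by (intro norm_mult_le)
  then have "v * z = 0" using 1 by (intro ext) (simp_all add: right_diff_distrib)
  then have "v * y = 0" by (simp add: zz distrib_left)
  then show ?thesis by (simp add: x_y_def algebra_simps)
qed

text \<open>An element of the corner \<open>(1 - q) * a * (1 - p)\<close>, scaled to a contraction
  \<open>c\<close>, has initial and final spaces orthogonal to those of \<open>v\<close>. So
  \<open>v + c\<close> and \<open>v - c\<close> are contractions, and extremality leaves only
  \<open>c = 0\<close>.\<close>

lemma kadison_unit_ball_extremes: "v \<in> unit_ball_extremes \<longleftrightarrow> extremal v"
  for v :: "'a::cstar_algebra_1"
proof
  assume v: "v \<in> unit_ball_extremes"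
  then have ext: "\<And>b. norm (v + b) \<le> 1 \<Longrightarrow> norm (v - b) \<le> 1 \<Longrightarrow> b = 0"
    by (auto simp: unit_ball_extremes_iff)
  define p q where "p = adj v * v" "q = v * adj v"
  have vv: "v * adj v * v = v" by (rule unit_ball_extreme_imp_partial_isometry[OF v])
  then have av: "adj v * v * adj v = adj v" by (metis adj_adj adj_mult mult.assoc)
  have pq: "p * p = p" "adj p = p" "adj q = q" "adj v * q = adj v" "q * v = v"
    using vv av by (simp_all add: p_q_def mult.assoc adj_mult adj_adj)
  show "extremal v" unfolding extremal_def
  proof
    fix a
    define b where "b = (1 - q) * a * (1 - p)"
    define c where "c = (1 / (norm b + 1)) *\<^sub>R b"
    have nc: "norm c \<le> 1" by (simp add: c_def) (simp add: add_nonneg_pos)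
    have bp: "b * p = 0" by (simp add: b_def algebra_simps pq)
    have vb: "adj v * b = 0"
    proof -
      have "adj v * b = (adj v * (1 - q)) * a * (1 - p)" by (simp only: b_def mult.assoc)
      then show ?thesis by (simp add: right_diff_distrib pq)
    qed
    have c: "c * p = 0" "adj v * c = 0" by (simp_all add: c_def bp vb)
    have "adj (adj v * c) = 0" using c by simp
    then have cv: "adj c * v = 0" by (simp add: adj_mult adj_adj)
    have pc: "p * adj c = 0" using arg_cong[OF c(1), of adj] by (simp add: adj_mult pq)
    have "positive (adj (1 - p) * (1 - adj c * c) * (1 - p))"
      using nc by (intro positive_conj) (simp add: norm_le_one_iff_positive)
    also have "adj (1 - p) * (1 - adj c * c) * (1 - p) = 1 - p - adj c * c"
    proof -
      have "adj (1 - p) * (1 - adj c * c) * (1 - p)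
          = (1 - p) * (1 - p) - (adj c - p * adj c) * (c - c * p)"
        by (simp add: adj_diff pq algebra_simps)
      then show ?thesis by (simp add: c pc) (simp add: algebra_simps pq)
    qed
    finally have pos: "positive (1 - p - adj c * c)" .
    have eq: "1 - adj (v + c) * (v + c) = 1 - p - adj c * c"
      "1 - adj (v - c) * (v - c) = 1 - p - adj c * c"
      by (simp_all add: adj_add adj_diff algebra_simps c cv) (simp_all add: p_q_def)
    then have "c = 0" using pos by (intro ext) (simp_all only: norm_le_one_iff_positive eq)
    then have "b = 0" by (simp add: c_def) (metis add_nonneg_eq_0_iff norm_ge_zero zero_le_one zero_neq_one)
    then show "(1 - v * adj v) * a * (1 - adj v * v) = 0" by (simp add: b_def p_q_def)
  qed
qed (rule extremal_imp_unit_ball_extreme)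

text \<open>Surjectivity lets the arbitrary middle factor be lifted. The extended Busby map need not
  be onto, and for it preservation of extreme points is a genuine condition.\<close>

lemma unital_hom_extremal:
  assumes "unital_hom f" "surj f" "extremal v"
  shows "extremal (f v)"
  unfolding extremal_def
proof
  fix a
  obtain b where b: "a = f b" using assms(2) by blast
  have "f ((1 - v * adj v) * b * (1 - adj v * v)) = f 0"
    using assms(3) by (simp add: extremal_def)
  then show "(1 - f v * adj (f v)) * a * (1 - adj (f v) * f v) = 0"
    by (simp add: b unital_homD[OF assms(1)])
qed

section \<open>Quasi-invertible elements\<close>

definition moore_penrose :: "'a::cstar_algebra_1 \<Rightarrow> 'a \<Rightarrow> bool" where
  "moore_penrose a x \<longleftrightarrow> a * x * a = a \<and> x * a * x = x \<and> adj (a * x) = a * x \<and> adj (x * a) = x * a"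

text \<open>The corner condition of \<open>extremal\<close>, kept apart from
  \<open>moore_penrose\<close>: the Penrose equations survive every unital homomorphism, whereas
  this condition in general does not.\<close>

definition orthogonal_defects :: "'a::cstar_algebra_1 \<Rightarrow> 'a \<Rightarrow> bool" where
  "orthogonal_defects a x \<longleftrightarrow> (\<forall>c. (1 - a * x) * c * (1 - x * a) = 0)"

lemma moore_penrose_unique:
  assumes "moore_penrose a x" "moore_penrose a y"
  shows "x = y"
proof -
  have x: "a * x * a = a" "x * a * x = x" "adj (a * x) = a * x" "adj (x * a) = x * a"
    and y: "a * y * a = a" "y * a * y = y" "adj (a * y) = a * y" "adj (y * a) = y * a"
    using assms by (auto simp: moore_penrose_def)
  have "a * x = (a * y) * (a * x)" using y(1) by (simp add: mult.assoc[symmetric])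
  then have "adj (a * x) = adj (a * x) * adj (a * y)" by (metis adj_mult)
  then have "a * x = (a * x) * (a * y)" by (simp only: x y)
  also have "\<dots> = a * y" using x(1) by (simp add: mult.assoc[symmetric])
  finally have 1: "a * x = a * y" .
  have "x * a = (x * a) * (y * a)" using y(1) by (simp add: mult.assoc)
  then have "adj (x * a) = adj (y * a) * adj (x * a)" by (metis adj_mult)
  then have "x * a = (y * a) * (x * a)" by (simp only: x y)
  also have "\<dots> = y * a" using x(1) by (simp add: mult.assoc)
  finally have 2: "x * a = y * a" .
  have "x = x * (a * x)" using x(2) by (simp add: mult.assoc)
  also have "\<dots> = (x * a) * y" by (simp add: 1 mult.assoc)
  also have "\<dots> = y" using y(2) by (simp add: 2)
  finally show ?thesis .
qed

lemma moore_penrose_hom: "unital_hom f \<Longrightarrow> moore_penrose a x \<Longrightarrow> moore_penrose (f a) (f x)"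
  by (simp add: moore_penrose_def unital_homD(3,4)[symmetric])

lemma moore_penrose_extremal:
  assumes "extremal v"
  shows "moore_penrose v (adj v)"
proof -
  have v: "v * adj v * v = v" by (rule extremal_partial_isometry[OF assms])
  then have "adj v * v * adj v = adj v" by (metis adj_adj adj_mult mult.assoc)
  with v show ?thesis by (simp add: moore_penrose_def adj_mult adj_adj)
qed

text \<open>The projection is \<open>f * adj f * v\<close>, with \<open>v\<close> the inverse of
  \<open>z = 1 + adj (f - adj f) * (f - adj f)\<close>. It works because \<open>z\<close> commutes
  with \<open>f\<close> and \<open>adj f\<close>, and \<open>f * z = f * adj f * f\<close>.\<close>

lemma range_projection:
  fixes f :: "'a::cstar_algebra_1"
  assumes f: "f * f = f"
  obtains p where "adj p = p" "p * f = f" "f * p = p"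
proof -
  define g where "g = adj f"
  have g: "g * g = g" unfolding g_def using f by (metis adj_mult)
  define d where "d = f - g"
  define z where "z = adj d * d + 1 *\<^sub>R 1"
  have zp: "positive z" unfolding z_def by (intro positive_add positive_adj_mult positive_scaleR_one) simp
  have "z \<in> invertibles" unfolding z_def by (intro positive_invertible positive_adj_mult) simp
  then obtain v where v: "z * v = 1" "v * z = 1" by (auto simp: invertibles_iff)
  have zeq: "z = 1 - f + f * g + g * f - g"
    by (simp add: z_def d_def adj_diff adj_adj g_def[symmetric])
      (simp add: g_def adj_adj algebra_simps g[unfolded g_def] f)
  have f3: "f * (f * x) = f * x" "g * (g * x) = g * x" for x
    by (simp_all add: mult.assoc[symmetric] f g)
  have fz: "f * z = f * g * f" "z * f = f * g * f"
    by (simp_all add: zeq algebra_simps f g f3)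
  have gz: "g * z = z * g"
    by (simp add: zeq algebra_simps f g f3)
  have fv: "f * v = v * f" and gv: "g * v = v * g"
    by (intro positive_inverse(2)[OF zp v], simp add: fz gz)+
  have va: "adj v = v" by (rule positive_adj[OF positive_inverse(1)[OF zp v]])
  show ?thesis
  proof
    have "v * f * g = f * g * v" by (metis fv gv mult.assoc)
    then show "adj (f * g * v) = f * g * v" by (simp add: adj_mult va g_def adj_adj mult.assoc)
    have "f * g * v * f = f * g * f * v" by (simp only: mult.assoc fv)
    also have "\<dots> = (f * z) * v" by (simp only: fz(1))
    also have "\<dots> = f * (z * v)" by (rule mult.assoc)
    finally show "f * g * v * f = f" by (simp add: v)
    show "f * (f * g * v) = f * g * v" by (simp add: mult.assoc f3)
  qed
qed

text \<open>Inverting the outer factors gives a generalized inverse \<open>g\<close>, but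
  \<open>a * g\<close> and \<open>g * a\<close> are only idempotents. Replacing them by the
  projections with the same range, respectively the same kernel, produces the Moore-Penrose inverse,
  and the corner condition carries over.\<close>

lemma quasi_invertible_imp_moore_penrose:
  fixes a :: "'a::cstar_algebra_1"
  assumes "a \<in> quasi_invertibles"
  obtains x where "moore_penrose a x" "orthogonal_defects a x"
proof -
  obtain b v c where a: "a = b * v * c" and b: "b \<in> invertibles" and v: "extremal v"
    and c: "c \<in> invertibles"
    using assms by (auto simp: quasi_invertibles_def kadison_unit_ball_extremes)
  obtain b' c' where b': "b * b' = 1" "b' * b = 1" and c': "c * c' = 1" "c' * c = 1"
    using b c by (auto simp: invertibles_iff)
  have bc: "b * (b' * x) = x" "b' * (b * x) = x" "c * (c' * x) = x" "c' * (c * x) = x" for x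
    by (simp_all add: mult.assoc[symmetric] b' c')
  have vv: "v * (adj v * v) = v" "v * (adj v * (v * x)) = v * x" for x
    using extremal_partial_isometry[OF v] by (simp_all add: mult.assoc[symmetric])
  define g where "g = c' * adj v * b'"
  define e f where "e = g * a" "f = a * g"
  have aga: "a * g * a = a" by (simp add: a g_def mult.assoc bc vv)
  have ef: "e * e = e" "f * f = f"
    by (simp_all add: e_f_def mult.assoc) (metis aga mult.assoc)+
  have defect: "(1 - f) * x * (1 - e) = 0" for x
  proof -
    have "1 - f = b * (1 - v * adj v) * b'" "1 - e = c' * (1 - adj v * v) * c"
      by (simp_all add: e_f_def a g_def algebra_simps bc b' c')
    then have "(1 - f) * x * (1 - e) = b * ((1 - v * adj v) * (b' * x * c') * (1 - adj v * v)) * c"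
      by (simp only: mult.assoc)
    then show ?thesis using v by (simp add: extremal_def)
  qed
  obtain p where p: "adj p = p" "p * f = f" "f * p = p" using range_projection[OF ef(2)] .
  have "adj e * adj e = adj e" by (metis ef(1) adj_mult)
  then obtain q where q: "adj q = q" "q * adj e = adj e" "adj e * q = q" by (rule range_projection)
  have q': "e * q = e" "q * e = q"
    using arg_cong[OF q(2), of adj] arg_cong[OF q(3), of adj] by (simp_all add: adj_mult adj_adj q(1))
  define x where "x = q * g * p"
  have "a * q = a"
  proof -
    have "a * q = a * (e * q)" by (simp add: e_f_def mult.assoc[symmetric] aga)
    also have "\<dots> = a" by (simp add: q' ) (simp add: e_f_def mult.assoc[symmetric] aga)
    finally show ?thesis .
  qed
  then have "a * x = f * p" by (simp add: x_def mult.assoc[symmetric] e_f_def)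
  then have ax: "a * x = p" by (simp add: p)
  have "p * a = p * (f * a)" by (simp add: e_f_def aga)
  then have pa: "p * a = a" by (simp add: mult.assoc[symmetric] p) (simp add: e_f_def aga)
  have "x * a = q * e" by (simp add: x_def mult.assoc pa e_f_def)
  then have xa: "x * a = q" by (simp add: q')
  have qq: "q * q = q" by (metis q'(1,2) mult.assoc)
  have "moore_penrose a x"
    unfolding moore_penrose_def ax xa by (simp add: pa p q) (simp add: x_def mult.assoc[symmetric] qq)
  moreover have "orthogonal_defects a x" unfolding orthogonal_defects_def ax xa
  proof
    fix y
    have "(1 - p) * (1 - f) = 1 - p" "(1 - e) * (1 - q) = 1 - q"
      by (simp_all add: algebra_simps p q')
    then have "(1 - p) * y * (1 - q) = (1 - p) * ((1 - f) * y * (1 - e)) * (1 - q)"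
      by (metis mult.assoc)
    then show "(1 - p) * y * (1 - q) = 0" by (simp add: defect)
  qed
  ultimately show ?thesis by (rule that)
qed

text \<open>\<open>adj a * a\<close> need not be invertible; adding the projection
  \<open>1 - x * a\<close> onto the kernel of \<open>a\<close> makes it so, with inverse
  \<open>x * adj x + (1 - x * a)\<close>. The root \<open>k\<close> acts as 1 on this projection, so
  \<open>u = a * ki\<close> has the same defects as \<open>a\<close>. The formula for
  \<open>k * k\<close> serves to compute images of \<open>k\<close>.\<close>

lemma moore_penrose_polar:
  fixes a :: "'a::cstar_algebra_1"
  assumes "moore_penrose a x" "orthogonal_defects a x"
  obtains u k where "a = u * k" "extremal u" "k \<in> invertibles" "positive k"
    "k * k = adj a * a + (1 - x * a)"
proof -
  have x: "a * x * a = a" "x * a * x = x" "adj (a * x) = a * x" "adj (x * a) = x * a"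
    using assms(1) by (auto simp: moore_penrose_def)
  define r where "r = 1 - x * a"
  have ra: "adj r = r" by (simp add: r_def adj_diff x)
  have ar: "a * r = 0" by (simp add: r_def right_diff_distrib mult.assoc[symmetric] x)
  have rx: "r * x = 0" by (simp add: r_def left_diff_distrib x)
  have rr: "r * r = r"
    by (subst r_def) (simp add: left_diff_distrib mult.assoc ar)
  have raa: "r * adj a = 0" using arg_cong[OF ar, of adj] by (simp add: adj_mult ra)
  define h where "h = adj a * a + r"
  have h: "positive h" unfolding h_def
    using positive_adj_mult[of r] by (intro positive_add positive_adj_mult) (simp add: ra rr)
  define hi where "hi = x * adj x + r"
  have aax: "adj a * (a * x) = adj a"
    using arg_cong[OF x(1), of adj] by (simp add: adj_mult x mult.assoc) (metis adj_mult x(3))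
  have "adj a * adj x = x * a" using x(4) by (simp add: adj_mult)
  then have "h * hi = x * a + r"
    by (simp add: h_def hi_def algebra_simps rr)
       (simp add: mult.assoc[symmetric] rx ar raa aax[unfolded mult.assoc[symmetric]] mult.assoc[of "adj a" a r])
  then have hhi: "h * hi = 1" by (simp add: r_def)
  have "adj hi = hi" "adj h = h" by (simp_all add: hi_def h_def adj_add adj_mult adj_adj ra)
  then have hih: "hi * h = 1" using arg_cong[OF hhi, of adj] by (simp add: adj_mult)
  obtain k where k: "adj k = k" "h = k * k" "positive k" "\<And>z. z * h = h * z \<Longrightarrow> z * k = k * z"
    using positive_sqrt[OF h] by metis
  define ki where "ki = k * hi"
  have kki: "k * ki = 1" using hhi by (simp add: ki_def k(2) mult.assoc)
  have "(hi * k) * k = 1" using hih by (simp add: k(2) mult.assoc)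
  then have kik: "ki * k = 1" using kki left_right_inverse_eq by metis
  have ki: "positive ki" by (rule positive_inverse(1)[OF k(3) kki kik])
  have kia: "adj ki = ki" by (rule positive_adj[OF ki])
  have hr: "h * r = r" "r * h = r"
    by (simp_all add: h_def distrib_right distrib_left rr mult.assoc ar)
       (simp add: mult.assoc[symmetric] raa)
  have kr: "k * r = r"
  proof -
    have "k + 1 *\<^sub>R 1 \<in> invertibles" by (rule positive_invertible[OF k(3)]) simp
    then obtain w where w: "w * (k + 1) = 1" by (auto simp: invertibles_iff)
    have "(k + 1) * (k * r - r) = h * r - r" by (simp add: algebra_simps k(2))
    then have "w * ((k + 1) * (k * r - r)) = 0" by (simp add: hr)
    then have "k * r - r = 0" by (simp add: mult.assoc[symmetric] w)
    then show ?thesis by simp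
  qed
  have kir: "ki * r = r" using arg_cong[OF kr, of "\<lambda>t. ki * t"] kik by (simp add: mult.assoc[symmetric])
  have kiki: "ki * ki = hi"
  proof -
    have "ki * ki = ki * (k * hi)" by (simp only: ki_def[symmetric])
    then show ?thesis using kik by (simp add: mult.assoc[symmetric])
  qed
  define u where "u = a * ki"
  have "adj u * u = ki * (h - r) * ki" by (simp add: u_def adj_mult kia h_def mult.assoc)
  also have "\<dots> = ki * k * (k * ki) - ki * r * ki"
    by (simp add: k(2) right_diff_distrib left_diff_distrib mult.assoc)
  also have "ki * r * ki = adj (ki * r)" unfolding adj_mult kia ra by (simp only: kir)
  also have "\<dots> = r" by (simp only: kir ra)
  finally have uu: "1 - adj u * u = 1 - x * a" by (simp add: kki kik r_def)
  have "u * adj u = a * (ki * ki) * adj a" by (simp add: u_def adj_mult kia mult.assoc)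
  also have "\<dots> = (a * x) * adj (a * x)"
    by (simp add: kiki hi_def distrib_left distrib_right ar adj_mult mult.assoc[symmetric])
  also have "\<dots> = a * x" using x(1) by (simp add: x(3)) (simp add: mult.assoc[symmetric])
  finally have uu': "1 - u * adj u = 1 - a * x" by simp
  show ?thesis
  proof
    show "a = u * k" by (simp add: u_def mult.assoc kik)
    show "extremal u" using assms(2) by (simp add: extremal_def uu uu' orthogonal_defects_def)
    show "k \<in> invertibles" using kki kik by (auto simp: invertibles_iff)
    show "k * k = adj a * a + (1 - x * a)" by (simp add: k(2)[symmetric] h_def r_def)
  qed (rule k(3))
qed

lemma one_invertible: "(1::'a::cstar_algebra_1) \<in> invertibles"
  by (auto simp: invertibles_iff)

text \<open>Membership becomes a system of equations in \<open>a\<close> and \<open>x\<close>, which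
  can be checked componentwise in a pullback.\<close>

lemma quasi_invertibles_iff:
  "a \<in> quasi_invertibles \<longleftrightarrow> (\<exists>x. moore_penrose a x \<and> orthogonal_defects a x)"
  for a :: "'a::cstar_algebra_1"
proof
  assume "\<exists>x. moore_penrose a x \<and> orthogonal_defects a x"
  then obtain u k where "a = u * k" "extremal u" "k \<in> invertibles"
    using moore_penrose_polar by metis
  then have "a = 1 * u * k \<and> (1::'a) \<in> invertibles \<and> u \<in> unit_ball_extremes \<and> k \<in> invertibles"
    by (simp add: one_invertible kadison_unit_ball_extremes)
  then show "a \<in> quasi_invertibles" unfolding quasi_invertibles_def by blast
qed (metis quasi_invertible_imp_moore_penrose)

lemma quasi_invertibles_mult:
  fixes a :: "'a::cstar_algebra_1"
  assumes "a \<in> quasi_invertibles" "b \<in> invertibles" "c \<in> invertibles"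
  shows "b * a * c \<in> quasi_invertibles"
proof -
  obtain x v y where a: "a = x * v * y" "x \<in> invertibles" "v \<in> unit_ball_extremes" "y \<in> invertibles"
    using assms(1) by (auto simp: quasi_invertibles_def)
  have "b * a * c = (b * x) * v * (y * c)" by (simp add: a mult.assoc)
  then show ?thesis using a assms invertibles_mult unfolding quasi_invertibles_def by blast
qed

text \<open>Elements near \<open>a\<close> lie in its orbit under pairs of invertible elements.  With
  \<open>w = (1 - a x) z (1 + x z)\<^sup>-\<^sup>1\<close> one has \<open>w = w x a\<close> because the defects
  are orthogonal, whence \<open>a + z = (1 + w x) a (1 + x z)\<close>, and \<open>(w x)\<^sup>2 = 0\<close>.\<close>

lemma orthogonal_defects_stable:
  fixes a x :: "'a::cstar_algebra_1"
  assumes x: "x * a * x = x" and def: "orthogonal_defects a x"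
    and z: "norm x * norm z \<le> 1/2"
  defines "K \<equiv> 2 * norm x * (1 + norm a * norm x)"
  obtains g h where "a = (1 + g) * (a + z) * (1 + h)" "norm g \<le> K * norm z" "norm h \<le> K * norm z"
proof -
  have xz: "norm (x * z) \<le> 1/2" using norm_mult_ineq[of x z] z by simp
  then have "norm (x * z) < 1" by simp
  then obtain i where i: "(1 + x * z) * i = 1" "i * (1 + x * z) = 1"
    "norm i * (1 - norm (x * z)) \<le> 1" "norm (i - 1) * (1 - norm (x * z)) \<le> norm (x * z)"
    by (rule neumann_inverse)
  have "norm i * (1/2) \<le> norm i * (1 - norm (x * z))"
    "norm (i - 1) * (1/2) \<le> norm (i - 1) * (1 - norm (x * z))"
    using xz by (intro mult_left_mono; simp)+
  then have ni: "norm i \<le> 2" "norm (i - 1) \<le> 2 * norm (x * z)" using i(3,4) by linarith+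
  define w where "w = (1 - a * x) * z * i"
  have "w * (1 - x * a) = 0" 
    using def[unfolded orthogonal_defects_def, rule_format, of "z * i"] by (simp add: w_def mult.assoc)
  then have wxa: "w * x * a = w" by (simp add: algebra_simps)
  have "x * (1 - a * x) = 0" using x by (simp add: right_diff_distrib mult.assoc)
  then have xw: "x * w = 0" by (simp add: w_def mult.assoc[symmetric])
  have wi: "w * (1 + x * z) = (1 - a * x) * z" using i(2) by (simp add: w_def mult.assoc)
  have "(1 + w * x) * a * (1 + x * z) = (a + w * x * a) * (1 + x * z)"
    by (simp add: distrib_right mult.assoc)
  also have "\<dots> = a * (1 + x * z) + w * (1 + x * z)" by (simp only: wxa distrib_right)
  also have "\<dots> = a + z" unfolding wi by (simp add: algebra_simps)
  finally have az: "a + z = (1 + w * x) * a * (1 + x * z)" by simp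
  have "(1 + - (w * x)) * (1 + w * x) = 1" by (simp add: algebra_simps xw) (simp add: mult.assoc[symmetric] xw)
  then have "(1 + - (w * x)) * (a + z) * (1 + (i - 1)) = a"
    unfolding az using i(1) by (simp add: mult.assoc) (simp add: mult.assoc[symmetric])
  moreover have "norm (- (w * x)) \<le> K * norm z"
  proof -
    have "norm (w * x) \<le> (((1 + norm a * norm x) * norm z) * 2) * norm x"
      unfolding w_def
      by (intro norm_mult_le ni order_refl order_trans[OF norm_triangle_ineq4] add_mono norm_one_le
          norm_mult_ineq)
    then show ?thesis by (simp add: K_def algebra_simps)
  qed
  moreover have "norm (i - 1) \<le> K * norm z"
  proof -
    have "norm (i - 1) \<le> 2 * (norm x * norm z) * 1" using ni(2) norm_mult_ineq[of x z] by simp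
    also have "\<dots> \<le> 2 * (norm x * norm z) * (1 + norm a * norm x)" by (intro mult_left_mono) auto
    finally show ?thesis by (simp add: K_def algebra_simps)
  qed
  ultimately show ?thesis using that by metis
qed

section \<open>Stable rank\<close>

text \<open>The tuple is padded with the given \<open>y k\<close>, whose coefficients in the left
  inverse are 0. Since \<open>tsr_unital\<close> is an infimum, it says nothing directly about
  larger \<open>d\<close>.\<close>

lemma tsr_density_mono:
  fixes d d' :: nat
  assumes "\<And>(y :: nat \<Rightarrow> 'a::cstar_algebra_1) e. 0 < e \<Longrightarrow>
      \<exists>x. (\<forall>k<d. norm (x k - y k) < e) \<and> (\<Sum>k<d. adj (x k) * x k) \<in> invertibles"
    and "d \<le> d'" and "0 < e"
  shows "\<exists>x. (\<forall>k<d'. norm (x k - (y :: nat \<Rightarrow> 'a) k) < e) \<and> (\<Sum>k<d'. adj (x k) * x k) \<in> invertibles"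
proof -
  obtain x where x: "\<forall>k<d. norm (x k - y k) < e" "(\<Sum>k<d. adj (x k) * x k) \<in> invertibles"
    using assms(1)[OF assms(3)] by blast
  then obtain v where v: "v * (\<Sum>k<d. adj (x k) * x k) = 1" by (auto simp: invertibles_iff)
  define x' where "x' k = (if k < d then x k else y k)" for k
  define r where "r k = (if k < d then v * adj (x k) else 0)" for k
  have "(\<Sum>k<d'. r k * x' k) = (\<Sum>k<d. r k * x' k)"
    using assms(2) by (intro sum.mono_neutral_right) (auto simp: r_def)
  also have "\<dots> = v * (\<Sum>k<d. adj (x k) * x k)"
    unfolding sum_distrib_left by (intro sum.cong) (auto simp: r_def x'_def mult.assoc)
  finally have "(\<Sum>k<d'. r k * x' k) = 1" by (simp add: v)
  then have "(\<Sum>k<d'. adj (x' k) * x' k) \<in> invertibles" by (rule sum_adj_mult_invertible)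
  moreover have "\<forall>k<d'. norm (x' k - y k) < e" using x(1) assms(3) by (simp add: x'_def)
  ultimately show ?thesis by blast
qed

lemma tsr_unital_le_iff:
  "tsr_unital TYPE('a::cstar_algebra_1) \<le> enat d \<longleftrightarrow> 1 \<le> d \<and>
     (\<forall>(y :: nat \<Rightarrow> 'a) e. 0 < e \<longrightarrow>
        (\<exists>x. (\<forall>k<d. norm (x k - y k) < e) \<and> (\<Sum>k<d. adj (x k) * x k) \<in> invertibles))"
  (is "_ \<longleftrightarrow> 1 \<le> d \<and> ?P d")
proof
  assume "tsr_unital TYPE('a) \<le> enat d"
  then have "tsr_unital TYPE('a) < enat (Suc d)" using le_less_trans by fastforce
  then obtain d0 where d0: "d0 < Suc d" "1 \<le> d0" "?P d0"
    unfolding tsr_unital_def Inf_less_iff by auto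
  have "?P d"
  proof (intro allI impI)
    fix y :: "nat \<Rightarrow> 'a" and e :: real assume "0 < e"
    have "d0 \<le> d" using d0(1) by simp
    show "\<exists>x. (\<forall>k<d. norm (x k - y k) < e) \<and> (\<Sum>k<d. adj (x k) * x k) \<in> invertibles"
      by (rule tsr_density_mono[OF _ \<open>d0 \<le> d\<close> \<open>0 < e\<close>]) (use d0(3) in blast)
  qed
  with d0 show "1 \<le> d \<and> ?P d" by simp
next
  assume "1 \<le> d \<and> ?P d"
  then show "tsr_unital TYPE('a) \<le> enat d"
    unfolding tsr_unital_def by (intro Inf_lower) auto
qed

section \<open>Pullbacks\<close>

lemma ex_small_factor:
  fixes A r :: real
  assumes "0 \<le> A" "0 < r"
  obtains d where "0 < d" "\<And>d'. 0 \<le> d' \<Longrightarrow> d' \<le> d \<Longrightarrow> A * d' \<le> r"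
proof (rule that[of "r / (A + 1)"])
  show "0 < r / (A + 1)" using assms by simp
  fix d' assume "0 \<le> d'" "d' \<le> r / (A + 1)"
  then have "A * d' \<le> (A + 1) * (r / (A + 1))" using assms by (intro mult_mono) auto
  then show "A * d' \<le> r" using assms by simp
qed

lemma norm_conj_perturbation:
  fixes g h d :: "'a::cstar_algebra_1"
  assumes "norm g \<le> r" "norm h \<le> r" "r \<le> 1"
  shows "norm ((1 + g) * d * (1 + h) - d) \<le> 3 * r * norm d"
proof -
  have r: "0 \<le> r" using assms(1) norm_ge_zero order_trans by blast
  have "(1 + g) * d * (1 + h) - d = g * d + d * h + g * d * h" by (simp add: algebra_simps)
  then have "norm ((1 + g) * d * (1 + h) - d) \<le> norm (g * d) + norm (d * h) + norm (g * d * h)"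
    by (metis norm_triangle_ineq norm_triangle_mono order_refl)
  also have "\<dots> \<le> r * norm d + norm d * r + (r * norm d) * 1"
    using assms by (intro add_mono norm_mult_le) auto
  finally show ?thesis by (simp add: algebra_simps)
qed

lemma extremally_rich_unital_iff:
  "extremally_rich_unital TYPE('x::cstar_algebra_1) \<longleftrightarrow>
     (\<forall>(a::'x) e. 0 < e \<longrightarrow> (\<exists>b\<in>quasi_invertibles. norm (b - a) < e))"
  by (auto simp: extremally_rich_unital_def set_eq_iff closure_approachable dist_norm)

text \<open>\<open>norm_kernel\<close> says that \<open>\<mu>\<close> does not shrink the kernel of
  \<open>f\<close>, which is the ideal. So elements are determined by their two components, and
  distances in \<open>M(I)\<close> control distances in the pullback between elements with the same
  image under \<open>f\<close>.\<close>

locale cstar_pullback =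
  fixes f :: "'c::cstar_algebra_1 \<Rightarrow> 'd::cstar_algebra_1"
    and \<mu> :: "'c \<Rightarrow> 'm::cstar_algebra_1"
    and \<pi> :: "'m \<Rightarrow> 'q::cstar_algebra_1"
    and t :: "'d \<Rightarrow> 'q"
  assumes hom: "unital_hom f" "unital_hom \<mu>" "unital_hom \<pi>" "unital_hom t"
    and surj: "surj f" "surj \<pi>"
    and comm: "\<pi> (\<mu> c) = t (f c)"
    and ex_pair: "t x = \<pi> m \<Longrightarrow> \<exists>c. f c = x \<and> \<mu> c = m"
    and norm_kernel: "f c = 0 \<Longrightarrow> norm c \<le> norm (\<mu> c)"
begin

lemmas hom_simps = unital_homD[OF hom(1)] unital_homD[OF hom(2)] unital_homD[OF hom(3)]
  unital_homD[OF hom(4)]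

lemma pair_eqI: "f c = f c' \<Longrightarrow> \<mu> c = \<mu> c' \<Longrightarrow> c = c'"
  using norm_kernel[of "c - c'"] by (simp add: hom_simps)

lemma glue:
  assumes "\<pi> m = \<pi> (\<mu> a)"
  obtains c where "f c = f a" "\<mu> c = m" "norm (c - a) \<le> norm (m - \<mu> a)"
proof -
  obtain c where c: "f c = f a" "\<mu> c = m" using ex_pair[of "f a" m] assms comm by auto
  moreover have "norm (c - a) \<le> norm (m - \<mu> a)"
    using norm_kernel[of "c - a"] by (simp add: hom_simps c)
  ultimately show ?thesis by (rule that)
qed

lemma lift_near:
  assumes "norm (b - f a) < e"
  obtains a' where "f a' = b" "norm (a' - a) < e"
proof -
  obtain s where "f s = b - f a" "norm s \<le> norm (b - f a)"
    using unital_hom_lift[OF hom(1) surj(1)] .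
  then show ?thesis using that[of "a + s"] assms by (simp add: hom_simps)
qed

text \<open>Inverses are unique, so the two component inverses agree in the quotient and form a
  pair.\<close>

lemma invertible_pair:
  assumes "f c \<in> invertibles" "\<mu> c \<in> invertibles"
  shows "c \<in> invertibles"
proof -
  obtain x y where x: "f c * x = 1" "x * f c = 1" and y: "\<mu> c * y = 1" "y * \<mu> c = 1"
    using assms by (auto simp: invertibles_iff)
  have "t (f c) * t x = 1" using arg_cong[OF x(1), of t] by (simp add: hom_simps)
  moreover have "\<pi> y * t (f c) = 1" using arg_cong[OF y(2), of \<pi>] by (simp add: hom_simps comm)
  ultimately have "\<pi> y = t x" by (rule left_right_inverse_eq)
  then obtain z where z: "f z = x" "\<mu> z = y" using ex_pair by metis
  have "c * z = 1" "z * c = 1" by (rule pair_eqI; simp add: hom_simps x y z)+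
  then show ?thesis by (auto simp: invertibles_iff)
qed

text \<open>Read \<open>z\<close> as a column and \<open>l\<close> as a row lifting a left inverse
  of the column \<open>t b\<close>. Over the quotient, \<open>1 + z l\<close> carries
  \<open>\<mu> a\<close> to \<open>m = \<mu> a + z\<close>, so \<open>m' = (1 + z l)^(-1) m\<close>
  is the corrected tuple. Writing this inverse as \<open>1 - z (1 + l z)^(-1) l\<close> requires
  inverting only the single element \<open>1 + lz\<close> and keeps matrices out.\<close>

theorem tsr_pullback:
  "tsr_unital TYPE('c) \<le> max (tsr_unital TYPE('d)) (tsr_unital TYPE('m))"
proof (cases "max (tsr_unital TYPE('d)) (tsr_unital TYPE('m))")
  case (enat d)
  then have "tsr_unital TYPE('d) \<le> enat d" "tsr_unital TYPE('m) \<le> enat d"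
    by (metis max.cobounded1, metis max.cobounded2)
  then have d: "1 \<le> d"
    and D: "\<And>(y :: nat \<Rightarrow> 'd) e. 0 < e \<Longrightarrow>
      \<exists>x. (\<forall>k<d. norm (x k - y k) < e) \<and> (\<Sum>k<d. adj (x k) * x k) \<in> invertibles"
    and M: "\<And>(y :: nat \<Rightarrow> 'm) e. 0 < e \<Longrightarrow>
      \<exists>x. (\<forall>k<d. norm (x k - y k) < e) \<and> (\<Sum>k<d. adj (x k) * x k) \<in> invertibles"
    unfolding tsr_unital_le_iff by blast+
  have "\<exists>x. (\<forall>k<d. norm (x k - y k) < e) \<and> (\<Sum>k<d. adj (x k) * x k) \<in> invertibles"
    if e: "0 < e" for y :: "nat \<Rightarrow> 'c" and e :: real
  proof -
    obtain b where b: "\<forall>k<d. norm (b k - f (y k)) < e / 2"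
      "(\<Sum>k<d. adj (b k) * b k) \<in> invertibles"
      using D[of "e / 2" "\<lambda>k. f (y k)"] e by auto
    have "\<exists>a. f a = b k \<and> norm (a - y k) < e / 2" if "k < d" for k
      using b(1) that lift_near by metis
    then obtain a where a: "\<And>k. k < d \<Longrightarrow> f (a k) = b k" "\<And>k. k < d \<Longrightarrow> norm (a k - y k) < e / 2"
      by metis
    obtain v where v: "v * (\<Sum>k<d. adj (b k) * b k) = 1" using b(2) by (auto simp: invertibles_iff)
    have "\<exists>l. \<pi> l = t (v * adj (b k))" for k using surj(2) by (metis surjD)
    then obtain l where l: "\<And>k. \<pi> (l k) = t (v * adj (b k))" by metis
    have "t (v * (\<Sum>k<d. adj (b k) * b k)) = 1" by (simp add: v hom_simps)
    then have la: "(\<Sum>k<d. \<pi> (l k) * \<pi> (\<mu> (a k))) = 1"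
      by (simp add: l comm a(1) hom_simps unital_hom_sum[OF hom(4)] sum_distrib_left mult.assoc)
    define L where "L = (\<Sum>k<d. norm (l k))"
    \<comment> \<open>Bounds \<open>norm s\<close> for all \<open>m k\<close> within distance 1 of
      \<open>\<mu> (a k)\<close>, so it is available before \<open>r\<close> is fixed. The
      correction then moves each entry by at most \<open>(1 + 2 * S) * r\<close>.\<close>
    define S where "S = (\<Sum>k<d. norm (l k) * (norm (\<mu> (a k)) + 1))"
    have L: "0 \<le> L" and S: "0 \<le> S" by (auto simp: L_def S_def intro!: sum_nonneg)
    obtain d1 where d1: "0 < d1" "\<And>r. 0 \<le> r \<Longrightarrow> r \<le> d1 \<Longrightarrow> L * r \<le> 1/2"
      using ex_small_factor[OF L, of "1/2"] by auto
    obtain d2 where d2: "0 < d2" "\<And>r. 0 \<le> r \<Longrightarrow> r \<le> d2 \<Longrightarrow> (1 + 2 * S) * r \<le> e / 4"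
      using ex_small_factor[of "1 + 2 * S" "e / 4"] S e by auto
    define r where "r = min 1 (min d1 d2)"
    have r: "0 < r" "r \<le> 1" "L * r \<le> 1/2" "(1 + 2 * S) * r \<le> e / 4"
      using d1 d2 by (auto simp: r_def)
    obtain m where m: "\<forall>k<d. norm (m k - \<mu> (a k)) < r" "(\<Sum>k<d. adj (m k) * m k) \<in> invertibles"
      using M[OF r(1), of "\<lambda>k. \<mu> (a k)"] by auto
    obtain u where u: "u * (\<Sum>k<d. adj (m k) * m k) = 1" using m(2) by (auto simp: invertibles_iff)
    define z where "z k = m k - \<mu> (a k)" for k
    have z: "norm (z k) \<le> r" if "k < d" for k using m(1) that by (auto simp: z_def less_imp_le)
    define s where "s = (\<Sum>k<d. l k * m k)"
    define lz where "lz = (\<Sum>k<d. l k * z k)"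
    have "norm lz \<le> (\<Sum>k<d. norm (l k) * r)"
      unfolding lz_def by (intro order_trans[OF norm_sum] sum_mono norm_mult_le z) auto
    also have "(\<Sum>k<d. norm (l k) * r) = L * r" by (simp add: L_def sum_distrib_right)
    finally have nlz: "norm lz \<le> 1/2" using r(3) by simp
    have "norm (m k) \<le> norm (\<mu> (a k)) + 1" if "k < d" for k
      using norm_triangle_sub[of "m k" "\<mu> (a k)"] z[OF that] r(2) by (simp add: z_def)
    then have ns: "norm s \<le> S"
      unfolding s_def S_def by (intro order_trans[OF norm_sum] sum_mono norm_mult_le) auto
    have "norm lz < 1" using nlz by simp
    then obtain i where i: "(1 + lz) * i = 1" "i * (1 + lz) = 1" "norm i * (1 - norm lz) \<le> 1"
      by (rule neumann_inverse)
    have "norm i * (1/2) \<le> norm i * (1 - norm lz)" using nlz by (intro mult_left_mono) auto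
    then have ni: "norm i \<le> 2" using i(3) by linarith
    define m' where "m' k = m k - z k * i * s" for k
    have "\<pi> s = 1 + \<pi> lz"
    proof -
      have "s = (\<Sum>k<d. l k * \<mu> (a k)) + lz"
        by (simp add: s_def lz_def z_def sum.distrib[symmetric] algebra_simps)
      then show ?thesis by (simp add: hom_simps unital_hom_sum[OF hom(3)] la)
    qed
    then have "\<pi> i * \<pi> s = 1" using arg_cong[OF i(2), of \<pi>] by (simp add: hom_simps)
    then have "\<pi> (m' k) = \<pi> (\<mu> (a k))" for k
      by (simp add: m'_def hom_simps mult.assoc) (simp add: z_def hom_simps)
    then have "\<exists>c. f c = f (a k) \<and> \<mu> c = m' k \<and> norm (c - a k) \<le> norm (m' k - \<mu> (a k))" for k
      using glue by metis
    then obtain c where c: "\<And>k. f (c k) = f (a k)" "\<And>k. \<mu> (c k) = m' k"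
      "\<And>k. norm (c k - a k) \<le> norm (m' k - \<mu> (a k))" by metis
    have "(\<Sum>k<d. f (adj (c k)) * f (c k)) = (\<Sum>k<d. adj (b k) * b k)"
      by (intro sum.cong) (auto simp: hom_simps c(1) a(1))
    then have 1: "f (\<Sum>k<d. adj (c k) * c k) \<in> invertibles"
      using b(2) by (simp add: unital_hom_sum[OF hom(1)] hom_simps(3))
    have m_eq: "m k = m' k + z k * (\<Sum>j<d. l j * m' j)" for k
    proof -
      have "(\<Sum>j<d. l j * m' j) = s - lz * i * s"
        by (simp add: m'_def right_diff_distrib sum_subtractf s_def lz_def sum_distrib_right mult.assoc)
      also have "\<dots> = s + i * s - (1 + lz) * i * s" by (simp add: algebra_simps)
      also have "\<dots> = i * s" by (simp add: i(1))
      finally show ?thesis by (simp add: m'_def mult.assoc)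
    qed
    \<comment> \<open>The row \<open>u * adj (m k)\<close> is a left inverse of \<open>m\<close>;
      multiplied on the right by \<open>1 + z l\<close> it becomes one of \<open>m'\<close>.\<close>
    define uz where "uz = (\<Sum>k<d. u * adj (m k) * z k)"
    have "(\<Sum>k<d. (u * adj (m k) + uz * l k) * m' k)
        = (\<Sum>k<d. u * adj (m k) * m' k) + uz * (\<Sum>k<d. l k * m' k)"
      by (simp add: distrib_right sum.distrib sum_distrib_left mult.assoc)
    also have "\<dots> = (\<Sum>k<d. u * adj (m k) * (m' k + z k * (\<Sum>j<d. l j * m' j)))"
      by (simp add: distrib_left sum.distrib uz_def sum_distrib_right mult.assoc)
    also have "\<dots> = (\<Sum>k<d. u * adj (m k) * m k)" by (simp only: m_eq[symmetric])
    also have "\<dots> = 1" using u by (simp add: sum_distrib_left mult.assoc)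
    finally have "(\<Sum>k<d. adj (m' k) * m' k) \<in> invertibles" by (rule sum_adj_mult_invertible)
    then have "\<mu> (\<Sum>k<d. adj (c k) * c k) \<in> invertibles"
      by (simp add: unital_hom_sum[OF hom(2)] hom_simps c(2))
    with 1 have "(\<Sum>k<d. adj (c k) * c k) \<in> invertibles" by (rule invertible_pair)
    moreover have "norm (c k - y k) < e" if k: "k < d" for k
    proof -
      have "m' k - \<mu> (a k) = z k - z k * i * s" by (simp add: m'_def z_def)
      then have "norm (m' k - \<mu> (a k)) \<le> norm (z k) + norm (z k * i * s)"
        by (metis norm_triangle_ineq4)
      also have "\<dots> \<le> r + (r * 2) * S"
        using z[OF k] ni ns by (intro add_mono norm_mult_le)
      also have "\<dots> = (1 + 2 * S) * r" by (simp add: algebra_simps)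
      also have "\<dots> < e / 2" using r(4) e by linarith
      finally have "norm (c k - a k) < e / 2" using c(3)[of k] by linarith
      then show ?thesis
        using norm_triangle_ineq[of "c k - a k" "a k - y k"] a(2)[OF k] by simp
    qed
    ultimately show ?thesis by blast
  qed
  then have "tsr_unital TYPE('c) \<le> enat d" using d unfolding tsr_unital_le_iff by blast
  then show ?thesis using enat by simp
qed simp

text \<open>Self-adjointness must survive the correction, so congruences are used. With
  \<open>w\<close> the inverse of \<open>y0\<close> times \<open>\<pi> z\<close>, the product
  \<open>y0 * w\<close> is self-adjoint; hence \<open>y0\<close> intertwines \<open>w\<close> with
  \<open>adj w\<close>, and the root \<open>s\<close> of \<open>1 + w\<close> with
  \<open>adj s\<close>. Therefore \<open>adj s * y0 * s = y0 * (1 + w) = \<pi> d\<close>.\<close>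

theorem real_rank_zero_pullback:
  assumes "real_rank_zero_unital TYPE('d)" "real_rank_zero_unital TYPE('m)"
  shows "real_rank_zero_unital TYPE('c)"
  unfolding real_rank_zero_unital_def closure_approachable subset_iff mem_Collect_eq
proof (intro allI impI)
  fix y :: 'c and e :: real
  assume y: "adj y = y" and e: "0 < e"
  have D: "\<exists>b. adj b = b \<and> b \<in> invertibles \<and> norm (b - x) < r" if "adj x = x" "0 < r"
    for x :: 'd and r
    using assms(1) that unfolding real_rank_zero_unital_def closure_approachable subset_iff dist_norm
    by blast
  have M: "\<exists>b. adj b = b \<and> b \<in> invertibles \<and> norm (b - x) < r" if "adj x = x" "0 < r"
    for x :: 'm and r
    using assms(2) that unfolding real_rank_zero_unital_def closure_approachable subset_iff dist_norm
    by blast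
  obtain b where b: "adj b = b" "b \<in> invertibles" "norm (b - f y) < e / 2"
    using D[of "f y" "e / 2"] e y by (auto simp: hom_simps(4)[symmetric])
  obtain a0 where a0: "f a0 = b" "norm (a0 - y) < e / 2" using lift_near[OF b(3)] .
  \<comment> \<open>A lift of a self-adjoint element need not be self-adjoint; averaging with the
    adjoint spoils neither its image nor the error bound.\<close>
  define a where "a = (1/2) *\<^sub>R (a0 + adj a0)"
  have fa: "f a = b" by (simp add: a_def hom_simps a0 b scaleR_2[symmetric])
  have a: "adj a = a" by (simp add: a_def adj_scaleR adj_add adj_adj add.commute)
  have ay: "norm (a - y) < e / 2"
  proof -
    have "y = (1/2) *\<^sub>R (y + adj y)" by (simp add: y scaleR_2[symmetric])
    then have "a - y = (1/2) *\<^sub>R (a0 + adj a0) - (1/2) *\<^sub>R (y + adj y)" by (simp only: a_def)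
    also have "\<dots> = (1/2) *\<^sub>R ((a0 - y) + adj (a0 - y))"
      by (simp add: adj_diff algebra_simps)
    finally have "norm (a - y) \<le> (1/2) * (norm (a0 - y) + norm (adj (a0 - y)))"
      using norm_triangle_ineq[of "a0 - y" "adj (a0 - y)"] by simp
    then show ?thesis using a0(2) by simp
  qed
  obtain b' where b': "b' * b = 1" "b * b' = 1" using b(2) by (auto simp: invertibles_iff)
  obtain v where v: "\<pi> v = t b'" using surj(2) by (metis surjD)
  define m where "m = \<mu> a"
  have m: "adj m = m" by (simp add: m_def a hom_simps(4)[symmetric] unital_homD(4)[OF hom(2), symmetric])
  \<comment> \<open>Conjugating by \<open>1 + u\<close> will cost
    \<open>3 * (2 * norm v * r) * norm d\<close> with \<open>norm d \<le> norm m + 1\<close>, and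
    passing from \<open>m\<close> to \<open>d\<close> costs \<open>r\<close>.\<close>
  define A where "A = 1 + 6 * norm v * (norm m + 1)"
  obtain d1 where d1: "0 < d1" "\<And>r. 0 \<le> r \<Longrightarrow> r \<le> d1 \<Longrightarrow> norm v * r \<le> 1/4"
    using ex_small_factor[of "norm v" "1/4"] by auto
  obtain d2 where d2: "0 < d2" "\<And>r. 0 \<le> r \<Longrightarrow> r \<le> d2 \<Longrightarrow> A * r \<le> e / 4"
    using ex_small_factor[of A "e / 4"] e by (auto simp: A_def)
  define r where "r = min 1 (min d1 d2)"
  have r: "0 < r" "r \<le> 1" "norm v * r \<le> 1/4" "A * r \<le> e / 4"
    using d1 d2 by (auto simp: r_def)
  obtain d where d: "adj d = d" "d \<in> invertibles" "norm (d - m) < r"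
    using M[OF m r(1)] by blast
  define z where "z = d - m"
  have z: "adj z = z" "norm z \<le> r" using d m by (simp_all add: z_def adj_diff)
  define w where "w = \<pi> (v * z)"
  have "norm (v * z) \<le> norm v * r" using z by (intro norm_mult_le) auto
  then have nw: "norm w \<le> norm v * r"
    unfolding w_def by (rule order_trans[OF unital_hom_norm_le[OF hom(3)]])
  define y0 where "y0 = \<pi> m"
  have y0: "y0 = t b" by (simp add: y0_def m_def comm fa)
  have ay0: "adj y0 = y0" by (simp add: y0_def unital_homD(4)[OF hom(3), symmetric] m)
  have y0w: "y0 * w = \<pi> z"
    using arg_cong[OF b'(2), of t] by (simp add: w_def hom_simps v y0 mult.assoc[symmetric])
  have "adj (y0 * w) = y0 * w" unfolding y0w by (simp add: unital_homD(4)[OF hom(3), symmetric] z)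
  then have wy0: "y0 * w = adj w * y0" by (simp add: adj_mult ay0)
  have "norm (- w) \<le> 1" using nw r(3) by simp
  then obtain s where s: "s * s = 1 - - w" "norm (s - 1) \<le> norm (- w)"
    "\<And>x. x * - w = adj (- w) * x \<Longrightarrow> x * s = adj s * x" by (rule ex_sqrt_one_minus) blast
  have "y0 * s = adj s * y0" by (rule s(3)) (simp add: wy0 adj_minus)
  then have "adj s * y0 * s = y0 * s * s" by simp
  also have "\<dots> = y0 * (s * s)" by (rule mult.assoc)
  also have "\<dots> = \<pi> d" by (simp add: s(1) distrib_left y0w) (simp add: y0_def z_def hom_simps)
  finally have pd: "\<pi> d = adj s * y0 * s" by simp
  have ns: "norm (s - 1) \<le> norm v * r" using s(2) nw by simp
  then have "norm (s - 1) < 1" using r(3) by simp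
  then obtain i where i: "(1 + (s - 1)) * i = 1" "norm (i - 1) * (1 - norm (s - 1)) \<le> norm (s - 1)"
    by (rule neumann_inverse)
  have "norm (i - 1) * (1/2) \<le> norm (i - 1) * (1 - norm (s - 1))"
    using ns r(3) by (intro mult_left_mono) auto
  then have ni: "norm (i - 1) \<le> 2 * norm v * r" using i(2) ns by linarith
  obtain u where u: "\<pi> u = i - 1" "norm u \<le> norm (i - 1)"
    using unital_hom_lift[OF hom(3) surj(2)] .
  have nu: "norm u \<le> 2 * norm v * r" using u(2) ni by simp
  define d' where "d' = (1 + adj u) * d * (1 + u)"
  have pu: "\<pi> (1 + u) = i" by (simp add: hom_simps u)
  have "\<pi> d' = adj (\<pi> (1 + u)) * \<pi> d * \<pi> (1 + u)"
    by (simp add: d'_def hom_simps adj_add)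
  also have "\<dots> = adj (s * i) * y0 * (s * i)" unfolding pu pd by (simp add: adj_mult mult.assoc)
  also have "\<dots> = y0" using i(1) by simp
  finally have "\<pi> d' = \<pi> (\<mu> a)" by (simp add: y0_def m_def)
  then obtain c where c: "f c = f a" "\<mu> c = d'" "norm (c - a) \<le> norm (d' - \<mu> a)" by (rule glue)
  have "norm u < 1" using nu r(3) by simp
  then have "1 + u \<in> invertibles" "1 + adj u \<in> invertibles" by (auto intro: invertible_near_one)
  then have "d' \<in> invertibles" unfolding d'_def using d(2) invertibles_mult by blast
  then have "c \<in> invertibles" using c b(2) by (intro invertible_pair) (simp_all add: fa)
  moreover have "adj c = c"
    by (rule pair_eqI) (simp_all add: hom_simps c fa b d'_def adj_mult adj_add adj_adj d mult.assoc)
  moreover have "norm (c - y) < e"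
  proof -
    have "norm d \<le> norm m + 1" using norm_triangle_sub[of d m] d(3) r(2) by simp
    have "norm (d' - d) \<le> 3 * (2 * norm v * r) * norm d"
      unfolding d'_def by (rule norm_conj_perturbation) (use nu r(3) in simp_all)
    also have "\<dots> \<le> 3 * (2 * norm v * r) * (norm m + 1)"
      using \<open>norm d \<le> norm m + 1\<close> r(1) by (intro mult_left_mono) auto
    finally have "norm (d' - m) \<le> A * r"
      using norm_triangle_ineq[of "d' - d" "d - m"] d(3) by (simp add: A_def algebra_simps)
    then have "norm (c - a) < e / 2" using c(3) r(4) e by (simp add: m_def)
    then show ?thesis using norm_triangle_ineq[of "c - a" "a - y"] ay by simp
  qed
  ultimately show "\<exists>x\<in>{x. adj x = x \<and> x \<in> invertibles}. dist x y < e"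
    by (auto simp: dist_norm)
qed

theorem extremally_rich_pullback:
  assumes "extremally_rich_unital TYPE('d)" "extremally_rich_unital TYPE('m)"
    and "extreme_point_preserving t"
  shows "extremally_rich_unital TYPE('c)"
  unfolding extremally_rich_unital_iff
proof (intro allI impI)
  fix y :: 'c and e :: real assume e: "0 < e"
  have D: "\<exists>b\<in>quasi_invertibles. norm (b - a) < r" if "0 < r" for a :: 'd and r
    using assms(1) that unfolding extremally_rich_unital_iff by blast
  have M: "\<exists>b\<in>quasi_invertibles. norm (b - a) < r" if "0 < r" for a :: 'm and r
    using assms(2) that unfolding extremally_rich_unital_iff by blast
  obtain b where b: "b \<in> quasi_invertibles" "norm (b - f y) < e / 2"
    using D[of "e / 2" "f y"] e by auto
  obtain a where a: "f a = b" "norm (a - y) < e / 2" using lift_near[OF b(2)] .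
  obtain x where x: "moore_penrose b x" "orthogonal_defects b x"
    using b(1) by (rule quasi_invertible_imp_moore_penrose)
  obtain b1 v b2 where "b = b1 * v * b2" and bi: "b1 \<in> invertibles" "b2 \<in> invertibles"
    and v: "v \<in> unit_ball_extremes"
    using b(1) by (auto simp: quasi_invertibles_def)
  then have "t b = t b1 * t v * t b2" by (simp add: hom_simps)
  moreover have "t v \<in> unit_ball_extremes"
    using v assms(3) by (auto simp: extreme_point_preserving_def)
  moreover have "t b1 \<in> invertibles" "t b2 \<in> invertibles"
    using bi hom(4) by (auto intro: unital_hom_invertible)
  ultimately have "t b \<in> quasi_invertibles" unfolding quasi_invertibles_def by blast
  then obtain x' where x': "moore_penrose (t b) x'" "orthogonal_defects (t b) x'"
    by (rule quasi_invertible_imp_moore_penrose)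
  have tx: "moore_penrose (t b) (t x)" by (rule moore_penrose_hom[OF hom(4) x(1)])
  \<comment> \<open>The Moore-Penrose inverse of \<open>t b\<close> is \<open>t x\<close> in any
    case. The hypothesis on \<open>t\<close> provides an inverse \<open>x'\<close> with orthogonal
    defects, and uniqueness transfers them to \<open>t x\<close>.\<close>
  have "x' = t x" by (rule moore_penrose_unique[OF x'(1) tx])
  then have def: "orthogonal_defects (t b) (t x)" using x'(2) by simp
  define m where "m = \<mu> a"
  have pm: "\<pi> m = t b" by (simp add: m_def comm a)
  define K where "K = 2 * norm (t x) * (1 + norm (t b) * norm (t x))"
  have K: "0 \<le> K" by (simp add: K_def)
  define A where "A = 1 + 3 * K * (norm m + 1)"
  have A: "0 \<le> A" using K by (simp add: A_def)
  obtain d1 where d1: "0 < d1" "\<And>r. 0 \<le> r \<Longrightarrow> r \<le> d1 \<Longrightarrow> norm (t x) * r \<le> 1/2"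
    using ex_small_factor[of "norm (t x)" "1/2"] by auto
  obtain d2 where d2: "0 < d2" "\<And>r. 0 \<le> r \<Longrightarrow> r \<le> d2 \<Longrightarrow> K * r \<le> 1/2"
    using ex_small_factor[of K "1/2"] K by auto
  obtain d3 where d3: "0 < d3" "\<And>r. 0 \<le> r \<Longrightarrow> r \<le> d3 \<Longrightarrow> A * r \<le> e / 4"
    using ex_small_factor[of A "e / 4"] A e by auto
  define r where "r = min 1 (min d1 (min d2 d3))"
  have r: "0 < r" "r \<le> 1" "norm (t x) * r \<le> 1/2" "K * r \<le> 1/2" "A * r \<le> e / 4"
    using d1 d2 d3 by (auto simp: r_def)
  obtain d where d: "d \<in> quasi_invertibles" "norm (d - m) < r" using M[OF r(1)] by blast
  define z where "z = \<pi> (d - m)"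
  have z: "norm z \<le> r" using unital_hom_norm_le[OF hom(3), of "d - m"] d(2) by (simp add: z_def)
  have pd: "\<pi> d = t b + z" by (simp add: z_def hom_simps pm)
  have "norm (t x) * norm z \<le> norm (t x) * r" using z by (intro mult_left_mono) auto
  then have "norm (t x) * norm z \<le> 1/2" using r(3) by simp
  then obtain g h where gh: "t b = (1 + g) * (t b + z) * (1 + h)"
    "norm g \<le> K * norm z" "norm h \<le> K * norm z"
    using tx def unfolding K_def moore_penrose_def by (meson orthogonal_defects_stable)
  have Kz: "K * norm z \<le> K * r" using z K by (rule mult_left_mono)
  obtain G where G: "\<pi> G = g" "norm G \<le> norm g" using unital_hom_lift[OF hom(3) surj(2)] .
  obtain H where H: "\<pi> H = h" "norm H \<le> norm h" using unital_hom_lift[OF hom(3) surj(2)] .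
  have nG: "norm G \<le> K * r" and nH: "norm H \<le> K * r" using G H gh Kz by linarith+
  define d' where "d' = (1 + G) * d * (1 + H)"
  have "1 + G \<in> invertibles" "1 + H \<in> invertibles"
    using nG nH r(4) by (auto intro: invertible_near_one)
  then have d': "d' \<in> quasi_invertibles" unfolding d'_def using d(1) by (intro quasi_invertibles_mult)
  have "\<pi> d' = t b" by (simp add: d'_def hom_simps G H pd gh(1)[symmetric])
  then have pd': "\<pi> d' = \<pi> (\<mu> a)" by (simp add: comm a)
  then obtain c where c: "f c = f a" "\<mu> c = d'" "norm (c - a) \<le> norm (d' - \<mu> a)" by (rule glue)
  obtain xd where xd: "moore_penrose d' xd" "orthogonal_defects d' xd"
    using d' by (rule quasi_invertible_imp_moore_penrose)
  have "moore_penrose (t b) (\<pi> xd)"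
    using moore_penrose_hom[OF hom(3) xd(1)] by (simp add: \<open>\<pi> d' = t b\<close>)
  then have "t x = \<pi> xd" by (rule moore_penrose_unique[OF tx])
  then obtain cx where cx: "f cx = x" "\<mu> cx = xd" using ex_pair by metis
  have fc: "f c = b" by (simp add: c a)
  have "moore_penrose c cx"
    using x(1) xd(1) unfolding moore_penrose_def
    by (intro conjI; intro pair_eqI; simp add: hom_simps cx fc c(2))
  moreover have "orthogonal_defects c cx"
    using x(2) xd(2) unfolding orthogonal_defects_def
    by (intro allI pair_eqI; simp add: hom_simps cx fc c(2))
  ultimately have "c \<in> quasi_invertibles" by (auto simp: quasi_invertibles_iff)
  moreover have "norm (c - y) < e"
  proof -
    have "norm d \<le> norm m + 1" using norm_triangle_sub[of d m] d(2) r(2) by simp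
    have "norm (d' - d) \<le> 3 * (K * r) * norm d"
      unfolding d'_def by (rule norm_conj_perturbation) (use nG nH r(4) in simp_all)
    also have "\<dots> \<le> 3 * (K * r) * (norm m + 1)"
      using \<open>norm d \<le> norm m + 1\<close> r(1) K by (intro mult_left_mono) auto
    finally have "norm (d' - m) \<le> A * r"
      using norm_triangle_ineq[of "d' - d" "d - m"] d(2) by (simp add: A_def algebra_simps)
    then have "norm (c - a) < e / 2" using c(3) r(5) e by (simp add: m_def)
    then show ?thesis using norm_triangle_ineq[of "c - a" "a - y"] a(2) by simp
  qed
  ultimately show "\<exists>c\<in>quasi_invertibles. norm (c - y) < e" by blast
qed

end

lemma extremally_rich_lift_extremes:
  fixes f :: "'c::cstar_algebra_1 \<Rightarrow> 'd::cstar_algebra_1"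
  assumes rich: "extremally_rich_unital TYPE('c)" and f: "unital_hom f" "surj f"
  shows "f ` unit_ball_extremes = unit_ball_extremes"
proof
  show "f ` unit_ball_extremes \<subseteq> unit_ball_extremes"
    using unital_hom_extremal[OF f] by (auto simp: kadison_unit_ball_extremes)
  show "unit_ball_extremes \<subseteq> f ` unit_ball_extremes"
  proof
    fix w :: 'd assume "w \<in> unit_ball_extremes"
    then have w: "extremal w" by (simp add: kadison_unit_ball_extremes)
    have mp: "moore_penrose w (adj w)" by (rule moore_penrose_extremal[OF w])
    have def: "orthogonal_defects w (adj w)"
      using w by (simp add: orthogonal_defects_def extremal_def)
    obtain a where a: "f a = w" using f(2) by (metis surjD)
    define K where "K = 2 * norm (adj w) * (1 + norm w * norm (adj w))"
    have K: "0 \<le> K" by (simp add: K_def)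
    obtain d1 where d1: "0 < d1" "\<And>r. 0 \<le> r \<Longrightarrow> r \<le> d1 \<Longrightarrow> norm (adj w) * r \<le> 1/2"
      using ex_small_factor[of "norm (adj w)" "1/2"] by auto
    obtain d2 where d2: "0 < d2" "\<And>r. 0 \<le> r \<Longrightarrow> r \<le> d2 \<Longrightarrow> K * r \<le> 1/2"
      using ex_small_factor[of K "1/2"] K by auto
    have "0 < min d1 d2" using d1 d2 by simp
    then obtain c where c: "c \<in> quasi_invertibles" "norm (c - a) < min d1 d2"
      using rich unfolding extremally_rich_unital_iff by blast
    define z where "z = f (c - a)"
    have "norm z \<le> min d1 d2"
      using unital_hom_norm_le[OF f(1), of "c - a"] c(2) unfolding z_def by linarith
    then have z: "norm (adj w) * norm z \<le> 1/2" "K * norm z \<le> 1/2"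
      using d1(2)[of "norm z"] d2(2)[of "norm z"] by simp_all
    have fc: "f c = w + z" by (simp add: z_def unital_homD[OF f(1)] a)
    obtain g h where gh: "w = (1 + g) * (w + z) * (1 + h)"
      "norm g \<le> K * norm z" "norm h \<le> K * norm z"
      using mp def z(1) unfolding K_def moore_penrose_def by (meson orthogonal_defects_stable)
    obtain G where G: "f G = g" "norm G \<le> norm g" using unital_hom_lift[OF f] .
    obtain H where H: "f H = h" "norm H \<le> norm h" using unital_hom_lift[OF f] .
    define c' where "c' = (1 + G) * c * (1 + H)"
    have "1 + G \<in> invertibles" "1 + H \<in> invertibles"
      using G H gh(2,3) z(2) by (auto intro!: invertible_near_one)
    then have "c' \<in> quasi_invertibles" unfolding c'_def using c(1) by (intro quasi_invertibles_mult)
    then obtain x where x: "moore_penrose c' x" "orthogonal_defects c' x"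
      by (rule quasi_invertible_imp_moore_penrose)
    have fc': "f c' = w" by (simp add: c'_def unital_homD[OF f(1)] G H fc gh(1)[symmetric])
    have "moore_penrose w (f x)" using moore_penrose_hom[OF f(1) x(1)] by (simp add: fc')
    then have fx: "f x = adj w" using mp moore_penrose_unique by blast
    obtain u k where u: "c' = u * k" "extremal u" "k \<in> invertibles" "positive k"
      "k * k = adj c' * c' + (1 - x * c')" using x by (rule moore_penrose_polar)
    have "f k = 1"
    proof (rule positive_sqrt_unique)
      show "positive (f k)" using f(1) u(4) by (rule unital_hom_positive)
      \<comment> \<open>The image is \<open>adj w * w + (1 - adj w * w)\<close>, so \<open>k\<close>
        disappears from the polar decomposition and \<open>u\<close> itself lies over
        \<open>w\<close>.\<close>
      have "f (k * k) = 1" unfolding u(5) by (simp add: unital_homD[OF f(1)] fc' fx)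
      then show "f k * f k = 1 * 1" by (simp add: unital_homD(3)[OF f(1)])
    qed simp_all
    then have "f u = w" using fc' by (simp add: u(1) unital_homD(3)[OF f(1)])
    then show "w \<in> f ` unit_ball_extremes" using u(2) kadison_unit_ball_extremes by blast
  qed
qed

section \<open>Unital algebras and their unitizations\<close>

lemma is_unit_element_cunit: "unital TYPE('a) \<Longrightarrow> is_unit_element (cunit :: 'a::complex_normed_star_algebra)"
  unfolding unital_def using cunit_eqI by metis

lemma cunit_simps:
  fixes x :: "'a::complex_normed_star_algebra"
  assumes "unital TYPE('a)"
  shows "cunit * x = x" "x * cunit = x" "adj cunit = (cunit :: 'a)"
proof -
  show 1: "cunit * x = x" "x * cunit = x" for x :: 'a
    using is_unit_element_cunit[OF assms] by (auto simp: is_unit_element_def)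
  show "adj cunit = (cunit :: 'a)" by (metis 1 adj_adj adj_mult)
qed

text \<open>For unital \<open>A\<close>, the pair \<open>(unit_coord, scal_part)\<close> identifies
  \<open>A\<^sup>+\<close> with the direct sum of \<open>A\<close> and the complex numbers.\<close>

definition unit_coord :: "'a::cstar_algebra unitization \<Rightarrow> 'a" where
  "unit_coord x = alg_part x + scal_part x *\<^sub>C cunit"

lemma scal_part_simps:
  "scal_part 0 = 0" "scal_part 1 = 1" "scal_part (x + y) = scal_part x + scal_part y"
  "scal_part (x - y) = scal_part x - scal_part y" "scal_part (x * y) = scal_part x * scal_part y"
  "scal_part (adj x) = cnj (scal_part x)"
  for x y :: "'a::cstar_algebra unitization"
  by (simp_all add: unitization_defs one_unitization_def)

lemma scal_part_sum: "scal_part (\<Sum>k\<in>S. g k) = (\<Sum>k\<in>S. scal_part (g k))"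
  for g :: "'b \<Rightarrow> 'a::cstar_algebra unitization"
  by (induction S rule: infinite_finite_induct) (auto simp: scal_part_simps)

context
  assumes unital_a: "unital TYPE('a::cstar_algebra)"
begin

lemma unit_coord_simps:
  fixes x y :: "'a unitization"
  shows "unit_coord (0 :: 'a unitization) = 0" "unit_coord (1 :: 'a unitization) = cunit"
    "unit_coord (x + y) = unit_coord x + unit_coord y"
    "unit_coord (x - y) = unit_coord x - unit_coord y"
    "unit_coord (x * y) = unit_coord x * unit_coord y"
    "unit_coord (adj x) = adj (unit_coord x)"
  by (simp_all add: unit_coord_def unitization_defs one_unitization_def algebra_simps
      scaleC_add_left scaleC_add_right scaleC_diff_left adj_add adj_scaleC mult_scaleC_left mult_scaleC_right
      scaleC_scaleC cunit_simps[OF unital_a])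

lemma unit_coord_sum: "unit_coord (\<Sum>k\<in>S. g k) = (\<Sum>k\<in>S. unit_coord (g k :: 'a unitization))"
  by (induction S rule: infinite_finite_induct) (auto simp: unit_coord_simps)

lemma unit_coord_eqI:
  "unit_coord x = unit_coord y \<Longrightarrow> scal_part x = scal_part y \<Longrightarrow> x = y" for x y :: "'a unitization"
  by (simp add: unit_coord_def unitization.expand)

lemma unit_coord_ex: "\<exists>x :: 'a unitization. unit_coord x = a \<and> scal_part x = c"
  by (rule exI[of _ "Unitize (a - c *\<^sub>C cunit) c"]) (simp add: unit_coord_def)

lemma norm_unit_coord: "norm x = max (norm (unit_coord x)) (cmod (scal_part x))"
  for x :: "'a unitization"
proof (rule antisym)
  have act: "unitization_action x b = unit_coord x * b" for b
    by (simp add: unitization_action_def unit_coord_def algebra_simps mult_scaleC_left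
        cunit_simps[OF unital_a])
  show "norm x \<le> max (norm (unit_coord x)) (cmod (scal_part x))"
  proof (rule norm_unitization_le)
    show "norm (unitization_action x b) \<le> max (norm (unit_coord x)) (cmod (scal_part x)) * norm b" for b
      unfolding act by (intro norm_mult_le) auto
  qed simp
  have "norm (unit_coord x) * norm (unit_coord x) \<le> norm x * norm (unit_coord x)"
    using norm_action_le[of x "adj (unit_coord x)"]
    by (simp add: act norm_self_adj power2_eq_square)
  then have "norm (unit_coord x) \<le> norm x" by (cases "norm (unit_coord x) = 0") auto
  then show "max (norm (unit_coord x)) (cmod (scal_part x)) \<le> norm x"
    using norm_scal_le[of x] by simp
qed

lemma invertibles_unitization:
  "x \<in> invertibles \<longleftrightarrow> unit_coord x \<in> invertibles \<and> scal_part x \<noteq> 0" for x :: "'a unitization"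
proof
  assume "x \<in> invertibles"
  then obtain y where y: "x * y = 1" "y * x = 1" by (auto simp: invertibles_iff)
  have "unit_coord x * unit_coord y = cunit" "unit_coord y * unit_coord x = cunit"
    "scal_part x * scal_part y = 1"
    using arg_cong[OF y(1), of unit_coord] arg_cong[OF y(2), of unit_coord]
      arg_cong[OF y(1), of scal_part] by (simp_all add: unit_coord_simps scal_part_simps)
  then show "unit_coord x \<in> invertibles \<and> scal_part x \<noteq> 0" by (auto simp: invertibles_def)
next
  assume x: "unit_coord x \<in> invertibles \<and> scal_part x \<noteq> 0"
  then obtain b where b: "unit_coord x * b = cunit" "b * unit_coord x = cunit"
    by (auto simp: invertibles_def)
  obtain y :: "'a unitization" where y: "unit_coord y = b" "scal_part y = inverse (scal_part x)"
    using unit_coord_ex by blast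
  have "x * y = 1" "y * x = 1"
    by (rule unit_coord_eqI; simp add: unit_coord_simps scal_part_simps b y x)+
  then show "x \<in> invertibles" by (auto simp: invertibles_iff)
qed

text \<open>In a direct sum with maximum norm the unit ball is a product, so its extreme points are
  pairs of extreme points; in the complex disc these are the points of modulus 1.\<close>

lemma unit_ball_extremes_unitization:
  "x \<in> unit_ball_extremes \<longleftrightarrow> unit_coord x \<in> unit_ball_extremes \<and> cmod (scal_part x) = 1"
  for x :: "'a unitization"
proof
  assume "x \<in> unit_ball_extremes"
  then have n: "norm (unit_coord x) \<le> 1" "cmod (scal_part x) \<le> 1"
    and ext: "\<And>b. norm (x + b) \<le> 1 \<Longrightarrow> norm (x - b) \<le> 1 \<Longrightarrow> b = 0"
    by (auto simp: unit_ball_extremes_iff norm_unit_coord)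
  have "b = 0" if b: "norm (unit_coord x + b) \<le> 1" "norm (unit_coord x - b) \<le> 1" for b
  proof -
    obtain y :: "'a unitization" where y: "unit_coord y = b" "scal_part y = 0"
      using unit_coord_ex by blast
    have "y = 0"
      using b n by (intro ext) (simp_all add: norm_unit_coord unit_coord_simps scal_part_simps y)
    then show "b = 0" using y by (simp add: unit_coord_simps)
  qed
  then have "unit_coord x \<in> unit_ball_extremes" using n by (simp add: unit_ball_extremes_iff)
  moreover have "cmod (scal_part x) = 1"
  proof -
    define r where "r = complex_of_real (1 - cmod (scal_part x))"
    have r: "cmod r = 1 - cmod (scal_part x)" using n unfolding r_def norm_of_real by simp
    obtain y :: "'a unitization" where y: "unit_coord y = 0" "scal_part y = r"
      using unit_coord_ex by blast
    have "cmod (scal_part x + r) \<le> 1" "cmod (scal_part x - r) \<le> 1"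
      using norm_triangle_ineq[of "scal_part x" r] norm_triangle_ineq4[of "scal_part x" r] r by auto
    then have "y = 0"
      using n by (intro ext) (simp_all add: norm_unit_coord unit_coord_simps scal_part_simps y)
    then have "r = 0" using y by (simp add: scal_part_simps)
    then show ?thesis using r by simp
  qed
  ultimately show "unit_coord x \<in> unit_ball_extremes \<and> cmod (scal_part x) = 1" by blast
next
  assume x: "unit_coord x \<in> unit_ball_extremes \<and> cmod (scal_part x) = 1"
  then have n: "norm (unit_coord x) \<le> 1"
    and ext: "\<And>b. norm (unit_coord x + b) \<le> 1 \<Longrightarrow> norm (unit_coord x - b) \<le> 1 \<Longrightarrow> b = 0"
    by (auto simp: unit_ball_extremes_iff)
  have "b = 0" if b: "norm (x + b) \<le> 1" "norm (x - b) \<le> 1" for b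
  proof (rule unit_coord_eqI)
    have nb: "norm (unit_coord x + unit_coord b) \<le> 1" "norm (unit_coord x - unit_coord b) \<le> 1"
      "cmod (scal_part x + scal_part b) \<le> 1" "cmod (scal_part x - scal_part b) \<le> 1"
      using b by (simp_all add: norm_unit_coord unit_coord_simps scal_part_simps)
    then show "unit_coord b = unit_coord 0" by (simp add: ext unit_coord_simps)
    have "(cmod (scal_part x + scal_part b))\<^sup>2 + (cmod (scal_part x - scal_part b))\<^sup>2 \<le> 1 + 1"
      using nb by (intro add_mono power_le_one) auto
    then have "2 * (cmod (scal_part x))\<^sup>2 + 2 * (cmod (scal_part b))\<^sup>2 \<le> 2"
      unfolding cmod_power2 by (simp add: power2_eq_square algebra_simps)
    then show "scal_part b = scal_part 0" using x by (simp add: scal_part_simps)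
  qed
  then show "x \<in> unit_ball_extremes" using n x by (simp add: unit_ball_extremes_iff norm_unit_coord)
qed

lemma tsr_unital_unitization: "tsr_unital TYPE('a unitization) = tsr_unital TYPE('a)"
proof -
  have "(\<forall>(y :: nat \<Rightarrow> 'a) e. 0 < e \<longrightarrow>
        (\<exists>x. (\<forall>k<d. norm (x k - y k) < e) \<and> (\<Sum>k<d. adj (x k) * x k) \<in> invertibles))
    \<longleftrightarrow> (\<forall>(y :: nat \<Rightarrow> 'a unitization) e. 0 < e \<longrightarrow>
        (\<exists>x. (\<forall>k<d. norm (x k - y k) < e) \<and> (\<Sum>k<d. adj (x k) * x k) \<in> invertibles))"
    (is "?A \<longleftrightarrow> ?B") if d: "1 \<le> d" for d
  proof (intro iffI allI impI)
    fix y :: "nat \<Rightarrow> 'a unitization" and e :: real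
    assume ?A and e: "0 < e"
    then obtain x where x: "\<forall>k<d. norm (x k - unit_coord (y k)) < e"
      "(\<Sum>k<d. adj (x k) * x k) \<in> invertibles"
      by meson
    \<comment> \<open>Where the given scalar is 0, a nonzero one within \<open>e\<close> is
      substituted. As \<open>1 \<le> d\<close> there is at least one summand, so the scalar sum is
      nonzero.\<close>
    define c where "c k = (if scal_part (y k) = 0 then complex_of_real (e / 2) else scal_part (y k))" for k
    have c: "c k \<noteq> 0" "cmod (c k - scal_part (y k)) < e" for k
      using e by (auto simp: c_def)
    have "\<exists>z :: 'a unitization. unit_coord z = x k \<and> scal_part z = c k" for k
      by (rule unit_coord_ex)
    then obtain z :: "nat \<Rightarrow> 'a unitization" where z: "\<And>k. unit_coord (z k) = x k" "\<And>k. scal_part (z k) = c k"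
      by metis
    have "0 < (\<Sum>k<d. (cmod (c k))\<^sup>2)" 
      using d c(1) by (intro sum_pos) (auto simp: lessThan_empty_iff bot_nat_def)
    moreover have "(\<Sum>k<d. cnj (c k) * c k) = complex_of_real (\<Sum>k<d. (cmod (c k))\<^sup>2)"
      unfolding of_real_sum complex_norm_square by (simp add: mult.commute)
    ultimately have "(\<Sum>k<d. cnj (c k) * c k) \<noteq> 0" by (metis less_irrefl of_real_eq_0_iff)
    then have "(\<Sum>k<d. adj (z k) * z k) \<in> invertibles"
      using x(2) by (simp add: invertibles_unitization unit_coord_sum scal_part_sum unit_coord_simps
          scal_part_simps z)
    moreover have "\<forall>k<d. norm (z k - y k) < e"
      using x(1) c(2) by (simp add: norm_unit_coord unit_coord_simps scal_part_simps z)
    ultimately show "\<exists>x. (\<forall>k<d. norm (x k - y k) < e) \<and> (\<Sum>k<d. adj (x k) * x k) \<in> invertibles"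
      by blast
  next
    fix y :: "nat \<Rightarrow> 'a" and e :: real
    assume B: ?B and e: "0 < e"
    have "\<exists>z :: 'a unitization. unit_coord z = y k \<and> scal_part z = 0" for k
      by (rule unit_coord_ex)
    then obtain z :: "nat \<Rightarrow> 'a unitization" where z: "\<And>k. unit_coord (z k) = y k" by metis
    obtain x where x: "\<forall>k<d. norm (x k - z k) < e" "(\<Sum>k<d. adj (x k) * x k) \<in> invertibles"
      using B e by meson
    then have "\<forall>k<d. norm (unit_coord (x k) - y k) < e"
      by (simp add: norm_unit_coord unit_coord_simps z)
    moreover have "(\<Sum>k<d. adj (unit_coord (x k)) * unit_coord (x k)) \<in> invertibles"
      using x(2) by (simp add: invertibles_unitization unit_coord_sum unit_coord_simps)
    ultimately show "\<exists>x. (\<forall>k<d. norm (x k - y k) < e) \<and> (\<Sum>k<d. adj (x k) * x k) \<in> invertibles"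
      by (intro exI[of _ "\<lambda>k. unit_coord (x k)"]) simp
  qed
  then have "{enat d | d. 1 \<le> d \<and> (\<forall>(y :: nat \<Rightarrow> 'a unitization) e. 0 < e \<longrightarrow>
        (\<exists>x. (\<forall>k<d. norm (x k - y k) < e) \<and> (\<Sum>k<d. adj (x k) * x k) \<in> invertibles))}
    = {enat d | d. 1 \<le> d \<and> (\<forall>(y :: nat \<Rightarrow> 'a) e. 0 < e \<longrightarrow>
        (\<exists>x. (\<forall>k<d. norm (x k - y k) < e) \<and> (\<Sum>k<d. adj (x k) * x k) \<in> invertibles))}"
    by blast
  then show ?thesis unfolding tsr_unital_def by (rule arg_cong)
qed

lemma real_rank_zero_unital_unitization:
  "real_rank_zero_unital TYPE('a unitization) \<longleftrightarrow> real_rank_zero_unital TYPE('a)"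
proof
  assume L: "real_rank_zero_unital TYPE('a unitization)"
  show "real_rank_zero_unital TYPE('a)"
    unfolding real_rank_zero_unital_def closure_approachable subset_iff mem_Collect_eq dist_norm
  proof (intro allI impI)
    fix y :: 'a and e :: real
    assume y: "adj y = y" and e: "0 < e"
    obtain z :: "'a unitization" where z: "unit_coord z = y" "scal_part z = 0"
      using unit_coord_ex by blast
    have "adj z = z" by (rule unit_coord_eqI) (simp_all add: unit_coord_simps scal_part_simps z y)
    then obtain x where x: "adj x = x" "x \<in> invertibles" "norm (x - z) < e"
      using L e unfolding real_rank_zero_unital_def closure_approachable subset_iff mem_Collect_eq dist_norm
      by blast
    have "adj (unit_coord x) = unit_coord x" using x(1) by (simp add: unit_coord_simps(6)[symmetric])
    moreover have "unit_coord x \<in> invertibles" using x(2) by (simp add: invertibles_unitization)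
    moreover have "norm (unit_coord x - y) < e"
      using x(3) by (simp add: norm_unit_coord unit_coord_simps z)
    ultimately show "\<exists>x\<in>{x. adj x = x \<and> x \<in> invertibles}. norm (x - y) < e" by blast
  qed
next
  assume R: "real_rank_zero_unital TYPE('a)"
  show "real_rank_zero_unital TYPE('a unitization)"
    unfolding real_rank_zero_unital_def closure_approachable subset_iff mem_Collect_eq dist_norm
  proof (intro allI impI)
    fix y :: "'a unitization" and e :: real
    assume y: "adj y = y" and e: "0 < e"
    then have "adj (unit_coord y) = unit_coord y" by (simp add: unit_coord_simps(6)[symmetric])
    then obtain x where x: "adj x = x" "x \<in> invertibles" "norm (x - unit_coord y) < e"
      using R e unfolding real_rank_zero_unital_def closure_approachable subset_iff mem_Collect_eq dist_norm
      by blast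
    define c where "c = (if scal_part y = 0 then complex_of_real (e / 2) else scal_part y)"
    have "cnj (scal_part y) = scal_part y" using y by (simp add: scal_part_simps(6)[symmetric])
    then have c: "c \<noteq> 0" "cmod (c - scal_part y) < e" "cnj c = c"
      using e by (auto simp: c_def)
    obtain z :: "'a unitization" where z: "unit_coord z = x" "scal_part z = c"
      using unit_coord_ex by blast
    have "adj z = z" by (rule unit_coord_eqI) (simp_all add: unit_coord_simps scal_part_simps z x c)
    moreover have "z \<in> invertibles" by (simp add: invertibles_unitization z x c)
    moreover have "norm (z - y) < e"
      using x(3) c(2) by (simp add: norm_unit_coord unit_coord_simps scal_part_simps z)
    ultimately show "\<exists>x\<in>{x. adj x = x \<and> x \<in> invertibles}. norm (x - y) < e" by blast
  qed
qed

lemma quasi_invertibles_unitization: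
  "x \<in> quasi_invertibles \<longleftrightarrow> unit_coord x \<in> quasi_invertibles \<and> scal_part x \<noteq> 0"
  for x :: "'a unitization"
proof
  assume "x \<in> quasi_invertibles"
  then obtain b v c where x: "x = b * v * c" "b \<in> invertibles" "v \<in> unit_ball_extremes" "c \<in> invertibles"
    by (auto simp: quasi_invertibles_def)
  have "unit_coord x = unit_coord b * unit_coord v * unit_coord c"
    "scal_part x = scal_part b * scal_part v * scal_part c"
    by (simp_all add: x unit_coord_simps scal_part_simps)
  then show "unit_coord x \<in> quasi_invertibles \<and> scal_part x \<noteq> 0"
    using x(2-4) unfolding invertibles_unitization unit_ball_extremes_unitization quasi_invertibles_def
    by fastforce
next
  assume x: "unit_coord x \<in> quasi_invertibles \<and> scal_part x \<noteq> 0"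
  then obtain b v c where bvc: "unit_coord x = b * v * c" "b \<in> invertibles" "v \<in> unit_ball_extremes"
    "c \<in> invertibles"
    by (auto simp: quasi_invertibles_def)
  obtain b' :: "'a unitization" where b': "unit_coord b' = b" "scal_part b' = scal_part x"
    using unit_coord_ex by blast
  obtain v' :: "'a unitization" where v': "unit_coord v' = v" "scal_part v' = 1"
    using unit_coord_ex by blast
  obtain c' :: "'a unitization" where c': "unit_coord c' = c" "scal_part c' = 1"
    using unit_coord_ex by blast
  have "x = b' * v' * c'"
    by (rule unit_coord_eqI) (simp_all add: unit_coord_simps scal_part_simps b' v' c' bvc)
  moreover have "b' \<in> invertibles" "v' \<in> unit_ball_extremes" "c' \<in> invertibles"
    by (simp_all add: invertibles_unitization unit_ball_extremes_unitization b' v' c' bvc x)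
  ultimately show "x \<in> quasi_invertibles" unfolding quasi_invertibles_def by blast
qed

lemma extremally_rich_unital_unitization:
  "extremally_rich_unital TYPE('a unitization) \<longleftrightarrow> extremally_rich_unital TYPE('a)"
proof
  assume L: "extremally_rich_unital TYPE('a unitization)"
  have "\<exists>b\<in>quasi_invertibles. norm (b - a) < e" if "0 < e" for a :: 'a and e
  proof -
    obtain z :: "'a unitization" where z: "unit_coord z = a" "scal_part z = 0"
      using unit_coord_ex by blast
    obtain x where "x \<in> quasi_invertibles" "norm (x - z) < e"
      using L \<open>0 < e\<close> unfolding extremally_rich_unital_iff by blast
    then show ?thesis
      by (intro bexI[of _ "unit_coord x"])
        (simp_all add: quasi_invertibles_unitization norm_unit_coord unit_coord_simps z)
  qed
  then show "extremally_rich_unital TYPE('a)"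
    by (auto simp: extremally_rich_unital_def set_eq_iff closure_approachable dist_norm)
next
  assume R: "extremally_rich_unital TYPE('a)"
  have R': "\<exists>b\<in>quasi_invertibles. norm (b - a) < e" if "0 < e" for a :: 'a and e
    using R that by (auto simp: extremally_rich_unital_def set_eq_iff closure_approachable dist_norm)
  show "extremally_rich_unital TYPE('a unitization)"
    unfolding extremally_rich_unital_iff
  proof (intro allI impI)
    fix y :: "'a unitization" and e :: real
    assume e: "0 < e"
    obtain x where x: "x \<in> quasi_invertibles" "norm (x - unit_coord y) < e" using R'[OF e] by blast
    define c where "c = (if scal_part y = 0 then complex_of_real (e / 2) else scal_part y)"
    have c: "c \<noteq> 0" "cmod (c - scal_part y) < e" using e by (auto simp: c_def)
    obtain z :: "'a unitization" where z: "unit_coord z = x" "scal_part z = c"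
      using unit_coord_ex by blast
    show "\<exists>b\<in>quasi_invertibles. norm (b - y) < e"
      using x c by (intro bexI[of _ z])
        (simp_all add: quasi_invertibles_unitization norm_unit_coord unit_coord_simps scal_part_simps z)
  qed
qed

end

text \<open>Holds whether or not \<open>'a\<close> is unital; in particular a unital quotient of a
  non-unital algebra needs no separate case.\<close>

lemma tsr_eq_unitization: "tsr TYPE('a::cstar_algebra) = tsr_unital TYPE('a unitization)"
  by (simp add: tsr_def tsr_unital_unitization)

lemma real_rank_zero_iff_unitization:
  "real_rank_zero TYPE('a::cstar_algebra) \<longleftrightarrow> real_rank_zero_unital TYPE('a unitization)"
  by (simp add: real_rank_zero_def real_rank_zero_unital_unitization)

lemma extremally_rich_iff_unitization:
  "extremally_rich TYPE('a::cstar_algebra) \<longleftrightarrow> extremally_rich_unital TYPE('a unitization)"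
  by (simp add: extremally_rich_def extremally_rich_unital_unitization)

section \<open>The pullback of an extension\<close>

lemma unital_hom_unitization_map: "star_hom f \<Longrightarrow> unital_hom (unitization_map f)"
proof -
  assume f: "star_hom f"
  then have "f 0 = 0" unfolding star_hom_def by (metis scaleC_zero_left)
  with f show ?thesis
    by (simp add: unital_hom_def star_hom_def unitization_map_def unitization_defs one_unitization_def)
qed

lemma unital_hom_unital_extension:
  fixes g :: "'a::cstar_algebra \<Rightarrow> 'b::cstar_algebra_1"
  assumes "star_hom g"
  shows "unital_hom (unital_extension g)"
proof -
  have "g 0 = 0" using assms unfolding star_hom_def by (metis scaleC_zero_left)
  with assms show ?thesis
    by (simp add: unital_hom_def star_hom_def unital_extension_def unitization_defs
        one_unitization_def algebra_simps scaleC_add_left scaleC_add_right scaleC_scaleC adj_add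
        adj_scaleC mult_scaleC_left mult_scaleC_right)
qed

lemma norm_Unitize_zero [simp]: "norm (Unitize a 0) = norm a" for a :: "'a::cstar_algebra"
  using norm_alg_part_le[of "Unitize a 0"] norm_unitization_le_sum[of "Unitize a 0"] by simp

context
  fixes \<iota> :: "'i::cstar_algebra \<Rightarrow> 'a::cstar_algebra"
    and \<eta> :: "'a \<Rightarrow> 'b::cstar_algebra"
  assumes ext: "cstar_extension \<iota> \<eta>"
begin

lemma iota: "star_hom \<iota>" "inj \<iota>" and eta: "star_hom \<eta>" "surj \<eta>"
  and exact: "range \<iota> = {a. \<eta> a = 0}"
  using ext by (auto simp: cstar_extension_def)

lemma iota_zero: "\<iota> 0 = 0"
  using iota(1) unfolding star_hom_def by (metis scaleC_zero_left)

text \<open>Injectivity passes to the unitizations, where injective unital homomorphisms are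
  isometric. This supplies the isometry assumption of \<open>ideal_action\<close> and
  \<open>busby_eta\<close>.\<close>

lemma norm_iota: "norm (\<iota> i) = norm i"
proof -
  have "norm (unitization_map \<iota> (Unitize i 0)) = norm (Unitize i 0)"
  proof (rule unital_hom_isometric)
    show "unital_hom (unitization_map \<iota>)" by (rule unital_hom_unitization_map[OF iota(1)])
    show "x = 0" if "unitization_map \<iota> x = 0" for x
    proof -
      have "\<iota> (alg_part x) = \<iota> 0" "scal_part x = 0"
        using that by (simp_all add: unitization_map_def zero_unitization_def iota_zero)
      then show ?thesis using injD[OF iota(2)]
        by (simp add: zero_unitization_def unitization.expand)
    qed
  qed
  then show ?thesis by (simp add: unitization_map_def)
qed

lemmas act = ideal_action[OF ext norm_iota]

lemma ideal_action_eqI: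
  "(\<And>i. a * \<iota> i = \<iota> (mult_L m i)) \<Longrightarrow> ideal_action \<iota> a = m"
  by (rule multiplier_eqI', rule injD[OF iota(2)]) (simp add: act)

lemma star_hom_ideal_action: "star_hom (ideal_action \<iota>)"
proof -
  have h: "\<iota> (x + y) = \<iota> x + \<iota> y" "\<iota> (c *\<^sub>C x) = c *\<^sub>C \<iota> x" "\<iota> (x * y) = \<iota> x * \<iota> y"
    "\<iota> (adj x) = adj (\<iota> x)" for x y c
    using iota(1) by (auto simp: star_hom_def)
  show ?thesis unfolding star_hom_def
  proof (intro conjI allI)
    show "ideal_action \<iota> (x + y) = ideal_action \<iota> x + ideal_action \<iota> y" for x y
      by (rule ideal_action_eqI) (simp add: multiplier_apply h act algebra_simps)
    show "ideal_action \<iota> (c *\<^sub>C x) = c *\<^sub>C ideal_action \<iota> x" for c x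
      by (rule ideal_action_eqI) (simp add: multiplier_apply h act mult_scaleC_left)
    show "ideal_action \<iota> (x * y) = ideal_action \<iota> x * ideal_action \<iota> y" for x y
      by (rule ideal_action_eqI) (simp add: multiplier_apply h act mult.assoc)
    show "ideal_action \<iota> (adj x) = adj (ideal_action \<iota> x)" for x
      by (rule ideal_action_eqI) (simp add: multiplier_apply h act adj_mult adj_adj)
  qed
qed

lemma mult_L_one: "mult_L 1 i = (i :: 'i)"
proof -
  have "multiplier_of (mult_L 1 i - i) = 0"
    by (simp add: multiplier_of_algebra(2) multiplier_of_algebra(9)[symmetric])
  then show ?thesis using norm_multiplier_of[of "mult_L 1 i - i"] by simp
qed

lemma ideal_action_iota: "ideal_action \<iota> (\<iota> j) = multiplier_of j"
  using iota(1) by (intro ideal_action_eqI) (simp add: star_hom_def)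

lemma star_hom_busby: "star_hom (busby \<iota> \<eta>)"
proof -
  note busby = busby_eta[OF ext norm_iota]
  have e: "\<eta> (x + y) = \<eta> x + \<eta> y" "\<eta> (c *\<^sub>C x) = c *\<^sub>C \<eta> x" "\<eta> (x * y) = \<eta> x * \<eta> y"
    "\<eta> (adj x) = adj (\<eta> x)" for x y c
    using eta(1) by (auto simp: star_hom_def)
  have a: "ideal_action \<iota> (x + y) = ideal_action \<iota> x + ideal_action \<iota> y"
    "ideal_action \<iota> (c *\<^sub>C x) = c *\<^sub>C ideal_action \<iota> x"
    "ideal_action \<iota> (x * y) = ideal_action \<iota> x * ideal_action \<iota> y"
    "ideal_action \<iota> (adj x) = adj (ideal_action \<iota> x)" for x y c
    using star_hom_ideal_action by (auto simp: star_hom_def)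
  note c = plus_corona.abs_eq scaleC_corona.abs_eq times_corona.abs_eq adj_corona.abs_eq
  show ?thesis unfolding star_hom_def
  proof (intro conjI allI)
    fix x y and k :: complex
    obtain x' y' where x: "x = \<eta> x'" "y = \<eta> y'" using eta(2) by (metis surjD)
    show "busby \<iota> \<eta> (x + y) = busby \<iota> \<eta> x + busby \<iota> \<eta> y"
      unfolding x e(1)[symmetric] busby a c ..
    show "busby \<iota> \<eta> (k *\<^sub>C x) = k *\<^sub>C busby \<iota> \<eta> x"
      unfolding x e(2)[symmetric] busby a c ..
    show "busby \<iota> \<eta> (x * y) = busby \<iota> \<eta> x * busby \<iota> \<eta> y"
      unfolding x e(3)[symmetric] busby a c ..
    show "busby \<iota> \<eta> (adj x) = adj (busby \<iota> \<eta> x)"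
      unfolding x e(4)[symmetric] busby a c ..
  qed
qed

lemma surj_unitization_map: "surj (unitization_map \<eta>)"
proof (rule surjI)
  show "unitization_map \<eta> (Unitize (inv \<eta> (alg_part x)) (scal_part x)) = x" for x
    by (simp add: unitization_map_def surj_f_inv_f[OF eta(2)])
qed

text \<open>Only \<open>A\<close> and \<open>B\<close> receive a new unit; scalars of
  \<open>A\<^sup>+\<close> go to multiples of the unit that \<open>M(I)\<close> already has.\<close>

lemma cstar_pullback_extension:
  "cstar_pullback (unitization_map \<eta>) (unital_extension (ideal_action \<iota>)) abs_corona
     (unital_extension (busby \<iota> \<eta>))"
proof
  show "unital_hom (unitization_map \<eta>)" by (rule unital_hom_unitization_map[OF eta(1)])
  show "unital_hom (unital_extension (ideal_action \<iota>))"
    by (rule unital_hom_unital_extension[OF star_hom_ideal_action])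
  show "unital_hom (unital_extension (busby \<iota> \<eta>))"
    by (rule unital_hom_unital_extension[OF star_hom_busby])
  show comm: "abs_corona (unital_extension (ideal_action \<iota>) c)
      = unital_extension (busby \<iota> \<eta>) (unitization_map \<eta> c)" for c
    by (simp add: unital_extension_def unitization_map_def busby_eta[OF ext norm_iota]
        unital_homD[OF unital_hom_abs_corona])
  show "\<exists>c. unitization_map \<eta> c = x \<and> unital_extension (ideal_action \<iota>) c = m"
    if xm: "unital_extension (busby \<iota> \<eta>) x = abs_corona m" for x m
  proof -
    obtain a where a: "unitization_map \<eta> a = x" using surj_unitization_map by (metis surjD)
    have "abs_corona m = abs_corona (unital_extension (ideal_action \<iota>) a)"
      by (simp add: comm a xm)
    \<comment> \<open>Multipliers with the same image differ by an element of \<open>I\<close>, so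
      the lift can be corrected without changing its image in \<open>B\<^sup>+\<close>.\<close>
    then obtain j where j: "m - unital_extension (ideal_action \<iota>) a = multiplier_of j"
      by (auto simp: corona.abs_eq_iff)
    define c where "c = Unitize (alg_part a + \<iota> j) (scal_part a)"
    have "\<eta> (\<iota> j) = 0" using exact by blast
    then have "unitization_map \<eta> c = x"
      using eta(1) a by (simp add: c_def unitization_map_def star_hom_def)
    moreover have "unital_extension (ideal_action \<iota>) c = m"
      using j star_hom_ideal_action
      by (simp add: c_def unital_extension_def star_hom_def ideal_action_iota algebra_simps)
    ultimately show ?thesis by blast
  qed
  show "norm c \<le> norm (unital_extension (ideal_action \<iota>) c)" if "unitization_map \<eta> c = 0" for c
  proof -
    have "\<eta> (alg_part c) = 0" "scal_part c = 0"
      using that by (simp_all add: unitization_map_def zero_unitization_def)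
    then obtain i where "alg_part c = \<iota> i" using exact by blast
    then have "c = Unitize (\<iota> i) 0" using \<open>scal_part c = 0\<close> by (simp add: unitization.expand)
    then show ?thesis by (simp add: norm_iota unital_extension_def ideal_action_iota)
  qed
qed (rule unital_hom_abs_corona surj_unitization_map surj_abs_corona)+

section \<open>Extreme points and the Busby invariant\<close>

text \<open>The ideal is essential in its multiplier algebra, so orthogonality of the defect projections
  need only be tested on the ideal.\<close>

lemma extremal_ideal_action:
  assumes u: "extremal u"
  shows "extremal (unital_extension (ideal_action \<iota>) u)"
  unfolding extremal_def
proof
  let ?\<mu> = "unital_extension (ideal_action \<iota>)"
  fix m :: "'i multiplier"
  note hom = unital_homD[OF unital_hom_unital_extension[OF star_hom_ideal_action]]
  define p q where "p = 1 - ?\<mu> u * adj (?\<mu> u)" "q = 1 - adj (?\<mu> u) * ?\<mu> u"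
  define y where "y = p * m * q"
  have pIq: "p * multiplier_of j * q = 0" for j
  proof -
    have "?\<mu> (Unitize (\<iota> j) 0) = multiplier_of j"
      by (simp add: unital_extension_def ideal_action_iota)
    moreover have "?\<mu> ((1 - u * adj u) * Unitize (\<iota> j) 0 * (1 - adj u * u)) = 0"
      using u by (simp add: extremal_def hom)
    ultimately show ?thesis by (simp add: p_q_def hom)
  qed
  have "mult_L y k = 0" for k
  proof -
    \<comment> \<open>The factor \<open>k * adj k\<close> brings the middle part into the ideal, and
      \<open>adj y\<close> supplies the \<open>q\<close> on its right, so \<open>pIq\<close>
      applies.\<close>
    have "(y * multiplier_of k) * adj (y * multiplier_of k)
        = p * (m * q * multiplier_of (k * adj k)) * q * adj m * adj p"
      by (simp add: y_def adj_mult multiplier_of_algebra(7,8) mult.assoc)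
         (simp add: p_q_def adj_diff adj_mult adj_adj)
    also have "m * q * multiplier_of (k * adj k) = multiplier_of (mult_L (m * q) (k * adj k))"
      by (rule multiplier_of_algebra(9))
    finally have "(y * multiplier_of k) * adj (y * multiplier_of k) = 0" by (simp add: pIq)
    then have "norm (y * multiplier_of k) = 0" using norm_self_adj[of "y * multiplier_of k"] by simp
    then have "norm (multiplier_of (mult_L y k)) = 0" by (simp only: multiplier_of_algebra(9))
    then show ?thesis by simp
  qed
  then have "y = 0" by (intro multiplier_eqI') (simp add: mult_L_simps)
  then show "p * m * q = 0" by (simp add: y_def)
qed

lemma busby_extremes_of_lift:
  assumes "unitization_map \<eta> ` unit_ball_extremes = unit_ball_extremes"
  shows "extreme_point_preserving (unital_extension (busby \<iota> \<eta>))"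
  unfolding extreme_point_preserving_def
proof (rule image_subsetI)
  interpret cstar_pullback "unitization_map \<eta>" "unital_extension (ideal_action \<iota>)" abs_corona
    "unital_extension (busby \<iota> \<eta>)" by (rule cstar_pullback_extension)
  fix b :: "'b unitization" assume "b \<in> unit_ball_extremes"
  then obtain u where u: "u \<in> unit_ball_extremes" "b = unitization_map \<eta> u" using assms by blast
  have "extremal (abs_corona (unital_extension (ideal_action \<iota>) u))"
    using u by (intro unital_hom_extremal[OF hom(3) surj(2)] extremal_ideal_action)
      (simp add: kadison_unit_ball_extremes)
  then show "unital_extension (busby \<iota> \<eta>) b \<in> unit_ball_extremes"
    by (simp add: comm u(2) kadison_unit_ball_extremes)
qed

theorem extremally_rich_extension:
  assumes "extremally_rich_unital TYPE('b unitization)" "extremally_rich_unital TYPE('i multiplier)"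
  shows "extreme_point_preserving (unital_extension (busby \<iota> \<eta>)) \<longleftrightarrow>
      unitization_map \<eta> ` unit_ball_extremes = unit_ball_extremes" (is "?i \<longleftrightarrow> ?ii")
    and "unitization_map \<eta> ` unit_ball_extremes = unit_ball_extremes \<longleftrightarrow>
      extremally_rich_unital TYPE('a unitization)" (is "_ \<longleftrightarrow> ?iii")
proof -
  interpret cstar_pullback "unitization_map \<eta>" "unital_extension (ideal_action \<iota>)" abs_corona
    "unital_extension (busby \<iota> \<eta>)" by (rule cstar_pullback_extension)
  have "?i \<Longrightarrow> ?iii" using assms by (rule extremally_rich_pullback)
  moreover have "?iii \<Longrightarrow> ?ii" by (rule extremally_rich_lift_extremes[OF _ hom(1) surj(1)])
  moreover have "?ii \<Longrightarrow> ?i" by (rule busby_extremes_of_lift)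
  ultimately show "?i \<longleftrightarrow> ?ii" "?ii \<longleftrightarrow> ?iii" by blast+
qed

section \<open>Unital \<open>A\<close>: return to the literal reading of (c)\<close>

context
  assumes unital_a: "unital TYPE('a)"
begin

lemma eta_cunit: "is_unit_element (\<eta> cunit)"
  unfolding is_unit_element_def
proof
  fix x
  obtain y where y: "x = \<eta> y" using eta(2) by (metis surjD)
  have e: "\<eta> (x * y) = \<eta> x * \<eta> y" for x y using eta(1) by (simp add: star_hom_def)
  show "\<eta> cunit * x = x \<and> x * \<eta> cunit = x"
    unfolding y e[symmetric] cunit_simps[OF unital_a] by simp
qed

lemma unital_quotient: "unital TYPE('b)" "\<eta> cunit = cunit"
  using eta_cunit cunit_eqI[OF eta_cunit] by (auto simp: unital_def)

lemma unit_coord_unitization_map: "unit_coord (unitization_map \<eta> x) = \<eta> (unit_coord x)"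
  using eta(1) by (simp add: unit_coord_def unitization_map_def star_hom_def unital_quotient)

lemma busby_cunit: "busby \<iota> \<eta> cunit = 1"
proof -
  have "ideal_action \<iota> cunit = 1"
    by (intro ideal_action_eqI) (simp add: cunit_simps[OF unital_a] mult_L_one)
  then show ?thesis
    using busby_eta[OF ext norm_iota, of cunit] by (simp add: unital_quotient one_corona_def)
qed

lemma unital_extension_busby: "unital_extension (busby \<iota> \<eta>) x = busby \<iota> \<eta> (unit_coord x)"
  using star_hom_busby by (simp add: unital_extension_def unit_coord_def star_hom_def busby_cunit)

text \<open>In the coordinates \<open>unit_coord\<close> and \<open>scal_part\<close> the extended
  map is \<open>\<eta>\<close> together with the identity on scalars, and scalars of modulus 1 lift
  trivially.\<close>

lemma unitization_extremes_iff:
  "unitization_map \<eta> ` unit_ball_extremes = unit_ball_extremes \<longleftrightarrow>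
     \<eta> ` unit_ball_extremes = unit_ball_extremes"
proof -
  note E = unit_ball_extremes_unitization[OF unital_a]
    unit_ball_extremes_unitization[OF unital_quotient(1)]
  have sc: "scal_part (unitization_map \<eta> x) = scal_part x" for x
    by (simp add: unitization_map_def)
  show ?thesis
  proof (intro iffI; rule set_eqI)
    fix v :: 'b
    assume L: "unitization_map \<eta> ` unit_ball_extremes = unit_ball_extremes"
    obtain w :: "'b unitization" where w: "unit_coord w = v" "scal_part w = 1"
      using unit_coord_ex[OF unital_quotient(1)] by blast
    show "v \<in> \<eta> ` unit_ball_extremes \<longleftrightarrow> v \<in> unit_ball_extremes"
    proof
      assume "v \<in> unit_ball_extremes"
      then have "w \<in> unit_ball_extremes" by (simp add: E w)
      then obtain u where "u \<in> unit_ball_extremes" "w = unitization_map \<eta> u" using L by blast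
      then show "v \<in> \<eta> ` unit_ball_extremes"
        using w by (auto simp: E unit_coord_unitization_map)
    next
      assume "v \<in> \<eta> ` unit_ball_extremes"
      then obtain u where u: "v = \<eta> u" "u \<in> unit_ball_extremes" by blast
      obtain z :: "'a unitization" where z: "unit_coord z = u" "scal_part z = 1"
        using unit_coord_ex[OF unital_a] by blast
      have "unitization_map \<eta> z \<in> unit_ball_extremes" using L u z by (auto simp: E)
      then show "v \<in> unit_ball_extremes" by (simp add: E unit_coord_unitization_map z u)
    qed
  next
    fix v :: "'b unitization"
    assume R: "\<eta> ` unit_ball_extremes = unit_ball_extremes"
    show "v \<in> unitization_map \<eta> ` unit_ball_extremes \<longleftrightarrow> v \<in> unit_ball_extremes"
    proof
      assume "v \<in> unit_ball_extremes"
      then have v: "unit_coord v \<in> unit_ball_extremes" "cmod (scal_part v) = 1" by (simp_all add: E)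
      then obtain u where u: "u \<in> unit_ball_extremes" "unit_coord v = \<eta> u" using R by blast
      obtain z :: "'a unitization" where z: "unit_coord z = u" "scal_part z = scal_part v"
        using unit_coord_ex[OF unital_a] by blast
      have "v = unitization_map \<eta> z"
        by (rule unit_coord_eqI[OF unital_quotient(1)])
          (simp_all add: unit_coord_unitization_map sc z u)
      then show "v \<in> unitization_map \<eta> ` unit_ball_extremes" using u v by (auto simp: E z)
    next
      assume "v \<in> unitization_map \<eta> ` unit_ball_extremes"
      then show "v \<in> unit_ball_extremes" using R by (auto simp: E unit_coord_unitization_map sc)
    qed
  qed
qed

text \<open>For a unital Busby map the extension factors through \<open>unit_coord\<close>, which
  maps the extreme points of \<open>B\<^sup>+\<close> onto those of \<open>B\<close>.\<close>

lemma busby_extreme_point_preserving_iff: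
  "extreme_point_preserving (unital_extension (busby \<iota> \<eta>)) \<longleftrightarrow>
     extreme_point_preserving (busby \<iota> \<eta>)"
proof -
  note E = unit_ball_extremes_unitization[OF unital_quotient(1)]
  have "v \<in> unit_coord ` (unit_ball_extremes :: 'b unitization set) \<longleftrightarrow> v \<in> unit_ball_extremes" for v
  proof
    assume v: "v \<in> unit_ball_extremes"
    obtain w :: "'b unitization" where w: "unit_coord w = v" "scal_part w = 1"
      using unit_coord_ex[OF unital_quotient(1)] by blast
    then have "w \<in> unit_ball_extremes" using v by (simp add: E)
    then show "v \<in> unit_coord ` (unit_ball_extremes :: 'b unitization set)" using w by blast
  qed (auto simp: E)
  then have "unit_coord ` (unit_ball_extremes :: 'b unitization set) = unit_ball_extremes" by blast
  moreover have "unital_extension (busby \<iota> \<eta>) ` S = busby \<iota> \<eta> ` unit_coord ` S" for S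
    by (simp add: unital_extension_busby image_image)
  ultimately show ?thesis by (simp add: extreme_point_preserving_def)
qed

end

end

theorem corollary4p4:
  fixes \<iota> :: "'i::cstar_algebra \<Rightarrow> 'a::cstar_algebra"
    and \<eta> :: "'a \<Rightarrow> 'b::cstar_algebra"
    and \<tau> :: "'b \<Rightarrow> 'i corona"
  assumes "cstar_extension \<iota> \<eta>"
    and "\<tau> = busby \<iota> \<eta>"
  shows
    "tsr TYPE('a) \<le> max (tsr TYPE('b)) (tsr TYPE('i multiplier)) \<and>
     (real_rank_zero TYPE('b) \<and> real_rank_zero TYPE('i multiplier) \<longrightarrow> real_rank_zero TYPE('a)) \<and>
     (extremally_rich TYPE('b) \<and> extremally_rich TYPE('i multiplier) \<longrightarrow>
       (if unital TYPE('a) then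
          (extreme_point_preserving \<tau> \<longleftrightarrow> \<eta> ` unit_ball_extremes = unit_ball_extremes) \<and>
          (\<eta> ` unit_ball_extremes = unit_ball_extremes \<longleftrightarrow> extremally_rich TYPE('a))
        else
          (extreme_point_preserving (unital_extension \<tau>) \<longleftrightarrow>
             unitization_map \<eta> ` unit_ball_extremes = unit_ball_extremes) \<and>
          (unitization_map \<eta> ` unit_ball_extremes = unit_ball_extremes \<longleftrightarrow>
             extremally_rich TYPE('a))))"
proof (intro conjI impI)
  interpret cstar_pullback "unitization_map \<eta>" "unital_extension (ideal_action \<iota>)" abs_corona
    "unital_extension (busby \<iota> \<eta>)" by (rule cstar_pullback_extension[OF assms(1)])
  \<comment> \<open>\<open>M(I)\<close> is unital, so all three definitions take their unital branch
    and it is never unitized.\<close>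
  have M: "tsr TYPE('i multiplier) = tsr_unital TYPE('i multiplier)"
    "real_rank_zero TYPE('i multiplier) \<longleftrightarrow> real_rank_zero_unital TYPE('i multiplier)"
    "extremally_rich TYPE('i multiplier) \<longleftrightarrow> extremally_rich_unital TYPE('i multiplier)"
    by (simp_all add: tsr_def real_rank_zero_def extremally_rich_def unital_cstar_algebra_1)
  show "tsr TYPE('a) \<le> max (tsr TYPE('b)) (tsr TYPE('i multiplier))"
    unfolding M tsr_eq_unitization[where 'a='a] tsr_eq_unitization[where 'a='b] by (rule tsr_pullback)
  show "real_rank_zero TYPE('a)" if "real_rank_zero TYPE('b) \<and> real_rank_zero TYPE('i multiplier)"
    using that real_rank_zero_pullback
    unfolding M real_rank_zero_iff_unitization[where 'a='a] real_rank_zero_iff_unitization[where 'a='b]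
    by blast
  assume "extremally_rich TYPE('b) \<and> extremally_rich TYPE('i multiplier)"
  then have R: "extremally_rich_unital TYPE('b unitization)"
    "extremally_rich_unital TYPE('i multiplier)"
    by (simp_all only: M extremally_rich_iff_unitization[where 'a='b])
  note * = extremally_rich_extension[OF assms(1) R]
  show "if unital TYPE('a) then
      (extreme_point_preserving \<tau> \<longleftrightarrow> \<eta> ` unit_ball_extremes = unit_ball_extremes) \<and>
      (\<eta> ` unit_ball_extremes = unit_ball_extremes \<longleftrightarrow> extremally_rich TYPE('a))
    else
      (extreme_point_preserving (unital_extension \<tau>) \<longleftrightarrow>
         unitization_map \<eta> ` unit_ball_extremes = unit_ball_extremes) \<and>
      (unitization_map \<eta> ` unit_ball_extremes = unit_ball_extremes \<longleftrightarrow> extremally_rich TYPE('a))"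
  proof (cases "unital TYPE('a)")
    case True
    then show ?thesis
      using * unitization_extremes_iff[OF assms(1) True] busby_extreme_point_preserving_iff[OF assms(1) True]
      unfolding assms(2) extremally_rich_iff_unitization[where 'a='a] by simp
  next
    case False
    then show ?thesis
      using * unfolding assms(2) extremally_rich_iff_unitization[where 'a='a] by simp
  qed
qed

end
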